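(* Let $d\ge5$ and let $n$ be a positive integer. For $N>0$ with $N^2\in\mathbb{Z}$ let $\mathcal{F}_{d,N}=\{\mathbf{k}\in\mathbb{Z}^d:|\mathbf{k}|=N\}$, and let $$E_n(\mathcal{F}_{d,N})=\#\{(a_1,\dots,a_{2n})\in(\mathcal{F}_{d,N})^{2n}:\ a_1+\dots+a_n=a_{n+1}+\dots+a_{2n}\}.$$ (A) We have $E_n(\mathcal{F}_{d,N})\sim N^{2n(d-2)-d}$ when one of the following holds: (1) $d\ge 9$; (2) $d\in\{7,8\}$ and $n\ge 3$; (3) $d=6$ and $n\ge 4$; (4) $d=5$ and $n\ge 6$. That is, in these cases there are constants $0<c\le C$, independent of $N$ (but allowed to depend on $d$ and $n$), such that $$c\,N^{2n(d-2)-d}\le E_n(\mathcal{F}_{d,N})\le C\,N^{2n(d-2)-d}.$$ (B) Additionally, the upper bound holds with an extra factor $(\log N)^{\frac{d-2}{d-4}}$ if one of the following holds: (1) $d\in\{7,8\}$ and $n=2$; (2) $d=6$ and $n=3$; (3) $d=5$ and $n\in\{4,5\}$. That is, in these cases there is a constant $C$, independent of $N$ (but allowed to depend on $d$ and $n$), such that for $N>1$ $$E_n(\mathcal{F}_{d,N})\le C\,(\log N)^{\frac{d-2}{d-4}}\,N^{2n(d-2)-d}.$$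
   Context: $|\mathbf{k}|$ denotes the Euclidean norm and $\#$ denotes cardinality. $A\sim B$ means that each of $A$, $B$ is bounded by a constant times the other, with constants independent of $N$.
   Formalization: In case (A)(1), d≥9, the two-sided bound is stated for n≥2; for n=1 only the lower bound is stated, because E_1 equals the number of points of F_{d,N}, which is at least of order N^{d-2}, so the upper bound N^{d-4} is false. *)

theory Defs
  imports "HOL-Analysis.Analysis"
begin

definition lattice_sphere :: "real \<Rightarrow> (real ^ 'd) set" where
  "lattice_sphere N = {k. (\<forall>i. k $ i \<in> \<int>) \<and> norm k = N}"

text \<open>
  The tuples \<open>(a\<^sub>1, \<dots>, a\<^sub>2\<^sub>n)\<close> are extensional functions on \<open>{1..2 * n}\<close>, so that each
  tuple is counted exactly once.
\<close>
definition additive_energy :: "nat \<Rightarrow> 'a::comm_monoid_add set \<Rightarrow> nat" where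
  "additive_energy n A =
     card {a \<in> {1..2 * n} \<rightarrow>\<^sub>E A. (\<Sum>i = 1..n. a i) = (\<Sum>i = n + 1..2 * n. a i)}"

end

theory Submission
  imports Defs
begin

text \<open>
  Write \<open>F\<close> for the set of lattice points of norm \<open>N\<close> and \<open>f(\<theta>)\<close> for the exponential sum
  \<open>\<Sum>a\<in>F. e(a \<bullet> \<theta>)\<close>. The energy is the moment \<open>\<integral> \<bar>f\<bar>\<^sup>2\<^sup>n\<close>, and
  everything rests on detecting the equation \<open>\<bar>a\<bar>\<^sup>2 = N\<^sup>2\<close> by a second integral:
  \<open>f(\<theta>) = \<integral> e(-\<alpha> N\<^sup>2) \<Prod>\<^sub>j S(\<alpha>, \<theta>\<^sub>j) d\<alpha>\<close>, where
  \<open>S(\<alpha>, \<theta>) = \<Sum>x. w(x) e(\<alpha> x\<^sup>2 + \<theta> x)\<close> is a smoothed quadratic Weyl sum of length about \<open>N\<close>.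

  \<^emph>\<open>Upper bound.\<close> Weyl differencing bounds \<open>S(\<alpha>, \<theta>)\<close> by a constant times \<open>N v(\<alpha>)\<close>,
  uniformly in \<open>\<theta>\<close> and without loss of a logarithm
  (\<open>weyl_sum_bound\<close>). A value \<open>v(\<alpha>) > y\<close> forces \<open>\<alpha>\<close> to be very close to a rational of denominator
  at most about \<open>y\<^sup>-\<^sup>2\<close>, and counting these rationals shows that \<open>{v > y}\<close> has measure at most a
  constant times \<open>y\<^sup>-\<^sup>4 N\<^sup>-\<^sup>2\<close> (\<open>card_near_integer_count_ge\<close>). Cut the \<open>\<alpha>\<close>-integral into the level sets
  \<open>v \<approx> y\<close>. The corresponding piece of \<open>f\<close> has supremum at most a constant times the measure of the
  level set times \<open>(N y)\<^sup>d\<close>, that is \<open>N\<^sup>d\<^sup>-\<^sup>2 y\<^sup>d\<^sup>-\<^sup>4\<close>. By Parseval its squared mean is at most the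
  measure of the level set times \<open>\<integral> \<bar>S(\<alpha>, 0)\<bar>\<^sup>d d\<alpha>\<close>; the integral is of order \<open>N\<^sup>d\<^sup>-\<^sup>2\<close>
  because \<open>d > 4\<close>, and the product is of order \<open>N\<^sup>d\<^sup>-\<^sup>4 y\<^sup>-\<^sup>4\<close>. Hence
  the \<open>2n\<close>-th moment of the piece, at most its supremum to the power \<open>2n-2\<close> times its squared mean,
  is of order \<open>N\<^sup>2\<^sup>n\<^sup>(\<^sup>d\<^sup>-\<^sup>2\<^sup>)\<^sup>-\<^sup>d\<close> times \<open>y\<close> to the power \<open>2((n-1)(d-4) - 2)\<close>. These bounds form
  a geometric series over the scales \<open>y\<close> when \<open>(n-1)(d-4) \<ge> 3\<close> (\<open>interpolation\<close>,
  \<open>energy_upper_bound\<close>), and this inequality holds in each case in which an upper bound is claimed.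
  The logarithmic form of the bound follows since \<open>N > 1\<close> and \<open>N\<^sup>2 \<in> \<int>\<close> give \<open>N\<^sup>2 \<ge> 2\<close>,
  which keeps \<open>ln N\<close> away from zero.

  \<^emph>\<open>Lower bound.\<close> The \<open>#F\<^sup>n\<close> sums of \<open>n\<close> points of \<open>F\<close> lie among at most a constant times \<open>N\<^sup>d\<close>
  lattice points, so by Cauchy-Schwarz the energy is at least a constant times \<open>#F\<^sup>2\<^sup>n / N\<^sup>d\<close>
  (\<open>additive_energy_lower\<close>). It remains to see that \<open>#F\<close> is at least of order \<open>N\<^sup>d\<^sup>-\<^sup>2\<close>: choose
  all but four coordinates so small that the rest \<open>k\<close> of \<open>N\<^sup>2\<close> is at least \<open>N\<^sup>2 / 2\<close>,
  with parities that make \<open>k\<close> odd; an odd \<open>k\<close>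
  is a sum of four squares in at least \<open>8k\<close> ways (\<open>four_squares_lower_bound\<close>). This part of Jacobi's
  theorem is proved by showing that the number of representations as a sum of four odd squares and a divisor sum
  satisfy the same recurrence.

  Integrals over \<open>\<alpha>\<close> and \<open>\<theta>\<close> are replaced by averages over fractions with
  a common denominator \<open>M = 4dR\<^sup>2\<close>, where \<open>R = \<lceil>N\<rceil>\<close>. With this choice the average over \<open>\<alpha>\<close> still
  detects \<open>\<bar>a\<bar>\<^sup>2 = N\<^sup>2\<close> exactly, while the average over \<open>\<theta>\<close> turns the equation that defines the
  energy into a congruence modulo \<open>M\<close>, which can only enlarge the count.
\<close>

section \<open>Sums of four squares\<close>

definition odd_reps :: "int \<Rightarrow> (int \<times> int \<times> int \<times> int) set" where
  "odd_reps N = {(a, b, c, d). odd a \<and> odd b \<and> odd c \<and> odd d \<and> a\<^sup>2 + b\<^sup>2 + c\<^sup>2 + d\<^sup>2 = N}"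

text \<open>
  The sum of the first components over this set is \<open>\<sigma>(u)\<close> when \<open>N = 4u\<close> with \<open>u\<close> odd and positive,
  and \<open>0\<close> for every other \<open>N\<close>. Indexing by \<open>N\<close> rather than \<open>u\<close> makes
  both recurrences below run over the same set of odd \<open>x\<close>.
\<close>
definition odd_factorizations :: "int \<Rightarrow> (int \<times> int) set" where
  "odd_factorizations N = {(p, q). odd p \<and> odd q \<and> 0 < p \<and> 0 < q \<and> 4 * p * q = N}"

lemma abs_le_square_int: "\<bar>x\<bar> \<le> x\<^sup>2" for x :: int
proof (cases "x = 0")
  case False
  then have "\<bar>x\<bar> * 1 \<le> \<bar>x\<bar> * \<bar>x\<bar>" by (intro mult_left_mono) auto
  then show ?thesis by (simp add: power2_eq_square flip: abs_mult)
qed auto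

lemma finite_odd_reps: "finite (odd_reps N)"
proof (rule finite_subset)
  show "odd_reps N \<subseteq> {-N..N} \<times> {-N..N} \<times> {-N..N} \<times> {-N..N}"
  proof safe
    fix a b c d assume "(a, b, c, d) \<in> odd_reps N"
    then have eq: "a\<^sup>2 + b\<^sup>2 + c\<^sup>2 + d\<^sup>2 = N" by (simp add: odd_reps_def)
    have "\<bar>a\<bar> \<le> N" "\<bar>b\<bar> \<le> N" "\<bar>c\<bar> \<le> N" "\<bar>d\<bar> \<le> N"
      using eq abs_le_square_int[of a] abs_le_square_int[of b] abs_le_square_int[of c]
        abs_le_square_int[of d] by (smt (verit) zero_le_power2)+
    then show "a \<in> {-N..N}" "b \<in> {-N..N}" "c \<in> {-N..N}" "d \<in> {-N..N}" by auto
  qed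
qed auto

lemma odd_factorizations_subset: "odd_factorizations N \<subseteq> {1..N} \<times> {1..N}"
proof safe
  fix p q assume "(p, q) \<in> odd_factorizations N"
  then have *: "0 < p" "0 < q" "4 * p * q = N" by (auto simp: odd_factorizations_def)
  have "p * 1 \<le> p * q" "1 * q \<le> p * q"
    using * by (auto intro!: mult_left_mono mult_right_mono)
  with * show "p \<in> {1..N}" "q \<in> {1..N}" by auto
qed

lemma finite_odd_factorizations: "finite (odd_factorizations N)"
  by (rule finite_subset[OF odd_factorizations_subset]) auto

text \<open>
  Count the ways to write \<open>n\<close> as a sum of five odd squares \<open>x\<^sup>2 + a\<^sup>2 + b\<^sup>2 + c\<^sup>2 + d\<^sup>2\<close>, with weight
  \<open>n - 5x\<^sup>2\<close>. The five coordinates play the same role, so \<open>x\<^sup>2\<close> may be replaced by the average \<open>n / 5\<close> and the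
  weights cancel.
\<close>
lemma odd_squares_recurrence:
  fixes n :: int
  defines "X \<equiv> {x. odd x \<and> \<bar>x\<bar> \<le> n}"
  shows "(\<Sum>x\<in>X. (n - 5 * x\<^sup>2) * int (card (odd_reps (n - x\<^sup>2)))) = 0"
proof -
  have finX: "finite X"
    by (rule finite_subset[of _ "{-n..n}"]) (auto simp: X_def)
  define Y where "Y = (SIGMA x:X. odd_reps (n - x\<^sup>2))"
  have Y: "Y = {(x, a, b, c, d). odd x \<and> odd a \<and> odd b \<and> odd c \<and> odd d \<and>
             x\<^sup>2 + a\<^sup>2 + b\<^sup>2 + c\<^sup>2 + d\<^sup>2 = n}"
  proof -
    have "\<bar>x\<bar> \<le> n" if "x\<^sup>2 + a\<^sup>2 + b\<^sup>2 + c\<^sup>2 + d\<^sup>2 = n" for x a b c d :: int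
      using that abs_le_square_int[of x] by (smt (verit) zero_le_power2)
    then show ?thesis by (auto simp: Y_def X_def odd_reps_def)
  qed
  let ?s = "\<lambda>g. \<Sum>(x, a, b, c, d)\<in>Y. (g x a b c d :: int)"
  have 1: "?s (\<lambda>x a b c d. a\<^sup>2) = ?s (\<lambda>x a b c d. x\<^sup>2)"
    by (rule sum.reindex_bij_witness[of _ "\<lambda>(x,a,b,c,d). (a,x,b,c,d)" "\<lambda>(x,a,b,c,d). (a,x,b,c,d)"])
       (auto simp: Y algebra_simps)
  have 2: "?s (\<lambda>x a b c d. b\<^sup>2) = ?s (\<lambda>x a b c d. x\<^sup>2)"
    by (rule sum.reindex_bij_witness[of _ "\<lambda>(x,a,b,c,d). (b,a,x,c,d)" "\<lambda>(x,a,b,c,d). (b,a,x,c,d)"])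
       (auto simp: Y algebra_simps)
  have 3: "?s (\<lambda>x a b c d. c\<^sup>2) = ?s (\<lambda>x a b c d. x\<^sup>2)"
    by (rule sum.reindex_bij_witness[of _ "\<lambda>(x,a,b,c,d). (c,a,b,x,d)" "\<lambda>(x,a,b,c,d). (c,a,b,x,d)"])
       (auto simp: Y algebra_simps)
  have 4: "?s (\<lambda>x a b c d. d\<^sup>2) = ?s (\<lambda>x a b c d. x\<^sup>2)"
    by (rule sum.reindex_bij_witness[of _ "\<lambda>(x,a,b,c,d). (d,a,b,c,x)" "\<lambda>(x,a,b,c,d). (d,a,b,c,x)"])
       (auto simp: Y algebra_simps)
  have "?s (\<lambda>x a b c d. n) = ?s (\<lambda>x a b c d. x\<^sup>2 + a\<^sup>2 + b\<^sup>2 + c\<^sup>2 + d\<^sup>2)"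
    by (rule sum.cong) (auto simp: Y)
  also have "\<dots> = 5 * ?s (\<lambda>x a b c d. x\<^sup>2)"
    using 1 2 3 4 by (simp add: case_prod_unfold sum.distrib)
  finally have "?s (\<lambda>x a b c d. n - 5 * x\<^sup>2) = 0"
    by (simp add: case_prod_unfold sum_subtractf sum_distrib_left)
  also have "?s (\<lambda>x a b c d. n - 5 * x\<^sup>2) = (\<Sum>x\<in>X. \<Sum>v\<in>odd_reps (n - x\<^sup>2). n - 5 * x\<^sup>2)"
    unfolding Y_def
    by (subst sum.Sigma[OF finX]) (auto simp: finite_odd_reps case_prod_unfold)
  finally show ?thesis by (simp add: mult.commute)
qed

text \<open>
  A solution of \<open>x\<^sup>2 + 4pq = n\<close> is a binary quadratic form \<open>p X\<^sup>2 + x X Y - q Y\<^sup>2\<close> of discriminant \<open>n\<close>.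
  The values \<open>p\<close>, \<open>-q\<close>, \<open>p + x - q\<close> of the form at \<open>(1,0)\<close>, \<open>(0,1)\<close>, \<open>(1,1)\<close> are permuted by a group
  \<open>S\<^sub>3\<close> of substitutions, and \<open>\<psi>\<close> below is up to sign the product of their differences. Hence \<open>\<psi>\<close> changes sign
  under the substitution \<open>(X, Y) \<mapsto> (X, X - Y)\<close>, which is an involution of the solutions with
  \<open>p + x > q\<close>, and the sum of \<open>\<psi>\<close> over these vanishes. The remaining solutions are mirrored onto them, so the
  total sum of \<open>\<psi>\<close> vanishes. By the symmetries \<open>x \<mapsto> -x\<close> and \<open>p \<leftrightarrow> q\<close> of the solutions this
  total is a multiple of the sum in the recurrence.
\<close>
lemma odd_divisor_sum_recurrence:
  fixes n :: int
  defines "X \<equiv> {x. odd x \<and> \<bar>x\<bar> \<le> n}"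
  shows "(\<Sum>x\<in>X. (n - 5 * x\<^sup>2) * (\<Sum>(p, q)\<in>odd_factorizations (n - x\<^sup>2). p)) = 0"
proof -
  have finX: "finite X"
    by (rule finite_subset[of _ "{-n..n}"]) (auto simp: X_def)
  define Y where "Y = (SIGMA x:X. odd_factorizations (n - x\<^sup>2))"
  have finY: "finite Y" unfolding Y_def using finX finite_odd_factorizations by auto
  have Y: "Y = {(x, p, q). odd x \<and> odd p \<and> odd q \<and> 0 < p \<and> 0 < q \<and> x\<^sup>2 + 4 * p * q = n}"
  proof -
    have "\<bar>x\<bar> \<le> n" if "x\<^sup>2 + 4 * p * q = n" "0 < p" "0 < q" for x p q :: int
      using that abs_le_square_int[of x] mult_pos_pos[of p q] by linarith
    then show ?thesis by (auto simp: Y_def X_def odd_factorizations_def)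
  qed
  let ?s = "\<lambda>g. \<Sum>(x, p, q)\<in>Y. (g x p q :: int)"
  define \<psi> :: "int \<Rightarrow> int \<Rightarrow> int \<Rightarrow> int" where "\<psi> = (\<lambda>x p q. (p + q) * (p + x) * (q - x))"
  define A where "A = {(x, p, q) \<in> Y. q < p + x}"
  define A' where "A' = {(x, p, q) \<in> Y. p + x < q}"
  have "(\<Sum>(x, p, q)\<in>A. \<psi> x p q) = (\<Sum>(x, p, q)\<in>A. - \<psi> x p q)"
    by (rule sum.reindex_bij_witness[of _ "\<lambda>(x,p,q). (2*q-x,p+x-q,q)" "\<lambda>(x,p,q). (2*q-x,p+x-q,q)"])
       (auto simp: A_def Y \<psi>_def algebra_simps power2_eq_square)
  then have A: "(\<Sum>(x, p, q)\<in>A. \<psi> x p q) = 0"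
    by (simp add: case_prod_unfold sum_negf)
  have "(\<Sum>(x, p, q)\<in>A'. \<psi> x p q) = (\<Sum>(x, p, q)\<in>A. \<psi> x p q)"
    by (rule sum.reindex_bij_witness[of _ "\<lambda>(x,p,q). (-x,q,p)" "\<lambda>(x,p,q). (-x,q,p)"])
       (auto simp: A_def A'_def Y \<psi>_def algebra_simps power2_eq_square)
  \<comment> \<open>The case \<open>p + x = q\<close> cannot occur, since \<open>p + x\<close> is even and \<open>q\<close> is odd.\<close>
  moreover have "Y = A \<union> A'"
  proof -
    have "q \<noteq> p + x" if "odd x" "odd p" "odd q" for x p q :: int using that by auto
    then show ?thesis by (auto simp: A_def A'_def Y) (metis linorder_neqE)
  qed
  moreover have "A \<inter> A' = {}" by (auto simp: A_def A'_def)
  moreover have "finite A" "finite A'"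
    by (rule finite_subset[OF _ finY]; auto simp: A_def A'_def)+
  ultimately have \<psi>0: "?s \<psi> = 0" using A by (simp add: sum.union_disjoint)
  have "?s (\<lambda>x p q. \<psi> (-x) p q) = ?s \<psi>"
    by (rule sum.reindex_bij_witness[of _ "\<lambda>(x,p,q). (-x,p,q)" "\<lambda>(x,p,q). (-x,p,q)"])
       (auto simp: Y)
  with \<psi>0 have "0 = ?s (\<lambda>x p q. \<psi> x p q + \<psi> (-x) p q)"
    by (simp add: case_prod_unfold sum.distrib)
  also have "\<dots> = ?s (\<lambda>x p q. 2 * (p * (p * q - x\<^sup>2)) + 2 * (q * (p * q - x\<^sup>2)))"
    by (rule sum.cong) (auto simp: \<psi>_def algebra_simps power2_eq_square)
  also have "\<dots> = 2 * ?s (\<lambda>x p q. p * (p * q - x\<^sup>2)) + 2 * ?s (\<lambda>x p q. q * (p * q - x\<^sup>2))"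
    by (simp add: case_prod_unfold sum.distrib sum_distrib_left)
  also have "?s (\<lambda>x p q. q * (p * q - x\<^sup>2)) = ?s (\<lambda>x p q. p * (p * q - x\<^sup>2))"
    by (rule sum.reindex_bij_witness[of _ "\<lambda>(x,p,q). (x,q,p)" "\<lambda>(x,p,q). (x,q,p)"])
       (auto simp: Y algebra_simps)
  finally have "0 = 4 * ?s (\<lambda>x p q. p * (p * q - x\<^sup>2))" by simp
  also have "\<dots> = ?s (\<lambda>x p q. (n - 5 * x\<^sup>2) * p)"
    unfolding case_prod_unfold sum_distrib_left
    by (rule sum.cong) (auto simp: Y algebra_simps power2_eq_square)
  also have "\<dots> = (\<Sum>x\<in>X. \<Sum>(p, q)\<in>odd_factorizations (n - x\<^sup>2). (n - 5 * x\<^sup>2) * p)"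
    unfolding Y_def
    by (subst sum.Sigma[OF finX]) (auto simp: finite_odd_factorizations case_prod_unfold)
  finally show ?thesis by (simp add: sum_distrib_left case_prod_unfold)
qed

text \<open>
  Both sides satisfy \<open>\<Sum>x. (n - 5x\<^sup>2) g(n - x\<^sup>2) = 0\<close>, the sum running over odd \<open>x\<close>. For \<open>n = N + 1\<close> the
  terms \<open>x = 1\<close> and \<open>x = -1\<close> contribute \<open>2(N - 4) g(N)\<close> and all other terms involve smaller arguments. As \<open>g\<close>
  vanishes on arguments that are not positive, the recurrence determines \<open>g\<close> from its value at \<open>4\<close>.
\<close>
theorem card_odd_reps:
  "int (card (odd_reps N)) = 16 * (\<Sum>(p, q)\<in>odd_factorizations N. p)"
proof -
  have nonpos: "odd_reps N = {} \<and> odd_factorizations N = {}" if "N \<le> 0" for N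
  proof
  show "odd_reps N = {}"
  proof (rule ccontr)
    assume "odd_reps N \<noteq> {}"
    then obtain a b c d where "odd a" "a\<^sup>2 + b\<^sup>2 + c\<^sup>2 + d\<^sup>2 = N" by (auto simp: odd_reps_def)
    moreover from this have "a\<^sup>2 > 0" by auto
    ultimately show False using that by (smt (verit) zero_le_power2)
  qed
  show "odd_factorizations N = {}" using odd_factorizations_subset[of N] that by auto
  qed
  have ?thesis if "N \<ge> 1"
    using that
  proof (induction "nat N" arbitrary: N rule: less_induct)
    case less
    let ?D = "\<lambda>N. int (card (odd_reps N)) - 16 * (\<Sum>(p, q)\<in>odd_factorizations N. p)"
    define X where "X = {x::int. odd x \<and> \<bar>x\<bar> \<le> N + 1}"
    have finX: "finite X" by (rule finite_subset[of _ "{-(N+1)..N+1}"]) (auto simp: X_def)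
    have sub: "{1, -1} \<subseteq> X" using less by (auto simp: X_def)
    define G where "G = (\<lambda>x. ((N + 1) - 5 * x\<^sup>2) * ?D ((N + 1) - x\<^sup>2))"
    have "sum G X = 0"
    proof -
      have "(\<Sum>x\<in>X. f x * (A x - 16 * B x)) = (\<Sum>x\<in>X. f x * A x) - 16 * (\<Sum>x\<in>X. f x * B x)"
        for f A B :: "int \<Rightarrow> int"
        by (simp add: right_diff_distrib sum_subtractf sum_distrib_left mult.left_commute)
      then show ?thesis
        using odd_squares_recurrence[of "N + 1"] odd_divisor_sum_recurrence[of "N + 1"]
        unfolding X_def G_def by simp
    qed
    then have "0 = G 1 + G (-1) + sum G (X - {1, -1})"
      using sum.subset_diff[OF sub finX, of G] by simp
    also have "sum G (X - {1, -1}) = 0"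
    proof (intro sum.neutral ballI)
      fix x assume x: "x \<in> X - {1, -1}"
      then have "odd x" "x \<noteq> 1" "x \<noteq> -1" by (auto simp: X_def)
      then have "\<bar>x\<bar> \<ge> 2" by presburger
      then have "x\<^sup>2 > 1" using abs_le_square_int[of x] by linarith
      then have lt: "(N + 1) - x\<^sup>2 < N" by simp
      have "?D ((N + 1) - x\<^sup>2) = 0"
      proof (cases "(N + 1) - x\<^sup>2 \<le> 0")
        case True
        then show ?thesis using nonpos by simp
      next
        case False
        then show ?thesis using less.hyps[of "(N + 1) - x\<^sup>2"] lt by simp
      qed
      then show "G x = 0" by (simp add: G_def)
    qed
    finally have *: "(N - 4) * ?D N = 0" by (simp add: G_def)
    show ?case
    proof (cases "N = 4")
      case False
      then show ?thesis using * by simp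
    next
      case True
      have odd_reps_4: "(a, b, c, d) \<in> {1,-1} \<times> {1,-1} \<times> {1,-1} \<times> {1,-1}"
        if "(a, b, c, d) \<in> odd_reps 4" for a b c d
      proof -
        have o: "odd a" "odd b" "odd c" "odd d" and eq: "a\<^sup>2 + b\<^sup>2 + c\<^sup>2 + d\<^sup>2 = 4"
          using that by (auto simp: odd_reps_def)
        have pos: "x\<^sup>2 \<ge> 1" if "odd x" for x :: int
          using that abs_le_square_int[of x] by (cases "x = 0") auto
        have "a\<^sup>2 = 1" "b\<^sup>2 = 1" "c\<^sup>2 = 1" "d\<^sup>2 = 1"
          using eq pos[OF o(1)] pos[OF o(2)] pos[OF o(3)] pos[OF o(4)] by linarith+
        then have "a \<in> {1,-1}" "b \<in> {1,-1}" "c \<in> {1,-1}" "d \<in> {1,-1}"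
          by (simp_all only: power2_eq_1_iff insert_iff empty_iff simp_thms)
        then show ?thesis by (intro SigmaI)
      qed
      have "odd_reps 4 = {1,-1} \<times> {1,-1} \<times> {1,-1} \<times> {1,-1}" (is "_ = ?Q")
      proof (rule equalityI)
        show "?Q \<subseteq> odd_reps 4" by (auto simp: odd_reps_def)
        show "odd_reps 4 \<subseteq> ?Q"
        proof
          fix v :: "int \<times> int \<times> int \<times> int"
          assume v: "v \<in> odd_reps 4"
          obtain a b c d where "v = (a, b, c, d)" by (rule prod_cases4)
          then show "v \<in> ?Q" using odd_reps_4[of a b c d] v by simp
        qed
      qed
      moreover have "odd_factorizations 4 = {(1, 1)}"
      proof safe
        fix p q :: int
        assume "(p, q) \<in> odd_factorizations 4"
        then have *: "0 < p" "0 < q" "p * q = 1" by (auto simp: odd_factorizations_def)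
        then show "p = 1" "q = 1" by (simp_all add: pos_zmult_eq_1_iff)
      qed (auto simp: odd_factorizations_def)
      ultimately show ?thesis using True by (simp add: card_cartesian_product)
    qed
  qed
  then show ?thesis using nonpos[of N] by (cases "N \<ge> 1") auto
qed

text \<open>
  Half of the representations of \<open>4k\<close> as a sum of four odd squares have a coordinate sum divisible by four,
  as changing the sign of one coordinate shows. On these the \<open>4 \<times> 4\<close> Hadamard matrix divided by \<open>4\<close> has integral
  values, is injective, and divides the sum of squares by four.
\<close>
lemma four_squares_lower_bound:
  fixes k :: int
  assumes "odd k" "k > 0"
  shows "8 * k \<le> int (card {(a, b, c, d). a\<^sup>2 + b\<^sup>2 + c\<^sup>2 + d\<^sup>2 = k})"
proof -
  define V where "V = (\<lambda>r. {(a, b, c, d) \<in> odd_reps (4 * k). (a + b + c + d) mod 4 = r})"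
  define T where "T = {(a, b, c, d). a\<^sup>2 + b\<^sup>2 + c\<^sup>2 + d\<^sup>2 = k}"
  have finV: "finite (V r)" for r
    by (rule finite_subset[OF _ finite_odd_reps[of "4 * k"]]) (auto simp: V_def)
  have finT: "finite T"
  proof (rule finite_subset)
    show "T \<subseteq> {-k..k} \<times> {-k..k} \<times> {-k..k} \<times> {-k..k}"
    proof safe
      fix a b c d assume "(a, b, c, d) \<in> T"
      then have eq: "a\<^sup>2 + b\<^sup>2 + c\<^sup>2 + d\<^sup>2 = k" by (simp add: T_def)
      have "\<bar>a\<bar> \<le> k" "\<bar>b\<bar> \<le> k" "\<bar>c\<bar> \<le> k" "\<bar>d\<bar> \<le> k"
        using eq abs_le_square_int[of a] abs_le_square_int[of b] abs_le_square_int[of c]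
          abs_le_square_int[of d] by (smt (verit) zero_le_power2)+
      then show "a \<in> {-k..k}" "b \<in> {-k..k}" "c \<in> {-k..k}" "d \<in> {-k..k}" by auto
    qed
  qed auto
  have "odd_reps (4 * k) = V 0 \<union> V 2"
  proof -
    have "s mod 4 = 0 \<or> s mod 4 = 2" if "even s" for s :: int using that by presburger
    then have "(a + b + c + d) mod 4 = 0 \<or> (a + b + c + d) mod 4 = 2"
      if "odd a" "odd b" "odd c" "odd d" for a b c d :: int
      using that by simp
    then have "v \<in> odd_reps (4 * k) \<longleftrightarrow> v \<in> V 0 \<union> V 2" for v
      by (cases v) (simp add: V_def odd_reps_def, metis)
    then show ?thesis by blast
  qed
  moreover have "V 0 \<inter> V 2 = {}" by (auto simp: V_def)
  ultimately have "card (odd_reps (4 * k)) = card (V 0) + card (V 2)"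
    using finV by (simp add: card_Un_disjoint)
  also have "card (V 2) = card (V 0)"
  proof (rule bij_betw_same_card[of "\<lambda>(a, b, c, d). (-a, b, c, d)"])
    have flip: "(s - 2 * a) mod 4 = 2 \<longleftrightarrow> s mod 4 = 0" "(s - 2 * a) mod 4 = 0 \<longleftrightarrow> s mod 4 = 2"
      if "odd a" for a s :: int
      using that by presburger+
    have m: "(- a + b + c + d) mod 4 = 2 \<longleftrightarrow> (a + b + c + d) mod 4 = 0"
      and m': "(- a + b + c + d) mod 4 = 0 \<longleftrightarrow> (a + b + c + d) mod 4 = 2" if "odd a" for a b c d :: int
    proof -
      have "- a + b + c + d = (a + b + c + d) - 2 * a" by simp
      then show "(- a + b + c + d) mod 4 = 2 \<longleftrightarrow> (a + b + c + d) mod 4 = 0"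
        "(- a + b + c + d) mod 4 = 0 \<longleftrightarrow> (a + b + c + d) mod 4 = 2"
        using flip[OF that, of "a + b + c + d"] by metis+
    qed
    have V0: "(-a, b, c, d) \<in> V 0 \<longleftrightarrow> (a, b, c, d) \<in> V 2"
      and V2: "(-a, b, c, d) \<in> V 2 \<longleftrightarrow> (a, b, c, d) \<in> V 0" for a b c d
    proof -
      show "(-a, b, c, d) \<in> V 0 \<longleftrightarrow> (a, b, c, d) \<in> V 2"
        by (cases "odd a") (simp_all only: m' V_def odd_reps_def mem_Collect_eq
            case_prod_conv even_minus power2_minus not_False_eq_True simp_thms)
      show "(-a, b, c, d) \<in> V 2 \<longleftrightarrow> (a, b, c, d) \<in> V 0"
        by (cases "odd a") (simp_all only: m V_def odd_reps_def mem_Collect_eq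
            case_prod_conv even_minus power2_minus not_False_eq_True simp_thms)
    qed
    show "bij_betw (\<lambda>(a, b, c, d). (-a, b, c, d)) (V 2) (V 0)"
    proof (rule bij_betwI[where g = "\<lambda>(a, b, c, d). (-a, b, c, d)"])
      show "(\<lambda>(a, b, c, d). (- a, b, c, d)) \<in> V 2 \<rightarrow> V 0"
        by (rule funcsetI) (auto simp only: V0 case_prod_conv split_paired_all)
      show "(\<lambda>(a, b, c, d). (- a, b, c, d)) \<in> V 0 \<rightarrow> V 2"
        by (rule funcsetI) (auto simp only: V2 case_prod_conv split_paired_all)
    qed (simp_all add: case_prod_unfold)
  qed
  also have "card (V 0) \<le> card T"
  proof (rule card_inj_on_le[OF _ _ finT])
    let ?h = "\<lambda>(a, b, c, d). ((a + b + c + d) div 4, (a + b - c - d) div 4,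
        (a - b + c - d) div 4, (a - b - c + d) div (4::int))"
    have dv: "4 dvd a + b + c + d \<and> 4 dvd a + b - c - d \<and> 4 dvd a - b + c - d \<and> 4 dvd a - b - c + d"
      if "odd a" "odd b" "odd c" "odd d" "(a + b + c + d) mod 4 = 0" for a b c d :: int
    proof -
      have 4: "4 dvd s - 2 * (x + y)" if "odd x" "odd y" "4 dvd s" for s x y :: int
      proof (rule dvd_diff[OF that(3)])
        have "even (x + y)" using that by simp
        then obtain z where "x + y = 2 * z" by (elim evenE)
        then show "4 dvd 2 * (x + y)" by simp
      qed
      have s: "4 dvd a + b + c + d" using that(5) by (simp add: dvd_eq_mod_eq_0)
      show ?thesis
        using s 4[OF that(3,4) s] 4[OF that(2,4) s] 4[OF that(2,3) s] by (simp add: algebra_simps)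
    qed
    have ex: "\<exists>x y z w. ?h (a, b, c, d) = (x, y, z, w) \<and> a = x + y + z + w \<and> b = x + y - z - w \<and>
         c = x - y + z - w \<and> d = x - y - z + w" if v: "(a, b, c, d) \<in> V 0" for a b c d
    proof -
      obtain x y z w where "a + b + c + d = 4 * x" "a + b - c - d = 4 * y"
          "a - b + c - d = 4 * z" "a - b - c + d = 4 * w"
        using dv[of a b c d] v unfolding V_def odd_reps_def dvd_def by simp blast
      moreover from this have "a = x + y + z + w" "b = x + y - z - w" "c = x - y + z - w" "d = x - y - z + w"
        by linarith+
      ultimately show ?thesis by (intro exI[of _ x] exI[of _ y] exI[of _ z] exI[of _ w]) simp
    qed
    show "?h ` V 0 \<subseteq> T"
    proof (rule image_subsetI)
      fix v assume "v \<in> V 0"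
      then obtain a b c d where v: "v = (a, b, c, d)" "(a, b, c, d) \<in> V 0" by (cases v) auto
      obtain x y z w where h: "?h v = (x, y, z, w)"
        and eq: "a = x + y + z + w" "b = x + y - z - w" "c = x - y + z - w" "d = x - y - z + w"
        using ex[OF v(2)] unfolding v(1) by blast
      have "a\<^sup>2 + b\<^sup>2 + c\<^sup>2 + d\<^sup>2 = 4 * (x\<^sup>2 + y\<^sup>2 + z\<^sup>2 + w\<^sup>2)"
        unfolding eq by (simp add: power2_eq_square algebra_simps)
      moreover have "a\<^sup>2 + b\<^sup>2 + c\<^sup>2 + d\<^sup>2 = 4 * k" using v(2) by (simp add: V_def odd_reps_def)
      ultimately show "?h v \<in> T" unfolding h T_def by simp
    qed
    show "inj_on ?h (V 0)"
    proof (rule inj_on_inverseI[where g = "\<lambda>(x, y, z, w). (x + y + z + w, x + y - z - w, x - y + z - w, x - y - z + w)"])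
      fix v assume "v \<in> V 0"
      then obtain a b c d where v: "v = (a, b, c, d)" "(a, b, c, d) \<in> V 0" by (cases v) auto
      obtain x y z w where h: "?h v = (x, y, z, w)"
        and eq: "a = x + y + z + w" "b = x + y - z - w" "c = x - y + z - w" "d = x - y - z + w"
        using ex[OF v(2)] unfolding v(1) by blast
      show "(\<lambda>(x, y, z, w). (x + y + z + w, x + y - z - w, x - y + z - w, x - y - z + w)) (?h v) = v"
        unfolding h using eq v(1) by simp
    qed
  qed
  finally have "card (odd_reps (4 * k)) \<le> 2 * card T" by simp
  moreover have "16 * k \<le> int (card (odd_reps (4 * k)))"
  proof -
    have "(k, 1) \<in> odd_factorizations (4 * k)" using assms by (auto simp: odd_factorizations_def)
    then have "(\<lambda>(p, q). p) (k, 1 :: int) \<le> (\<Sum>(p, q)\<in>odd_factorizations (4 * k). p)"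
      by (rule member_le_sum)
         (simp_all only: finite_odd_factorizations, auto simp: odd_factorizations_def)
    then show ?thesis by (simp add: card_odd_reps)
  qed
  ultimately show ?thesis unfolding T_def by linarith
qed

section \<open>Lattice points on spheres from below\<close>

definition sq_norm :: "('d::finite \<Rightarrow> int) \<Rightarrow> int" where
  "sq_norm b = (\<Sum>i\<in>UNIV. (b i)\<^sup>2)"

text \<open>
  Single out four coordinates for the four-square theorem and let the others be even numbers \<open>2j\<close> with \<open>j \<le> J\<close>,
  except that one of them is shifted by \<open>\<epsilon>\<close> to make the remainder \<open>m - s\<close> odd. The range \<open>J\<close>, of order
  \<open>\<surd>m\<close>, is so small that the remainder is at least \<open>m / 2\<close>, and each
  of the \<open>(J + 1)\<^sup>d\<^sup>-\<^sup>4\<close> choices is completed by the four singled out coordinates in at least \<open>4m\<close> ways.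
\<close>
lemma card_lattice_points_lower:
  assumes d: "CARD('d::finite) = d" "d \<ge> 5" and m: "m > 0"
    and fin: "finite {b :: 'd \<Rightarrow> int. sq_norm b = m}"
  shows "4 * real_of_int m * (sqrt (of_int m) / (4 * real d)) ^ (d - 4)
           \<le> real (card {b :: 'd \<Rightarrow> int. sq_norm b = m})"
proof -
  let ?F = "{b :: 'd \<Rightarrow> int. sq_norm b = m}"
  obtain f where f: "bij_betw f {0..<d} (UNIV :: 'd set)"
    using ex_bij_betw_nat_finite[of "UNIV :: 'd set"] d(1) by auto
  define i1 i2 i3 i4 i5 where i_def: "i1 = f 0" "i2 = f 1" "i3 = f 2" "i4 = f 3" "i5 = f 4"
  have f_eq: "f x = f y \<longleftrightarrow> x = y" if "x < d" "y < d" for x y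
    using f that by (auto simp: bij_betw_def inj_on_def)
  have dist: "distinct [i1, i2, i3, i4, i5]" using d(2) by (simp add: i_def f_eq)
  define I where "I = UNIV - {i1, i2, i3, i4}"
  have cardI: "card I = d - 4" using dist d(1) by (simp add: I_def card_Diff_subset)
  have i5: "i5 \<in> I" using dist by (auto simp: I_def)
  define J where "J = nat \<lfloor>sqrt (of_int m) / (4 * real d)\<rfloor>"
  define \<epsilon> where "\<epsilon> = (if even m then 1 else 0 :: int)"
  define X where "X = (\<lambda>(j :: 'd \<Rightarrow> nat) i. 2 * int (j i) + (if i = i5 then \<epsilon> else 0))"
  define s where "s = (\<lambda>j. \<Sum>i\<in>I. (X j i)\<^sup>2)"
  define Js where "Js = (I \<rightarrow>\<^sub>E {0..J})"
  define T where "T = (\<lambda>k::int. {(a, b, c, e). a\<^sup>2 + b\<^sup>2 + c\<^sup>2 + e\<^sup>2 = k})"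
  have parity: "odd (m - s j)" for j
  proof -
    have "s j = (X j i5)\<^sup>2 + (\<Sum>i\<in>I - {i5}. (X j i)\<^sup>2)"
      unfolding s_def by (rule sum.remove) (use i5 in auto)
    moreover have "even (\<Sum>i\<in>I - {i5}. (X j i)\<^sup>2)" by (rule dvd_sum) (auto simp: X_def)
    ultimately show ?thesis by (auto simp: X_def \<epsilon>_def)
  qed
  have small: "2 * s j \<le> m" if "j \<in> Js" for j
  proof (cases "J = 0")
    case True
    then have "j i = 0" if "i \<in> I" for i using that \<open>j \<in> Js\<close> by (auto simp: Js_def PiE_iff)
    then have "s j = (\<Sum>i\<in>I. if i = i5 then \<epsilon> else 0)"
      unfolding s_def by (intro sum.cong) (auto simp: X_def \<epsilon>_def)
    then have "s j = \<epsilon>" using i5 by (simp add: I_def)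
    then show ?thesis using m by (auto simp: \<epsilon>_def elim!: evenE)
  next
    case False
    have "(X j i)\<^sup>2 \<le> 9 * (int J)\<^sup>2" if "i \<in> I" for i
    proof -
      have "j i \<le> J" using that \<open>j \<in> Js\<close> by (auto simp: Js_def PiE_iff)
      then have "0 \<le> X j i" "X j i \<le> 3 * int J" using False by (auto simp: X_def \<epsilon>_def)
      then have "(X j i)\<^sup>2 \<le> (3 * int J)\<^sup>2" by (intro power_mono)
      then show ?thesis by (simp add: power_mult_distrib)
    qed
    then have "s j \<le> (\<Sum>i\<in>I. 9 * (int J)\<^sup>2)" unfolding s_def by (intro sum_mono)
    also have "\<dots> = int (d - 4) * (9 * (int J)\<^sup>2)" by (simp add: cardI)
    also have "\<dots> \<le> int d * (9 * (int J)\<^sup>2)" by (intro mult_right_mono) auto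
    finally have sJ: "real_of_int (s j) \<le> 9 * real d * (real J)\<^sup>2"
      by (simp add: mult_ac flip: of_int_le_iff[where ?'a = real])
    have "real J \<le> sqrt (of_int m) / (4 * real d)" unfolding J_def using m by (simp add: of_nat_nat)
    then have "real J * (4 * real d) \<le> sqrt (of_int m)" using d(2) by (simp add: field_simps)
    then have "(real J * (4 * real d))\<^sup>2 \<le> (sqrt (of_int m))\<^sup>2" by (intro power_mono) auto
    then have "16 * real d * (real d * (real J)\<^sup>2) \<le> of_int m" using m by (simp add: power2_eq_square mult_ac)
    moreover have "18 * (real d * (real J)\<^sup>2) \<le> 16 * real d * (real d * (real J)\<^sup>2)"
      using d(2) by (intro mult_right_mono) auto
    ultimately have "2 * real_of_int (s j) \<le> of_int m" using sJ by linarith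
    then show ?thesis by linarith
  qed
  have finJs: "finite Js" by (simp add: Js_def finite_PiE I_def)
  define \<Phi> where "\<Phi> = (\<lambda>(j, a, b, c, e) i. if i = i1 then a else if i = i2 then b else if i = i3 then c
      else if i = i4 then e else X j i)"
  have \<Phi>: "\<Phi> p \<in> ?F" if "p \<in> (SIGMA j:Js. T (m - s j))" for p
  proof -
    obtain j a b c e where p: "p = (j, a, b, c, e)" by (cases p) auto
    have "sq_norm (\<Phi> p) = (\<Sum>i\<in>{i1, i2, i3, i4}. (\<Phi> p i)\<^sup>2) + (\<Sum>i\<in>I. (\<Phi> p i)\<^sup>2)"
      unfolding sq_norm_def I_def by (rule sum.subset_diff[THEN trans[OF _ add.commute]]) auto
    also have "(\<Sum>i\<in>I. (\<Phi> p i)\<^sup>2) = s j"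
      unfolding s_def by (intro sum.cong) (auto simp: \<Phi>_def p I_def)
    also have "(\<Sum>i\<in>{i1, i2, i3, i4}. (\<Phi> p i)\<^sup>2) = a\<^sup>2 + b\<^sup>2 + c\<^sup>2 + e\<^sup>2"
      using dist by (auto simp: \<Phi>_def p)
    finally show ?thesis using that by (simp add: p T_def)
  qed
  have inj: "inj_on \<Phi> (SIGMA j:Js. T (m - s j))"
  proof (rule inj_onI)
    fix p p' assume p: "p \<in> (SIGMA j:Js. T (m - s j))" "p' \<in> (SIGMA j:Js. T (m - s j))" and eq: "\<Phi> p = \<Phi> p'"
    obtain j a b c e where pj: "p = (j, a, b, c, e)" by (cases p) auto
    obtain j' a' b' c' e' where pj': "p' = (j', a', b', c', e')" by (cases p') auto
    have eqi: "\<Phi> p i = \<Phi> p' i" for i using eq by simp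
    have "a = a'" using eqi[of i1] by (simp add: \<Phi>_def pj pj')
    moreover have "b = b'" using eqi[of i2] dist by (simp add: \<Phi>_def pj pj' split: if_splits)
    moreover have "c = c'" using eqi[of i3] dist by (simp add: \<Phi>_def pj pj' split: if_splits)
    moreover have "e = e'" using eqi[of i4] dist by (simp add: \<Phi>_def pj pj' split: if_splits)
    moreover have "j = j'"
    proof (rule PiE_ext)
      show "j \<in> I \<rightarrow>\<^sub>E {0..J}" "j' \<in> I \<rightarrow>\<^sub>E {0..J}" using p by (auto simp: pj pj' Js_def)
      show "j i = j' i" if "i \<in> I" for i
        using eqi[of i] that by (auto simp: \<Phi>_def pj pj' I_def X_def)
    qed
    ultimately show "p = p'" by (simp add: pj pj')
  qed
  have cardSig: "card (SIGMA j:Js. T (m - s j)) \<le> card ?F"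
    using \<Phi> by (intro card_inj_on_le[OF inj _ fin]) auto
  have finT: "finite (T k)" for k
  proof (rule finite_subset)
    show "T k \<subseteq> {-k..k} \<times> {-k..k} \<times> {-k..k} \<times> {-k..k}"
    proof
      fix v assume v: "v \<in> T k"
      obtain a b c e where abc: "v = (a, b, c, e)" by (rule prod_cases4)
      then have eq: "a\<^sup>2 + b\<^sup>2 + c\<^sup>2 + e\<^sup>2 = k" using v by (simp add: T_def)
      have "\<bar>a\<bar> \<le> k" "\<bar>b\<bar> \<le> k" "\<bar>c\<bar> \<le> k" "\<bar>e\<bar> \<le> k"
        using eq abs_le_square_int[of a] abs_le_square_int[of b] abs_le_square_int[of c]
          abs_le_square_int[of e] by (smt (verit) zero_le_power2)+
      then show "v \<in> {-k..k} \<times> {-k..k} \<times> {-k..k} \<times> {-k..k}" by (simp add: abc abs_le_iff)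
    qed
  qed auto
  have "4 * real_of_int m * (sqrt (of_int m) / (4 * real d)) ^ (d - 4) \<le> 4 * real_of_int m * real (Suc J) ^ (d - 4)"
  proof (intro mult_left_mono power_mono)
    show "sqrt (of_int m) / (4 * real d) \<le> real (Suc J)" unfolding J_def by linarith
  qed (use m in auto)
  also have "\<dots> = (\<Sum>j\<in>Js. 4 * real_of_int m)"
    by (simp add: Js_def card_PiE I_def[symmetric] cardI)
  also have "\<dots> \<le> (\<Sum>j\<in>Js. real (card (T (m - s j))))"
  proof (rule sum_mono)
    fix j assume "j \<in> Js"
    then have j: "2 * s j \<le> m" by (rule small)
    then have "8 * (m - s j) \<le> int (card (T (m - s j)))"
      unfolding T_def using m by (intro four_squares_lower_bound parity) auto
    moreover have "4 * m \<le> 8 * (m - s j)" using j by simp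
    ultimately have "4 * m \<le> int (card (T (m - s j)))" by (rule order_trans[rotated])
    then show "4 * real_of_int m \<le> real (card (T (m - s j)))" by linarith
  qed
  also have "\<dots> = real (card (SIGMA j:Js. T (m - s j)))"
    by (subst card_SigmaI) (auto simp: finJs finT)
  also have "\<dots> \<le> real (card ?F)" using cardSig by simp
  finally show ?thesis .
qed

section \<open>Rational approximation and the number of near-integer multiples\<close>

text \<open>
  If \<open>\<alpha> h\<close> is within \<open>1/(2H)\<close> of an integer \<open>f(h)\<close> for \<open>h\<close> in \<open>S\<close>, then
  \<open>h\<^sub>1 f(h\<^sub>2) - h\<^sub>2 f(h\<^sub>1)\<close> is an integer of absolute value less than one. So all the
  fractions \<open>f(h)/h\<close> agree with one reduced fraction \<open>a/q\<close>, and the elements of \<open>S\<close> are multiples of \<open>q\<close> up to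
  \<open>H\<close>; in particular \<open>q\<close> times the cardinality of \<open>S\<close> is at most \<open>H\<close>. The largest of them is at least \<open>q\<close> times the
  cardinality, and dividing its approximation error accordingly gives the bound for \<open>\<alpha> q - a\<close>.
\<close>
lemma many_multiples_near_integers:
  fixes \<alpha> :: real and H :: nat
  defines "S \<equiv> {h \<in> {1..H}. \<exists>a::int. \<bar>\<alpha> * real h - a\<bar> < 1 / (2 * real H)}"
  assumes "S \<noteq> {}"
  shows "\<exists>q a. 1 \<le> q \<and> q * card S \<le> H \<and> real (card S) * \<bar>\<alpha> * real q - of_int a\<bar> < 1 / (2 * real H)"
proof -
  have finS: "finite S" by (simp add: S_def)
  have H: "H > 0" using assms by (auto simp: S_def)
  have "\<forall>h\<in>S. \<exists>a::int. \<bar>\<alpha> * real h - a\<bar> < 1 / (2 * real H)" by (auto simp: S_def)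
  then obtain f :: "nat \<Rightarrow> int" where f: "\<And>h. h \<in> S \<Longrightarrow> \<bar>\<alpha> * real h - f h\<bar> < 1 / (2 * real H)"
    by metis
  have cross: "int h1 * f h2 = int h2 * f h1" if "h1 \<in> S" "h2 \<in> S" for h1 h2
  proof -
    have "real_of_int (int h1 * f h2 - int h2 * f h1)
        = real h2 * (\<alpha> * real h1 - f h1) - real h1 * (\<alpha> * real h2 - f h2)"
      by (simp add: algebra_simps)
    also have "\<bar>\<dots>\<bar> \<le> real h2 * \<bar>\<alpha> * real h1 - f h1\<bar> + real h1 * \<bar>\<alpha> * real h2 - f h2\<bar>"
      by (rule order_trans[OF abs_triangle_ineq4]) (simp add: abs_mult)
    also have "\<dots> < real H * (1 / (2 * real H)) + real H * (1 / (2 * real H))"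
      using that f[OF that(1)] f[OF that(2)] H
      by (intro add_strict_mono mult_le_less_imp_less) (auto simp: S_def)
    also have "\<dots> = 1" using H by simp
    finally show ?thesis by linarith
  qed
  obtain h0 where h0: "h0 \<in> S" using assms by auto
  have h0pos: "h0 > 0" using h0 by (auto simp: S_def)
  define g where "g = gcd (int h0) (f h0)"
  have gpos: "g > 0" using h0pos by (simp add: g_def)
  obtain q a where qa: "int h0 = g * q" "f h0 = g * a" "coprime q a"
  proof
    show "int h0 = g * (int h0 div g)" "f h0 = g * (f h0 div g)" by (simp_all add: g_def)
    show "coprime (int h0 div g) (f h0 div g)"
      unfolding g_def using h0pos by (intro div_gcd_coprime) auto
  qed
  have qpos: "q > 0" using qa(1) h0pos gpos by (metis of_nat_0_less_iff zero_less_mult_pos)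
  have fq: "int h * a = f h * q" if "h \<in> S" for h
  proof -
    have "g * (int h * a) = g * (f h * q)"
      using cross[OF h0 that] unfolding qa(1,2) by (simp only: ac_simps)
    then show ?thesis using gpos by simp
  qed
  have dvd: "nat q dvd h" if "h \<in> S" for h
  proof -
    have "q dvd int h * a" using fq[OF that] by simp
    then have "q dvd int h" using qa(3) by (simp add: coprime_dvd_mult_left_iff)
    then show ?thesis using qpos by (simp add: nat_dvd_iff)
  qed
  define h where "h = Max S"
  have hS: "h \<in> S" unfolding h_def using finS assms by (intro Max_in) auto
  have "S \<subseteq> (\<lambda>j. nat q * j) ` {1..h div nat q}"
  proof
    fix x assume x: "x \<in> S"
    then obtain j where j: "x = nat q * j" using dvd[OF x] by (elim dvdE)
    have "x \<le> h" using x finS by (simp add: h_def)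
    moreover have "x > 0" using x by (auto simp: S_def)
    ultimately have "j \<in> {1..h div nat q}" using j qpos by (auto simp: less_eq_div_iff_mult_less_eq mult.commute)
    then show "x \<in> (\<lambda>j. nat q * j) ` {1..h div nat q}" using j by blast
  qed
  then have "card S \<le> card ((\<lambda>j. nat q * j) ` {1..h div nat q})"
    by (intro card_mono) auto
  also have "\<dots> \<le> h div nat q" using card_image_le[of "{1..h div nat q}"] by simp
  finally have "nat q * card S \<le> nat q * (h div nat q)" by simp
  also have "\<dots> \<le> h" by simp
  finally have qh: "nat q * card S \<le> h" .
  moreover have "h \<le> H" using hS by (simp add: S_def)
  moreover have "real (card S) * \<bar>\<alpha> * real (nat q) - of_int a\<bar> < 1 / (2 * real H)"
  proof -
    have "real h * \<bar>\<alpha> * real (nat q) - of_int a\<bar> = \<bar>real h * (\<alpha> * real (nat q) - of_int a)\<bar>"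
      by (simp add: abs_mult)
    also have "real h * (\<alpha> * real (nat q) - of_int a) = real (nat q) * (\<alpha> * real h - f h)"
      using arg_cong[OF fq[OF hS], of real_of_int] qpos by (simp add: algebra_simps)
    also have "\<bar>\<dots>\<bar> = real (nat q) * \<bar>\<alpha> * real h - f h\<bar>" by (simp add: abs_mult)
    finally have *: "real h * \<bar>\<alpha> * real (nat q) - of_int a\<bar> = real (nat q) * \<bar>\<alpha> * real h - f h\<bar>" .
    have "real (nat q) * (real (card S) * \<bar>\<alpha> * real (nat q) - of_int a\<bar>)
        \<le> real h * \<bar>\<alpha> * real (nat q) - of_int a\<bar>"
      using qh by (simp add: mult_right_mono flip: mult.assoc of_nat_mult)
    also have "\<dots> < real (nat q) * (1 / (2 * real H))"
      unfolding * using f[OF hS] qpos by (intro mult_strict_left_mono) auto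
    finally show ?thesis by (rule mult_left_less_imp_less) simp
  qed
  ultimately show ?thesis using qpos by (intro exI[of _ "nat q"] exI[of _ a]) auto
qed

lemma card_nat_interval_le:
  fixes A :: "nat set"
  assumes "\<And>x. x \<in> A \<Longrightarrow> \<bar>real x - c\<bar> \<le> Y" "Y \<ge> 0"
  shows "real (card A) \<le> 2 * Y + 1"
proof -
  have sub: "int ` A \<subseteq> {\<lceil>c - Y\<rceil>..\<lfloor>c + Y\<rfloor>}"
    using assms(1) by (force simp: abs_le_iff le_floor_iff ceiling_le_iff)
  have "card A = card (int ` A)" by (simp add: card_image)
  also have "\<dots> \<le> card {\<lceil>c - Y\<rceil>..\<lfloor>c + Y\<rfloor>}" using sub by (intro card_mono) auto
  finally have "real (card A) \<le> real (nat (\<lfloor>c + Y\<rfloor> - \<lceil>c - Y\<rceil> + 1))" by simp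
  also have "\<dots> \<le> 2 * Y + 1"
    using assms(2) of_int_floor_le[of "c + Y"] le_of_int_ceiling[of "c - Y"] by (cases "\<lfloor>c + Y\<rfloor> - \<lceil>c - Y\<rceil> + 1 \<ge> 0") linarith+
  finally show "real (card A) \<le> 2 * Y + 1" .
qed

text \<open>
  The integers \<open>k\<close> with \<open>b k\<close> close to a multiple of \<open>M\<close> lie in \<open>b + 1\<close> intervals of length
  \<open>2Y/b\<close> around the points \<open>aM/b\<close>.
\<close>
lemma card_near_multiples:
  fixes M b :: nat and Y :: real
  assumes "b > 0" "0 \<le> Y" "Y < real M"
  shows "real (card {k \<in> {0..<M}. \<exists>a::int. \<bar>real b * real k - of_int a * real M\<bar> \<le> Y}) \<le> real b + 1 + 4 * Y"
    (is "real (card ?A) \<le> _")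
proof -
  define B where "B = (\<lambda>a. {k \<in> {0..<M}. \<bar>real b * real k - real a * real M\<bar> \<le> Y})"
  have M: "M > 0" using assms by (cases M) auto
  have "?A \<subseteq> (\<Union>a\<in>{0..b}. B a)"
  proof
    fix k assume "k \<in> ?A"
    then obtain a :: int where k: "k < M" and a: "\<bar>real b * real k - of_int a * real M\<bar> \<le> Y" by auto
    have "of_int (-1) * real M < of_int a * real M"
      using a assms mult_nonneg_nonneg[of "real b" "real k"] by linarith
    then have "a \<ge> 0" using M by (simp only: mult_less_cancel_right) auto
    have "real b * real k \<le> real b * real M" using k by (intro mult_left_mono) auto
    then have "of_int a * real M < of_int (int b + 1) * real M"
      using a assms(3) unfolding of_int_add distrib_right by simp
    then have "a \<le> int b" using M by (simp only: mult_less_cancel_right) auto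
    with \<open>a \<ge> 0\<close> have "nat a \<in> {0..b}" by auto
    moreover have "k \<in> B (nat a)" using k a \<open>a \<ge> 0\<close> by (simp add: B_def)
    ultimately show "k \<in> (\<Union>a\<in>{0..b}. B a)" by blast
  qed
  then have "card ?A \<le> card (\<Union>a\<in>{0..b}. B a)" by (intro card_mono) (auto simp: B_def)
  also have "\<dots> \<le> (\<Sum>a\<in>{0..b}. card (B a))" by (rule card_UN_le) auto
  finally have "real (card ?A) \<le> (\<Sum>a\<in>{0..b}. real (card (B a)))" by (simp flip: of_nat_sum)
  also have "\<dots> \<le> (\<Sum>a\<in>{0..b}. 2 * (Y / real b) + 1)"
  proof (rule sum_mono)
    fix a
    show "real (card (B a)) \<le> 2 * (Y / real b) + 1"
    proof (rule card_nat_interval_le)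
      fix x assume "x \<in> B a"
      then have "\<bar>real b * real x - real a * real M\<bar> / real b \<le> Y / real b"
        by (intro divide_right_mono) (auto simp: B_def)
      also have "\<bar>real b * real x - real a * real M\<bar> / real b = \<bar>(real b * real x - real a * real M) / real b\<bar>"
        using assms by (simp add: abs_divide)
      also have "(real b * real x - real a * real M) / real b = real x - real a * real M / real b"
        using assms by (simp add: field_simps)
      finally show "\<bar>real x - real a * real M / real b\<bar> \<le> Y / real b" .
    qed (use assms in auto)
  qed
  also have "\<dots> = real b + 1 + 2 * Y + 2 * (Y / real b)"
    using assms by (simp add: field_simps)
  also have "\<dots> \<le> real b + 1 + 4 * Y"
  proof -
    have "Y * 1 \<le> Y * real b" using assms by (intro mult_left_mono) auto
    then have "Y / real b \<le> Y" using assms by (simp add: divide_le_eq)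
    then show ?thesis by simp
  qed
  finally show ?thesis .
qed

definition near_integer_count :: "nat \<Rightarrow> real \<Rightarrow> nat" where
  "near_integer_count H \<alpha> = card {h \<in> {1..H}. \<exists>a::int. \<bar>\<alpha> * real h - a\<bar> < 1 / (2 * real H)}"

lemma near_integer_count_le: "near_integer_count H \<alpha> \<le> H"
  unfolding near_integer_count_def
  by (rule order_trans[OF card_mono[of "{1..H}"]]) auto

text \<open>
  The fractions \<open>k/M\<close> at which the Weyl sum can be large are rare. With \<open>T = H/l\<close>, such a fraction has a
  denominator \<open>q \<le> T\<close> for which \<open>2qk\<close> is within \<open>Y\<close> of a multiple of \<open>M\<close>, where \<open>Y\<close> is of order \<open>T\<close>
  since \<open>M\<close> is of order \<open>H\<^sup>2\<close>. Each of the \<open>T\<close> denominators admits a number of \<open>k\<close> of order \<open>T\<close>.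
\<close>
lemma card_near_integer_count_ge:
  fixes M H :: nat and D l :: real
  assumes "real M = D * real H ^ 2" "H > 0" "M > 0" "l > 0"
  shows "real (card {k \<in> {0..<M}. l \<le> real (near_integer_count H (2 * real k / real M))})
           \<le> (5 + 2 * D) * (real H / l)\<^sup>2" (is "real (card ?K) \<le> _")
proof (cases "l \<le> real H")
  case False
  have D: "D > 0" using assms by (metis of_nat_0_less_iff zero_less_mult_pos2 zero_less_power)
  have "\<not> l \<le> real (near_integer_count H \<alpha>)" for \<alpha>
  proof
    assume "l \<le> real (near_integer_count H \<alpha>)"
    also have "\<dots> \<le> real H" using near_integer_count_le by simp
    finally show False using False by simp
  qed
  then have "?K = {}" by blast
  show ?thesis unfolding \<open>?K = {}\<close> using D by simp
next
  case True
  define T where "T = real H / l"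
  have T1: "T \<ge> 1" using True assms by (simp add: T_def)
  have D: "D > 0" using assms by (metis of_nat_0_less_iff zero_less_mult_pos2 zero_less_power)
  define Y where "Y = real M / (2 * real H * l)"
  define B where "B = (\<lambda>q. {k \<in> {0..<M}. \<exists>a::int. \<bar>real (2 * q) * real k - of_int a * real M\<bar> \<le> Y})"
  have sub: "?K \<subseteq> (\<Union>q\<in>{1..nat \<lfloor>T\<rfloor>}. B q)"
  proof
    fix k assume k: "k \<in> ?K"
    define \<alpha> where "\<alpha> = 2 * real k / real M"
    define S where "S = {h \<in> {1..H}. \<exists>a::int. \<bar>\<alpha> * real h - a\<bar> < 1 / (2 * real H)}"
    have S: "l \<le> real (card S)" using k by (simp add: S_def near_integer_count_def \<alpha>_def)
    then have "S \<noteq> {}" using assms by auto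
    then obtain q a where q: "1 \<le> q" "q * card S \<le> H"
        and a: "real (card S) * \<bar>\<alpha> * real q - of_int a\<bar> < 1 / (2 * real H)"
      using many_multiples_near_integers[of H \<alpha>] unfolding S_def by blast
    have "real q * l \<le> real q * real (card S)" using S by (intro mult_left_mono) auto
    also have "\<dots> \<le> real H" using q(2) by (simp flip: of_nat_mult)
    finally have "real q \<le> T" using assms by (simp add: T_def field_simps)
    then have qT: "q \<in> {1..nat \<lfloor>T\<rfloor>}" using q(1) by (simp add: le_nat_floor)
    have "l * \<bar>\<alpha> * real q - of_int a\<bar> \<le> real (card S) * \<bar>\<alpha> * real q - of_int a\<bar>"
      using S by (intro mult_right_mono) auto
    then have "l * \<bar>\<alpha> * real q - of_int a\<bar> \<le> 1 / (2 * real H)" using a by linarith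
    then have "\<bar>\<alpha> * real q - of_int a\<bar> \<le> 1 / (2 * real H * l)"
      using assms(2,4) by (simp add: field_simps)
    from mult_left_mono[OF this, of "real M"] have "real M * \<bar>\<alpha> * real q - of_int a\<bar> \<le> Y"
      by (simp add: Y_def)
    also have "real M * \<bar>\<alpha> * real q - of_int a\<bar> = \<bar>real M * (\<alpha> * real q - of_int a)\<bar>"
      by (simp add: abs_mult)
    also have "real M * (\<alpha> * real q - of_int a) = real (2 * q) * real k - of_int a * real M"
      using assms(3) by (simp add: \<alpha>_def right_diff_distrib)
    finally have "k \<in> B q" using k by (auto simp: B_def)
    with qT show "k \<in> (\<Union>q\<in>{1..nat \<lfloor>T\<rfloor>}. B q)" by blast
  qed
  have Y: "Y = D / 2 * T" using assms by (simp add: Y_def T_def power2_eq_square field_simps)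
  show ?thesis
  proof (cases "Y < real M")
    case True
    have "real (card ?K) \<le> real (card (\<Union>q\<in>{1..nat \<lfloor>T\<rfloor>}. B q))"
      using sub by (intro of_nat_mono card_mono) (auto simp: B_def)
    also have "\<dots> \<le> (\<Sum>q\<in>{1..nat \<lfloor>T\<rfloor>}. real (card (B q)))"
      unfolding of_nat_sum[symmetric] by (intro of_nat_mono card_UN_le) auto
    also have "\<dots> \<le> (\<Sum>q\<in>{1..nat \<lfloor>T\<rfloor>}. 5 * T - 2 * T + 2 * D * T)"
    proof (rule sum_mono)
      fix q assume q: "q \<in> {1..nat \<lfloor>T\<rfloor>}"
      then have "real q \<le> T" using T1 by (simp add: le_nat_iff) linarith
      have "real (card (B q)) \<le> real (2 * q) + 1 + 4 * Y"
        unfolding B_def using q True assms by (intro card_near_multiples) (auto simp: Y_def)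
      then show "real (card (B q)) \<le> 5 * T - 2 * T + 2 * D * T"
        using \<open>real q \<le> T\<close> T1 by (simp add: Y)
    qed
    also have "\<dots> = real (nat \<lfloor>T\<rfloor>) * ((3 + 2 * D) * T)" by (simp add: algebra_simps)
    also have "\<dots> \<le> T * ((5 + 2 * D) * T)"
      using T1 D by (intro mult_mono) (auto intro: mult_right_mono)
    finally show ?thesis by (simp add: T_def power2_eq_square mult.assoc mult.left_commute)
  next
    case False
    have "real (card ?K) \<le> real (card {0..<M})" by (intro of_nat_mono card_mono) auto
    also have "\<dots> \<le> D / 2 * T" using False Y by simp
    also have "\<dots> \<le> (5 + 2 * D) * T\<^sup>2"
      using T1 D by (intro mult_mono self_le_power) auto
    finally show ?thesis by (simp add: T_def)
  qed
qed

section \<open>Exponential sums with a triangular weight\<close>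

text \<open>
  Summation by parts twice. Two differences give quadratic decay in the frequency, which is
  summable over the cells below; a single one would lose a logarithm.
\<close>
lemma norm_sum_cis_le_second_differences:
  fixes u :: "int \<Rightarrow> real" and \<phi> :: real
  assumes supp: "\<And>x. \<bar>x\<bar> \<ge> K \<Longrightarrow> u x = 0"
  shows "4 * (sin (\<phi> / 2))\<^sup>2 * norm (\<Sum>x\<in>{-K..K}. u x * cis (\<phi> * of_int x))
           \<le> (\<Sum>x\<in>{-K..K}. \<bar>u (x + 1) - 2 * u x + u (x - 1)\<bar>)"
proof -
  let ?e = "\<lambda>x::int. cis (\<phi> * of_int x)"
  let ?S = "\<Sum>x\<in>{-K..K}. u x * ?e x"
  have shift: "(\<Sum>x\<in>{-K..K}. u (x + s) * ?e x) = cis (- \<phi> * of_int s) * ?S" if s: "\<bar>s\<bar> \<le> 1" for s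
  proof -
    have "(\<Sum>x\<in>{-K..K}. u (x + s) * ?e x) = (\<Sum>x\<in>{-K-1..K+1}. u (x + s) * ?e x)"
      using s by (intro sum.mono_neutral_left) (auto intro!: supp)
    also have "\<dots> = (\<Sum>y\<in>{-K-1+s..K+1+s}. u y * ?e (y - s))"
      by (rule sum.reindex_bij_witness[of _ "\<lambda>y. y - s" "\<lambda>x. x + s"]) auto
    also have "\<dots> = (\<Sum>y\<in>{-K..K}. u y * ?e (y - s))"
      using s by (intro sum.mono_neutral_right) (auto intro!: supp)
    also have "\<dots> = cis (- \<phi> * of_int s) * ?S"
      unfolding sum_distrib_left by (rule sum.cong) (auto simp: cis_mult algebra_simps)
    finally show ?thesis .
  qed
  have "(\<Sum>x\<in>{-K..K}. (u (x + 1) - 2 * u x + u (x - 1)) * ?e x)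
      = (\<Sum>x\<in>{-K..K}. u (x + 1) * ?e x) - 2 * ?S + (\<Sum>x\<in>{-K..K}. u (x - 1) * ?e x)"
    by (simp add: algebra_simps sum.distrib sum_subtractf sum_distrib_left)
  also have "\<dots> = (cis (-\<phi>) - 2 + cis \<phi>) * ?S"
    using shift[of 1] shift[of "-1"] by (simp add: algebra_simps)
  also have "cis (-\<phi>) - 2 + cis \<phi> = of_real (- (4 * (sin (\<phi> / 2))\<^sup>2))"
    using cos_double_sin[of "\<phi> / 2"] by (simp add: complex_eq_iff)
  finally have "of_real (- (4 * (sin (\<phi> / 2))\<^sup>2)) * ?S
      = (\<Sum>x\<in>{-K..K}. (u (x + 1) - 2 * u x + u (x - 1)) * ?e x)" by simp
  then have "4 * (sin (\<phi> / 2))\<^sup>2 * norm ?S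
      = norm (\<Sum>x\<in>{-K..K}. of_real (u (x + 1) - 2 * u x + u (x - 1)) * ?e x)"
    by (metis (no_types, lifting) abs_minus_cancel abs_of_nonneg mult_nonneg_nonneg norm_mult norm_of_real
        of_real_diff of_real_add of_real_mult of_real_numeral zero_le_numeral zero_le_power2)
  also have "\<dots> \<le> (\<Sum>x\<in>{-K..K}. \<bar>u (x + 1) - 2 * u x + u (x - 1)\<bar>)"
    by (rule order_trans[OF norm_sum]) (simp add: norm_mult del: of_real_add of_real_diff)
  finally show ?thesis .
qed

text \<open>
  Jordan's inequality, from the concavity of the sine on \<open>[0, \<pi>/2]\<close>.
\<close>
lemma sin_pi_lower_bound:
  assumes "\<bar>y\<bar> \<le> 1 / 2"
  shows "4 * y\<^sup>2 \<le> (sin (pi * y))\<^sup>2"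
proof -
  have *: "2 * z \<le> sin (pi * z)" if "0 \<le> z" "z \<le> 1/2" for z
  proof (cases "z = 0")
    case False
    have "convex_on {0..pi/2} (\<lambda>x. - sin x)"
    proof (rule f''_ge0_imp_convex)
      show "((\<lambda>x. - sin x) has_real_derivative - cos x) (at x)" for x :: real
        by (auto intro!: derivative_eq_intros)
      show "((\<lambda>x. - cos x) has_real_derivative sin x) (at x)" for x :: real
        by (auto intro!: derivative_eq_intros)
      show "sin x \<ge> 0" if "x \<in> {0..pi/2}" for x :: real
        using that by (intro sin_ge_zero) auto
    qed auto
    from convex_onD[OF this, of "2 * z" 0 "pi/2"] that show ?thesis by (simp add: mult.commute)
  qed auto
  have "2 * \<bar>y\<bar> \<le> \<bar>sin (pi * \<bar>y\<bar>)\<bar>" using *[of "\<bar>y\<bar>"] assms by auto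
  then have "(2 * \<bar>y\<bar>)\<^sup>2 \<le> \<bar>sin (pi * \<bar>y\<bar>)\<bar>\<^sup>2" by (intro power_mono) auto
  then show ?thesis by (cases "y \<ge> 0") (auto simp: power_mult_distrib)
qed

text \<open>
  The weight of the Weyl sums: at least \<open>1/2\<close> on \<open>[-R, R]\<close>, and with second differences concentrated at its three
  corners.
\<close>
definition triangle :: "nat \<Rightarrow> int \<Rightarrow> real" where
  "triangle R x = max 0 (1 - \<bar>real_of_int x\<bar> / (2 * real R))"

lemma triangle_nonneg: "0 \<le> triangle R x" and triangle_le_1: "triangle R x \<le> 1"
  by (auto simp: triangle_def)

lemma triangle_eq_0: "R > 0 \<Longrightarrow> \<bar>x\<bar> \<ge> 2 * int R \<Longrightarrow> triangle R x = 0"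
proof -
  assume "R > 0" "\<bar>x\<bar> \<ge> 2 * int R"
  moreover from this have "\<bar>real_of_int x\<bar> \<ge> 2 * real R" by linarith
  ultimately show ?thesis by (simp add: triangle_def field_simps)
qed

lemma triangle_ge_half: "R > 0 \<Longrightarrow> \<bar>x\<bar> \<le> int R \<Longrightarrow> 1 / 2 \<le> triangle R x"
proof -
  assume "R > 0" "\<bar>x\<bar> \<le> int R"
  moreover from this have "\<bar>real_of_int x\<bar> \<le> real R" by linarith
  ultimately show ?thesis by (simp add: triangle_def field_simps)
qed

lemma triangle_diff:
  assumes "R > 0" shows "\<bar>triangle R (x + 1) - triangle R x\<bar> \<le> 1 / (2 * real R)"
proof -
  have "\<bar>triangle R (x + 1) - triangle R x\<bar>
      \<le> \<bar>(1 - \<bar>real_of_int (x + 1)\<bar> / (2 * real R)) - (1 - \<bar>real_of_int x\<bar> / (2 * real R))\<bar>"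
    unfolding triangle_def by linarith
  also have "\<dots> = \<bar>\<bar>real_of_int x\<bar> - \<bar>real_of_int (x + 1)\<bar>\<bar> / (2 * real R)"
    by (simp add: diff_divide_distrib[symmetric] del: of_int_add)
  also have "\<dots> \<le> 1 / (2 * real R)"
    by (intro divide_right_mono) auto
  finally show ?thesis .
qed

lemma triangle_second_difference_eq_0:
  assumes "R > 0" "x \<notin> {0, 2 * int R, - 2 * int R}"
  shows "triangle R (x + 1) - 2 * triangle R x + triangle R (x - 1) = 0"
proof -
  have "x \<ge> 2 * int R + 1 \<or> 1 \<le> x \<and> x \<le> 2 * int R - 1 \<or> - 2 * int R + 1 \<le> x \<and> x \<le> -1 \<or> x \<le> -2 * int R - 1"
    using assms by auto
  moreover have "triangle R y = 1 - of_int y / (2 * real R)" if "0 \<le> y" "y \<le> 2 * int R" for y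
  proof -
    have "real_of_int y \<le> 2 * real R" using that by linarith
    then show ?thesis using assms that by (simp add: triangle_def field_simps)
  qed
  moreover have "triangle R y = 1 + of_int y / (2 * real R)" if "- 2 * int R \<le> y" "y \<le> 0" for y
  proof -
    have "- 2 * real R \<le> real_of_int y" using that by linarith
    then show ?thesis using assms that by (simp add: triangle_def field_simps)
  qed
  ultimately show ?thesis
    using assms(1) by (elim disjE) (simp_all add: triangle_eq_0 add_divide_distrib diff_divide_distrib)
qed

lemma triangle_second_difference:
  assumes "R > 0"
  shows "\<bar>triangle R (x + 1) - 2 * triangle R x + triangle R (x - 1)\<bar>
    \<le> (if x \<in> {0, 2 * int R, - 2 * int R} then 1 / real R else 0)"
proof -
  have "\<bar>triangle R (x + 1) - 2 * triangle R x + triangle R (x - 1)\<bar> \<le> 1 / (2 * real R) + 1 / (2 * real R)"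
    using triangle_diff[OF assms, of x] triangle_diff[OF assms, of "x-1"] by (simp add: abs_le_iff)
  then show ?thesis using triangle_second_difference_eq_0[OF assms] by auto
qed

text \<open>
  The Leibniz rule for second differences: two terms come from the corners of either factor, and the two
  products of first differences are of order \<open>R\<^sup>-\<^sup>2\<close> at each of the \<open>4R + 1\<close> points.
\<close>
lemma triangle_product_second_differences:
  assumes "R > 0"
  defines "u \<equiv> \<lambda>h x. triangle R x * triangle R (x + h)"
  shows "(\<Sum>x\<in>{-2 * int R..2 * int R}. \<bar>u h (x + 1) - 2 * u h x + u h (x - 1)\<bar>) \<le> 9 / real R"
proof -
  let ?r = "1 / (2 * real R)"
  define P where "P = (\<lambda>x. if x \<in> {0, 2 * int R, - 2 * int R} then 1 / real R else 0 :: real)"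
  have P: "sum P A \<le> 3 / real R" if "finite A" for A
  proof -
    have "sum P A = sum P (A \<inter> {0, 2 * int R, - 2 * int R})"
      using that by (intro sum.mono_neutral_right) (auto simp: P_def)
    also have "\<dots> \<le> sum P {0, 2 * int R, - 2 * int R}"
      by (intro sum_mono2) (auto simp: P_def)
    also have "\<dots> = 3 / real R" using assms(1) by (simp add: P_def)
    finally show ?thesis .
  qed
  have "\<bar>u h (x + 1) - 2 * u h x + u h (x - 1)\<bar> \<le> P x + P (x + h) + (?r * ?r + ?r * ?r)" for x
  proof -
    let ?a = "\<lambda>s. triangle R (x + s)" and ?b = "\<lambda>s. triangle R (x + h + s)"
    have four: "\<bar>p + q + r + s\<bar> \<le> A + B + (C + D)"
      if "\<bar>p\<bar> \<le> A" "\<bar>q\<bar> \<le> B" "\<bar>r\<bar> \<le> C" "\<bar>s\<bar> \<le> D" for p q r s A B C D :: real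
      using that by linarith
    have leibniz: "u h (x + 1) - 2 * u h x + u h (x - 1)
        = (?a 1 - 2 * ?a 0 + ?a (-1)) * ?b 0 + ?a 0 * (?b 1 - 2 * ?b 0 + ?b (-1))
          + (?a 1 - ?a 0) * (?b 1 - ?b 0) + (?a 0 - ?a (-1)) * (?b 0 - ?b (-1))"
      by (simp add: u_def algebra_simps)
    have 1: "\<bar>(?a 1 - 2 * ?a 0 + ?a (-1)) * ?b 0\<bar> \<le> P x * 1"
      unfolding abs_mult P_def
      using triangle_second_difference[OF assms(1), of x] triangle_nonneg[of R] triangle_le_1[of R]
      by (intro mult_mono) (auto simp: abs_of_nonneg)
    have 2: "\<bar>?a 0 * (?b 1 - 2 * ?b 0 + ?b (-1))\<bar> \<le> 1 * P (x + h)"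
      unfolding abs_mult P_def
      using triangle_second_difference[OF assms(1), of "x + h"] triangle_nonneg[of R] triangle_le_1[of R]
      by (intro mult_mono) (auto simp: abs_of_nonneg)
    have 3: "\<bar>(?a 1 - ?a 0) * (?b 1 - ?b 0)\<bar> \<le> ?r * ?r"
      unfolding abs_mult
      using triangle_diff[OF assms(1), of x] triangle_diff[OF assms(1), of "x + h"]
      by (intro mult_mono) auto
    have 4: "\<bar>(?a 0 - ?a (-1)) * (?b 0 - ?b (-1))\<bar> \<le> ?r * ?r"
      unfolding abs_mult
      using triangle_diff[OF assms(1), of "x - 1"] triangle_diff[OF assms(1), of "x + h - 1"]
      by (intro mult_mono) auto
    show ?thesis unfolding leibniz using four[OF 1 2 3 4] by simp
  qed
  then have "(\<Sum>x\<in>{-2 * int R..2 * int R}. \<bar>u h (x + 1) - 2 * u h x + u h (x - 1)\<bar>)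
      \<le> (\<Sum>x\<in>{-2 * int R..2 * int R}. P x + P (x + h) + (?r * ?r + ?r * ?r))"
    by (intro sum_mono)
  also have "\<dots> = sum P {-2 * int R..2 * int R} + (\<Sum>x\<in>{-2 * int R..2 * int R}. P (x + h))
      + (4 * real R + 1) * (?r * ?r + ?r * ?r)"
    by (simp add: sum.distrib)
  also have "(\<Sum>x\<in>{-2 * int R..2 * int R}. P (x + h)) = sum P {-2 * int R + h..2 * int R + h}"
    by (rule sum.reindex_bij_witness[of _ "\<lambda>y. y - h" "\<lambda>x. x + h"]) auto
  also have "(4 * real R + 1) * (?r * ?r + ?r * ?r) \<le> (5 * real R) * (?r * ?r + ?r * ?r)"
    using assms(1) by (intro mult_right_mono) auto
  also have "\<dots> \<le> 3 / real R" using assms(1) by (simp add: field_simps)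
  finally show ?thesis using P[of "{-2 * int R..2 * int R}"] P[of "{-2 * int R + h..2 * int R + h}"]
    by (simp add: add_divide_distrib[symmetric])
qed

text \<open>
  The signed distance from \<open>\<eta>\<close> to the nearest integer in units of \<open>1/(2H)\<close>, rounded down.
\<close>
definition cell :: "nat \<Rightarrow> real \<Rightarrow> int" where
  "cell H \<eta> = \<lfloor>2 * real H * (\<eta> - of_int (round \<eta>))\<rfloor>"

text \<open>
  The trivial bound \<open>5R\<close> serves the cells next to zero, and the second difference bound the others.
\<close>
lemma norm_sum_triangle_product_le:
  assumes "R > 0"
  shows "norm (\<Sum>x\<in>{-2 * int R..2 * int R}. (triangle R x * triangle R (x + h)) * cis (2 * pi * \<eta> * of_int x))
           \<le> 1152 * real R / (1 + (real_of_int (cell (8 * R) \<eta>))\<^sup>2)" (is "norm ?S \<le> _")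
proof -
  define z where "z = real_of_int (cell (8 * R) \<eta>)"
  define y where "y = \<eta> - of_int (round \<eta>)"
  have y: "\<bar>y\<bar> \<le> 1 / 2" using of_int_round_abs_le[of \<eta>] by (simp add: y_def abs_minus_commute)
  have z: "z \<le> 16 * real R * y" "16 * real R * y < z + 1"
    unfolding z_def y_def cell_def by (simp_all; linarith)+
  have triv: "norm ?S \<le> 5 * real R"
  proof -
    have "norm ?S \<le> (\<Sum>x\<in>{-2 * int R..2 * int R}. 1)"
      using triangle_nonneg[of R] triangle_le_1[of R]
      by (intro order_trans[OF norm_sum] sum_mono) (auto simp: norm_mult intro!: mult_le_one)
    then show ?thesis using assms by simp
  qed
  show ?thesis
  proof (cases "\<bar>z\<bar> \<le> 1")
    case True
    then have "z\<^sup>2 \<le> 1" by (simp add: abs_square_le_1)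
    then have "5 * real R * (1 + z\<^sup>2) \<le> 5 * real R * 2" by (intro mult_left_mono) auto
    then have "5 * real R * (1 + z\<^sup>2) \<le> 1152 * real R" by simp
    then have "5 * real R \<le> 1152 * real R / (1 + z\<^sup>2)"
      by (simp add: pos_le_divide_eq add_pos_nonneg)
    then show ?thesis using triv by (simp add: z_def)
  next
    case False
    have "\<bar>z\<bar> = real_of_int \<bar>cell (8 * R) \<eta>\<bar>" by (simp add: z_def)
    moreover from this False have "2 \<le> \<bar>cell (8 * R) \<eta>\<bar>" by simp
    ultimately have z2: "\<bar>z\<bar> \<ge> 2" by linarith
    then have "\<bar>z\<bar> \<le> \<bar>32 * real R * y\<bar>" using z by linarith
    then have "\<bar>z\<bar>\<^sup>2 \<le> \<bar>32 * real R * y\<bar>\<^sup>2" by (intro power_mono) auto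
    then have zy: "z\<^sup>2 \<le> 1024 * (real R)\<^sup>2 * y\<^sup>2" by (simp add: power_mult_distrib)
    have "(sin (pi * \<eta>))\<^sup>2 = (sin (pi * y))\<^sup>2"
    proof -
      have sq: "(sin t)\<^sup>2 = (1 - cos (2 * t)) / 2" for t :: real
        using cos_double_sin[of t] by simp
      have "2 * (pi * \<eta>) = 2 * (pi * y) + 2 * pi * of_int (round \<eta>)" by (simp add: y_def algebra_simps)
      then have "cos (2 * (pi * \<eta>)) = cos (2 * (pi * y))"
        by (simp only: cos_add cos_int_2pin sin_int_2pin)
      then show ?thesis by (simp only: sq)
    qed
    then have s: "4 * y\<^sup>2 \<le> (sin (pi * \<eta>))\<^sup>2" using sin_pi_lower_bound[OF y] by simp
    have "16 * y\<^sup>2 * norm ?S \<le> 4 * (sin (2 * pi * \<eta> / 2))\<^sup>2 * norm ?S"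
      using s by (intro mult_right_mono) auto
    also have "\<dots> \<le> 9 / real R"
    proof (rule order_trans)
      show "4 * (sin (2 * pi * \<eta> / 2))\<^sup>2 * norm ?S \<le> (\<Sum>x\<in>{-2 * int R..2 * int R}.
          \<bar>triangle R (x + 1) * triangle R (x + 1 + h) - 2 * (triangle R x * triangle R (x + h))
            + triangle R (x - 1) * triangle R (x - 1 + h)\<bar>)"
        using norm_sum_cis_le_second_differences[of "2 * int R" "\<lambda>x. triangle R x * triangle R (x + h)" "2 * pi * \<eta>"]
        using assms by (simp add: triangle_eq_0)
      show "\<dots> \<le> 9 / real R" by (rule triangle_product_second_differences[OF assms])
    qed
    finally have *: "real R * (16 * y\<^sup>2 * norm ?S) \<le> 9" using assms by (simp add: field_simps)
    have "z\<^sup>2 * norm ?S \<le> 1024 * (real R)\<^sup>2 * y\<^sup>2 * norm ?S" using zy by (intro mult_right_mono) auto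
    also have "\<dots> = 64 * real R * (real R * (16 * y\<^sup>2 * norm ?S))" by (simp add: power2_eq_square)
    also have "\<dots> \<le> 64 * real R * 9" using * by (intro mult_left_mono) auto
    finally have 1: "z\<^sup>2 * norm ?S \<le> 576 * real R" by simp
    have "1\<^sup>2 \<le> \<bar>z\<bar>\<^sup>2" using z2 by (intro power_mono) auto
    then have "1 * norm ?S \<le> z\<^sup>2 * norm ?S" by (intro mult_right_mono) auto
    then have "(1 + z\<^sup>2) * norm ?S \<le> 1152 * real R" using 1 unfolding distrib_right by linarith
    then show ?thesis by (simp add: z_def pos_le_divide_eq add_pos_nonneg mult.commute)
  qed
qed

text \<open>
  The difference of two elements \<open>h\<close> in one cell is a multiplier that brings \<open>\<alpha>\<close> within \<open>1/(2H)\<close> of an integer;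
  subtracting the least element maps the others injectively to such multipliers.
\<close>
lemma card_cell_le:
  assumes "R > 0"
  shows "card {h \<in> {-4 * int R..4 * int R}. cell (8 * R) (\<alpha> * of_int h) = c} \<le> 1 + near_integer_count (8 * R) \<alpha>"
    (is "card ?A \<le> _")
proof -
  define A where "A = ?A"
  have card: "card A \<le> 1 + near_integer_count (8 * R) \<alpha>"
  proof (cases "A = {}")
    case False
    define h0 where "h0 = Min A"
    have fin: "finite A" unfolding A_def by (rule finite_subset[of _ "{-4 * int R..4 * int R}"]) auto
    have h0: "h0 \<in> A" unfolding h0_def using fin False by (rule Min_in)
    define N where "N = {h \<in> {1..8 * R}. \<exists>a::int. \<bar>\<alpha> * real h - a\<bar> < 1 / (2 * real (8 * R))}"
    have "(\<lambda>h. nat (h - h0)) ` (A - {h0}) \<subseteq> N"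
    proof (rule image_subsetI)
      fix h assume h: "h \<in> A - {h0}"
      then have "h0 \<le> h" unfolding h0_def by (intro Min_le[OF fin]) blast
      with h have "h > h0" by auto
      define y where "y = (\<lambda>h::int. \<alpha> * of_int h - of_int (round (\<alpha> * of_int h)))"
      have "\<lfloor>16 * real R * y h\<rfloor> = \<lfloor>16 * real R * y h0\<rfloor>"
        using h h0 by (auto simp: A_def cell_def y_def)
      then have "\<bar>16 * real R * y h - 16 * real R * y h0\<bar> < 1" by linarith
      then have "\<bar>16 * real R * (y h - y h0)\<bar> < 1" by (simp add: right_diff_distrib)
      then have "16 * real R * \<bar>y h - y h0\<bar> < 1" by (simp add: abs_mult)
      then have "\<bar>y h - y h0\<bar> < 1 / (2 * real (8 * R))" using assms by (simp add: field_simps)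
      moreover have "y h - y h0 = \<alpha> * real (nat (h - h0)) - of_int (round (\<alpha> * of_int h) - round (\<alpha> * of_int h0))"
        using \<open>h > h0\<close> by (simp add: y_def algebra_simps)
      ultimately have "\<bar>\<alpha> * real (nat (h - h0)) - of_int (round (\<alpha> * of_int h) - round (\<alpha> * of_int h0))\<bar> < 1 / (2 * real (8 * R))"
        by (simp only:)
      moreover have "nat (h - h0) \<in> {1..8 * R}" using h h0 \<open>h > h0\<close> by (auto simp: A_def)
      ultimately show "nat (h - h0) \<in> N" unfolding N_def by blast
    qed
    moreover have "inj_on (\<lambda>h. nat (h - h0)) (A - {h0})"
    proof (rule inj_onI)
      fix x y assume "x \<in> A - {h0}" "y \<in> A - {h0}" "nat (x - h0) = nat (y - h0)"
      moreover have "h0 \<le> h" if "h \<in> A" for h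
        using Min_le[OF fin that] by (simp only: h0_def)
      ultimately show "x = y" by (metis DiffD1 diff_ge_0_iff_ge eq_nat_nat_iff diff_add_cancel)
    qed
    moreover have "finite N" by (simp add: N_def)
    ultimately have "card (A - {h0}) \<le> card N" by (intro card_inj_on_le)
    moreover have "card A = card (A - {h0}) + 1" using h0 fin by (metis card_Suc_Diff1 Suc_eq_plus1)
    ultimately show ?thesis by (simp add: near_integer_count_def N_def)
  next
    case True
    then show ?thesis by simp
  qed
  then show ?thesis by (simp only: A_def)
qed

lemma sum_inverse_one_plus_square: "(\<Sum>c\<in>{-int H..int H}. 1 / (1 + (real_of_int c)\<^sup>2)) \<le> 5"
proof -
  have half: "(\<Sum>c=1..n. 1 / (1 + (real c)\<^sup>2)) \<le> 2 - 2 / (1 + real n)" for n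
  proof (induction n)
    case (Suc n)
    have "1 / (1 + (real (Suc n))\<^sup>2) \<le> 2 / (1 + real n) - 2 / (1 + real (Suc n))"
    proof -
      have "2 / (1 + real n) - 2 / (1 + real (Suc n)) = 2 / ((1 + real n) * (2 + real n))"
        by (simp add: field_simps)
      moreover have "2 / (2 * (1 + (real (Suc n))\<^sup>2)) \<le> 2 / ((1 + real n) * (2 + real n))"
      proof (rule frac_le)
        show "0 < (1 + real n) * (2 + real n)" by (intro mult_pos_pos) auto
      qed (auto simp: power2_eq_square algebra_simps)
      moreover have "2 / (2 * z) = 1 / z" for z :: real by simp
      ultimately show ?thesis by (simp only:)
    qed
    then show ?case using Suc by simp
  qed auto
  have "(\<Sum>c\<in>{-int H..int H}. 1 / (1 + (real_of_int c)\<^sup>2)) =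
     (\<Sum>c\<in>{1..int H}. 1 / (1 + (real_of_int c)\<^sup>2)) + 1 + (\<Sum>c\<in>{-int H..-1}. 1 / (1 + (real_of_int c)\<^sup>2))"
  proof -
    have "{-int H..int H} = {1..int H} \<union> insert 0 {-int H..-1}" by auto
    then show ?thesis by (simp add: sum.union_disjoint)
  qed
  also have "(\<Sum>c\<in>{1..int H}. 1 / (1 + (real_of_int c)\<^sup>2)) = (\<Sum>c=1..H. 1 / (1 + (real c)\<^sup>2))"
    by (rule sum.reindex_bij_witness[of _ int nat]) auto
  also have "(\<Sum>c\<in>{-int H..-1}. 1 / (1 + (real_of_int c)\<^sup>2)) = (\<Sum>c=1..H. 1 / (1 + (real c)\<^sup>2))"
    by (rule sum.reindex_bij_witness[of _ "\<lambda>c. - int c" "\<lambda>c. nat (-c)"]) auto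
  finally have "(\<Sum>c\<in>{-int H..int H}. 1 / (1 + (real_of_int c)\<^sup>2)) = 2 * (\<Sum>c=1..H. 1 / (1 + (real c)\<^sup>2)) + 1"
    by simp
  moreover have "2 / (1 + real H) \<ge> 0" by simp
  ultimately show ?thesis using half[of H] by linarith
qed

definition weyl_sum :: "nat \<Rightarrow> nat \<Rightarrow> int \<Rightarrow> int \<Rightarrow> complex" where
  "weyl_sum M R k t = (\<Sum>x\<in>{-2 * int R..2 * int R}.
     triangle R x * cis (2 * pi * of_int (k * x\<^sup>2 + t * x) / real M))"

text \<open>
  Expanding the square and substituting \<open>y = x + h\<close> leaves for each \<open>h\<close> a sum whose phase is linear in \<open>x\<close>. The
  frequency \<open>t\<close> only enters through a factor of modulus one, so the bound is uniform in \<open>t\<close>.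
\<close>
lemma weyl_differencing:
  assumes "R > 0"
  shows "(norm (weyl_sum M R k t))\<^sup>2 \<le> (\<Sum>h\<in>{-4 * int R..4 * int R}.
     norm (\<Sum>x\<in>{-2 * int R..2 * int R}. (triangle R x * triangle R (x + h)) *
        cis (2 * pi * ((2 * of_int k / real M) * of_int h) * of_int x)))"
proof -
  let ?X = "{-2 * int R..2 * int R}" and ?H = "{-4 * int R..4 * int R}"
  define e where "e = (\<lambda>j::int. cis (2 * pi * of_int j / real M))"
  have e_diff: "e (i - j) = e i * cnj (e j)" for i j
    by (simp add: e_def cis_cnj cis_mult right_diff_distrib diff_divide_distrib)
  have e_add: "e (i + j) = e i * e j" for i j
    by (simp add: e_def cis_mult distrib_left add_divide_distrib)
  let ?f = "\<lambda>x. k * x\<^sup>2 + t * x"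
  have "of_real ((norm (weyl_sum M R k t))\<^sup>2) = weyl_sum M R k t * cnj (weyl_sum M R k t)"
    using complex_norm_square by simp
  also have "\<dots> = (\<Sum>x\<in>?X. \<Sum>y\<in>?X. of_real (triangle R y * triangle R x) * e (?f y - ?f x))"
    unfolding weyl_sum_def e_diff cnj_sum sum_product
    by (subst sum.swap, intro sum.cong refl) (simp add: e_def)
  also have "\<dots> = (\<Sum>x\<in>?X. \<Sum>h\<in>?H. of_real (triangle R (x + h) * triangle R x) * e (?f (x + h) - ?f x))"
  proof (rule sum.cong[OF refl])
    fix x assume x: "x \<in> ?X"
    have "(\<Sum>h\<in>?H. of_real (triangle R (x + h) * triangle R x) * e (?f (x + h) - ?f x))
       = (\<Sum>y\<in>{-4 * int R + x..4 * int R + x}. of_real (triangle R y * triangle R x) * e (?f y - ?f x))"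
      by (rule sum.reindex_bij_witness[of _ "\<lambda>y. y - x" "\<lambda>h. x + h"]) auto
    also have "\<dots> = (\<Sum>y\<in>?X. of_real (triangle R y * triangle R x) * e (?f y - ?f x))"
      using x assms by (intro sum.mono_neutral_right) (auto simp: triangle_eq_0)
    finally show "(\<Sum>y\<in>?X. of_real (triangle R y * triangle R x) * e (?f y - ?f x)) =
      (\<Sum>h\<in>?H. of_real (triangle R (x + h) * triangle R x) * e (?f (x + h) - ?f x))" by (rule sym)
  qed
  also have "\<dots> = (\<Sum>h\<in>?H. e (k * h\<^sup>2 + t * h) * (\<Sum>x\<in>?X. of_real (triangle R x * triangle R (x + h)) *
        cis (2 * pi * ((2 * of_int k / real M) * of_int h) * of_int x)))"
  proof -
    have "e (?f (x + h) - ?f x) = e (k * h\<^sup>2 + t * h) * cis (2 * pi * ((2 * of_int k / real M) * of_int h) * of_int x)" for x h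
    proof -
      have "?f (x + h) - ?f x = (k * h\<^sup>2 + t * h) + 2 * k * h * x" by (simp add: power2_eq_square algebra_simps)
      moreover have "e (2 * k * h * x) = cis (2 * pi * ((2 * of_int k / real M) * of_int h) * of_int x)"
        by (simp add: e_def mult_ac)
      ultimately show ?thesis by (simp only: e_add)
    qed
    then show ?thesis by (subst sum.swap) (simp add: sum_distrib_left mult.assoc mult.left_commute mult.commute)
  qed
  finally have "(norm (weyl_sum M R k t))\<^sup>2 = norm \<dots>"
    by (metis abs_norm_cancel abs_power2 norm_of_real)
  also have "\<dots> \<le> (\<Sum>h\<in>?H. norm (e (k * h\<^sup>2 + t * h) * (\<Sum>x\<in>?X. of_real (triangle R x * triangle R (x + h)) *
        cis (2 * pi * ((2 * of_int k / real M) * of_int h) * of_int x))))"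
    by (rule norm_sum)
  also have "\<dots> = (\<Sum>h\<in>?H. norm (\<Sum>x\<in>?X. of_real (triangle R x * triangle R (x + h)) *
        cis (2 * pi * ((2 * of_int k / real M) * of_int h) * of_int x)))"
    by (simp add: norm_mult e_def)
  finally show ?thesis by simp
qed

text \<open>
  Group the shifts \<open>h\<close> by cells: each cell contains at most \<open>1 + L\<close> of them, \<open>L\<close> being the number of near-integer
  multiples, and the bounds for the cells form a convergent series.
\<close>
lemma weyl_sum_bound:
  assumes "R > 0"
  shows "(norm (weyl_sum M R k t))\<^sup>2 \<le> 5760 * real R * (1 + real (near_integer_count (8 * R) (2 * of_int k / real M)))"
proof -
  let ?H = "{-4 * int R..4 * int R}"
  define \<alpha> where "\<alpha> = 2 * of_int k / real M"
  define L where "L = near_integer_count (8 * R) \<alpha>"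
  define c where "c = (\<lambda>h::int. cell (8 * R) (\<alpha> * of_int h))"
  have c: "c h \<in> {-int (8 * R)..int (8 * R)}" for h
  proof -
    define y where "y = \<alpha> * of_int h - of_int (round (\<alpha> * of_int h))"
    have y: "\<bar>y\<bar> \<le> 1 / 2" using of_int_round_abs_le[of "\<alpha> * of_int h"] by (simp add: y_def abs_minus_commute)
    have "\<bar>16 * real R * y\<bar> = 16 * real R * \<bar>y\<bar>" by (simp add: abs_mult)
    also have "\<dots> \<le> 16 * real R * (1 / 2)" using y by (intro mult_left_mono) auto
    finally have "\<bar>16 * real R * y\<bar> \<le> real (8 * R)" by simp
    then have "- int (8 * R) \<le> \<lfloor>16 * real R * y\<rfloor>" "\<lfloor>16 * real R * y\<rfloor> \<le> int (8 * R)" by linarith+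
    then show ?thesis by (simp add: c_def cell_def y_def)
  qed
  have "(norm (weyl_sum M R k t))\<^sup>2 \<le> (\<Sum>h\<in>?H. 1152 * real R / (1 + (real_of_int (c h))\<^sup>2))"
    unfolding c_def \<alpha>_def
    by (rule order_trans[OF weyl_differencing[OF assms] sum_mono]) (rule norm_sum_triangle_product_le[OF assms])
  also have "\<dots> = (\<Sum>j\<in>{-int (8 * R)..int (8 * R)}. \<Sum>h\<in>{h\<in>?H. c h = j}. 1152 * real R / (1 + (real_of_int (c h))\<^sup>2))"
    using c by (intro sum.group[symmetric]) auto
  also have "\<dots> = (\<Sum>j\<in>{-int (8 * R)..int (8 * R)}. real (card {h\<in>?H. c h = j}) * (1152 * real R / (1 + (real_of_int j)\<^sup>2)))"
    by (intro sum.cong refl) simp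
  also have "\<dots> \<le> (\<Sum>j\<in>{-int (8 * R)..int (8 * R)}. (1 + real L) * (1152 * real R / (1 + (real_of_int j)\<^sup>2)))"
  proof (intro sum_mono mult_right_mono)
    fix j
    have "card {h\<in>?H. c h = j} \<le> 1 + L" unfolding L_def c_def by (rule card_cell_le[OF assms])
    then show "real (card {h\<in>?H. c h = j}) \<le> 1 + real L" by linarith
  qed (auto simp: add_nonneg_nonneg)
  also have "\<dots> = (1 + real L) * (1152 * real R) * (\<Sum>j\<in>{-int (8 * R)..int (8 * R)}. 1 / (1 + (real_of_int j)\<^sup>2))"
    by (simp add: sum_distrib_left)
  also have "\<dots> \<le> (1 + real L) * (1152 * real R) * 5"
    by (intro mult_left_mono sum_inverse_one_plus_square) auto
  finally show ?thesis by (simp add: L_def \<alpha>_def mult.commute)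
qed

section \<open>Level sets and interpolation\<close>

lemma power_add_le_convex:
  fixes a b :: real
  assumes "0 \<le> a" "0 \<le> b"
  shows "(a + b) ^ Suc p \<le> 2 ^ p * (a ^ Suc p + b ^ Suc p)"
proof (induction p)
  case (Suc p)
  have cheb: "0 \<le> (a ^ Suc p - b ^ Suc p) * (a - b)"
    using assms by (cases "a \<le> b") (auto intro!: mult_nonneg_nonneg mult_nonpos_nonpos power_mono simp del: power_Suc)
  have "(a + b) ^ Suc (Suc p) = (a + b) * (a + b) ^ Suc p" by simp
  also have "\<dots> \<le> (a + b) * (2 ^ p * (a ^ Suc p + b ^ Suc p))"
    using Suc assms by (intro mult_left_mono) auto
  also have "\<dots> = 2 ^ p * ((a + b) * (a ^ Suc p + b ^ Suc p))" by (simp only: mult.left_commute)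
  also have "\<dots> \<le> 2 ^ p * (2 * (a ^ Suc (Suc p) + b ^ Suc (Suc p)))"
    using cheb by (intro mult_left_mono) (simp_all add: algebra_simps)
  finally show ?case by (simp add: algebra_simps)
qed auto

text \<open>
  A substitute for Minkowski's inequality for pieces of geometrically decaying size: splitting off one summand at a
  time costs a factor \<open>2\<^sup>p\<close> at each step.
\<close>
lemma power_sum_le_geometric:
  fixes x :: "nat \<Rightarrow> real"
  assumes "\<And>s. 0 \<le> x s"
  shows "(\<Sum>s<m. x s) ^ Suc p \<le> (\<Sum>s<m. 2 ^ (p * Suc s) * x s ^ Suc p)"
  using assms
proof (induction m arbitrary: x)
  case (Suc m)
  have "(\<Sum>s<Suc m. x s) ^ Suc p = (x 0 + (\<Sum>s<m. x (Suc s))) ^ Suc p"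
    by (simp only: sum.lessThan_Suc_shift)
  also have "\<dots> \<le> 2 ^ p * (x 0 ^ Suc p + (\<Sum>s<m. x (Suc s)) ^ Suc p)"
    using Suc.prems by (intro power_add_le_convex sum_nonneg) auto
  also have "\<dots> \<le> 2 ^ p * (x 0 ^ Suc p + (\<Sum>s<m. 2 ^ (p * Suc s) * x (Suc s) ^ Suc p))"
    using Suc.IH[of "\<lambda>s. x (Suc s)"] Suc.prems by (intro mult_left_mono add_left_mono) auto
  also have "\<dots> = (\<Sum>s<Suc m. 2 ^ (p * Suc s) * x s ^ Suc p)"
    by (simp only: sum.lessThan_Suc_shift distrib_left sum_distrib_left) (simp add: power_add mult_ac)
  finally show ?case .
qed auto

lemma sum_inverse_powers_of_2: "(\<Sum>s<m. 1 / 2 ^ s :: real) \<le> 2"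
  using sum_gp_strict[of "1 / 2 :: real" m] by (simp add: power_one_over)

definition level :: "('k \<Rightarrow> real) \<Rightarrow> nat \<Rightarrow> 'k \<Rightarrow> nat" where
  "level v b k = (LEAST s. 1 / real b ^ Suc s < v k)"

lemma level_bounds:
  assumes "b \<ge> 2" "0 < v k" "v k \<le> 1"
  shows "1 / real b ^ Suc (level v b k) < v k" "v k \<le> 1 / real b ^ level v b k"
proof -
  have "\<exists>s. 1 / real b ^ Suc s < v k"
  proof -
    obtain s where "(1 / real b) ^ s < v k" using assms real_arch_pow_inv[of "v k" "1 / real b"] by auto
    moreover have "1 / real b ^ Suc s \<le> 1 / real b ^ s"
      using assms by (intro frac_le power_increasing) auto
    ultimately show ?thesis by (auto simp: power_one_over intro: le_less_trans)
  qed
  then show "1 / real b ^ Suc (level v b k) < v k"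
    unfolding level_def by (rule LeastI_ex)
  show "v k \<le> 1 / real b ^ level v b k"
  proof (cases "level v b k")
    case (Suc s)
    then have "\<not> 1 / real b ^ Suc s < v k"
      using not_less_Least[of s "\<lambda>s. 1 / real b ^ Suc s < v k"] by (simp add: level_def)
    then show ?thesis using Suc by simp
  qed (use assms in simp)
qed

text \<open>
  The distribution of the normalised size \<open>v\<close> of the Weyl sums: a bound for the weak \<open>L\<^sup>4\<close> norm. The fourth
  moment itself may be larger by a logarithm, but all moments above the fourth are controlled.
\<close>
locale weak_L4 =
  fixes K :: "'k set" and v :: "'k \<Rightarrow> real" and C :: real
  assumes finK: "finite K"
    and v: "k \<in> K \<Longrightarrow> 0 < v k" "k \<in> K \<Longrightarrow> v k \<le> 1"
    and C: "C \<ge> 0"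
    and weak: "0 < y \<Longrightarrow> real (card {k \<in> K. y < v k}) \<le> C / y ^ 4"
begin

lemma card_level:
  assumes "b \<ge> 2"
  shows "real (card {k \<in> K. level v b k = s}) \<le> C * real b ^ (4 * Suc s)"
proof -
  have "card {k \<in> K. level v b k = s} \<le> card {k \<in> K. 1 / real b ^ Suc s < v k}"
    using level_bounds(1)[of b v, OF assms] v finK by (intro card_mono) auto
  also have "real \<dots> \<le> C / (1 / real b ^ Suc s) ^ 4"
    using assms by (intro weak) auto
  also have "\<dots> = C * real b ^ (4 * Suc s)"
    by (simp add: power_one_over power_mult[symmetric] mult.commute del: power_Suc)
  finally show ?thesis by simp
qed

lemma sum_over_levels:
  obtains m where "\<And>g :: 'k \<Rightarrow> 'b::comm_monoid_add. sum g K = (\<Sum>s<m. \<Sum>k\<in>{k \<in> K. level v b k = s}. g k)"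
proof
  fix g :: "'k \<Rightarrow> 'b"
  show "sum g K = (\<Sum>s<Suc (Max (level v b ` K)). \<Sum>k\<in>{k \<in> K. level v b k = s}. g k)"
    by (rule sum.group[symmetric]) (auto simp: finK less_Suc_eq_le)
qed

lemma moment_bound:
  assumes "d \<ge> 5"
  shows "(\<Sum>k\<in>K. v k ^ d) \<le> 32 * C"
proof -
  obtain m where m: "\<And>g :: 'k \<Rightarrow> real. sum g K = (\<Sum>s<m. \<Sum>k\<in>{k \<in> K. level v 2 k = s}. g k)"
    using sum_over_levels by blast
  have "(\<Sum>k\<in>{k \<in> K. level v 2 k = s}. v k ^ d) \<le> 16 * C * (1 / 2 ^ s)" for s
  proof -
    have "(\<Sum>k\<in>{k \<in> K. level v 2 k = s}. v k ^ d) \<le> (\<Sum>k\<in>{k \<in> K. level v 2 k = s}. (1 / 2 ^ s) ^ 5)"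
    proof (rule sum_mono)
      fix k assume k: "k \<in> {k \<in> K. level v 2 k = s}"
      then have "v k ^ d \<le> v k ^ 5" using assms v by (intro power_decreasing) (auto intro: less_imp_le)
      also have "\<dots> \<le> (1 / 2 ^ s) ^ 5"
        using k v[of k] level_bounds(2)[of 2 v k] by (intro power_mono) (auto intro: less_imp_le)
      finally show "v k ^ d \<le> (1 / 2 ^ s) ^ 5" .
    qed
    also have "\<dots> = real (card {k \<in> K. level v 2 k = s}) * (1 / 2 ^ s) ^ 5" by simp
    also have "\<dots> \<le> (C * 2 ^ (4 * Suc s)) * (1 / 2 ^ s) ^ 5"
      using card_level[of 2 s] by (intro mult_right_mono) auto
    also have "\<dots> = 16 * C * (1 / 2 ^ s)"
    proof -
      have "2 ^ (4 * Suc s) = (16 * (2 ^ s) ^ 4 :: real)"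
        by (simp add: power_mult[symmetric] mult.commute power_add)
      then show ?thesis by (simp add: power_one_over eval_nat_numeral field_simps)
    qed
    finally show ?thesis .
  qed
  then have "(\<Sum>k\<in>K. v k ^ d) \<le> (\<Sum>s<m. 16 * C * (1 / 2 ^ s))"
    unfolding m by (intro sum_mono)
  also have "\<dots> = 16 * C * (\<Sum>s<m. 1 / 2 ^ s)" by (simp only: sum_distrib_left)
  also have "\<dots> \<le> 16 * C * 2" using C by (intro mult_left_mono sum_inverse_powers_of_2) auto
  finally show ?thesis by simp
qed

text \<open>
  Here \<open>P k\<close> is the contribution of one fraction to the exponential sum. On the set where \<open>v\<close> is about
  \<open>b\<^sup>-\<^sup>s\<close>, the number of fractions, of order \<open>b\<^sup>4\<^sup>s\<close>, gives
  the supremum bound \<open>D\<^sup>d b\<^sup>-\<^sup>(\<^sup>d\<^sup>-\<^sup>4\<^sup>)\<^sup>s\<close> and the \<open>L\<^sup>2\<close> bound \<open>E b\<^sup>4\<^sup>s\<close>. Multiplying the power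
  \<open>2n - 2\<close> of the former by the latter leaves the decay \<open>b\<^sup>-\<^sup>2\<^sup>s\<close>, because
  \<open>(2n - 2)(d - 4) - 4 \<ge> 2\<close>.
  The base \<open>b = 2\<^sup>n\<close> is so large that this decay absorbs the factors \<open>2\<^sup>(\<^sup>2\<^sup>n\<^sup>-\<^sup>1\<^sup>)\<^sup>(\<^sup>s\<^sup>+\<^sup>1\<^sup>)\<close> from putting the pieces together.
\<close>
theorem interpolation:
  fixes P :: "'k \<Rightarrow> 't \<Rightarrow> complex" and T :: "'t set" and D E :: real and d n :: nat
  assumes "D \<ge> 0"
    and sup: "\<And>k t. k \<in> K \<Longrightarrow> t \<in> T \<Longrightarrow> norm (P k t) \<le> (D * v k) ^ d"
    and L2: "\<And>A. A \<subseteq> K \<Longrightarrow> (\<Sum>t\<in>T. (norm (\<Sum>k\<in>A. P k t))\<^sup>2) \<le> real (card A) * E"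
    and E: "E \<ge> 0"
    and n: "n \<ge> 1" and nd: "(n - 1) * (d - 4) \<ge> 3"
  shows "(\<Sum>t\<in>T. norm (\<Sum>k\<in>K. P k t) ^ (2 * n))
           \<le> 2 ^ (2 * n) * (C * 2 ^ (4 * n)) ^ (2 * n - 1) * (D ^ d) ^ (2 * n - 2) * E"
proof -
  define b where "b = (2::nat) ^ n"
  have b: "b \<ge> 2" using n unfolding b_def by (metis one_le_numeral power_increasing power_one_right)
  have d: "d \<ge> 4" using nd by (cases "d \<ge> 4") auto
  obtain m where m: "\<And>g :: 'k \<Rightarrow> complex. sum g K = (\<Sum>s<m. \<Sum>k\<in>{k \<in> K. level v b k = s}. g k)"
    using sum_over_levels by blast
  define A where "A = (\<lambda>s. {k \<in> K. level v b k = s})"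
  define x where "x = (\<lambda>s t. norm (\<Sum>k\<in>A s. P k t))"
  define c where "c = C * real b ^ 4"
  have c0: "c \<ge> 0" using C by (simp add: c_def)
  have cardA: "real (card (A s)) \<le> c * real b ^ (4 * s)" for s
    using card_level[OF b, of s] by (simp add: A_def c_def power_add mult_ac)
  have x0: "x s t \<ge> 0" for s t by (simp add: x_def)
  have xsup: "x s t \<le> c * D ^ d / real b ^ ((d - 4) * s)" if "t \<in> T" for s t
  proof -
    have "x s t \<le> (\<Sum>k\<in>A s. (D * (1 / real b ^ s)) ^ d)"
      unfolding x_def
    proof (rule order_trans[OF norm_sum sum_mono])
      fix k assume k: "k \<in> A s"
      then have kK: "k \<in> K" and lk: "level v b k = s" by (auto simp: A_def)
      have "norm (P k t) \<le> (D * v k) ^ d" using sup kK that by blast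
      also have "\<dots> \<le> (D * (1 / real b ^ s)) ^ d"
        using level_bounds(2)[of b v k, OF b v(1)[OF kK] v(2)[OF kK]] lk v(1)[OF kK] assms(1)
        by (intro power_mono mult_left_mono) auto
      finally show "norm (P k t) \<le> (D * (1 / real b ^ s)) ^ d" .
    qed
    also have "\<dots> = real (card (A s)) * (D ^ d * (1 / real b ^ s) ^ d)"
      by (simp only: sum_constant power_mult_distrib)
    also have "\<dots> \<le> (c * real b ^ (4 * s)) * (D ^ d * (1 / real b ^ s) ^ d)"
      using cardA assms(1) by (intro mult_right_mono) auto
    also have "\<dots> = c * D ^ d / real b ^ ((d - 4) * s)"
    proof -
      have "(real b ^ s) ^ d = real b ^ (4 * s) * real b ^ ((d - 4) * s)"
        using d by (simp add: power_mult[symmetric] power_add[symmetric] algebra_simps)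
      then show ?thesis using b by (simp add: power_one_over field_simps)
    qed
    finally show ?thesis .
  qed
  have xs: "(\<Sum>t\<in>T. x s t ^ (2 * n)) \<le> c ^ (2 * n - 1) * (D ^ d) ^ (2 * n - 2) * E / real b ^ (2 * s)" for s
  proof -
    have n2: "2 * n = (2 * n - 2) + 2" using n by simp
    have "(\<Sum>t\<in>T. x s t ^ (2 * n)) = (\<Sum>t\<in>T. x s t ^ (2 * n - 2) * (x s t)\<^sup>2)"
      by (subst n2) (simp only: power_add)
    also have "\<dots> \<le> (\<Sum>t\<in>T. (c * D ^ d / real b ^ ((d - 4) * s)) ^ (2 * n - 2) * (x s t)\<^sup>2)"
      using x0 xsup by (intro sum_mono mult_right_mono power_mono) auto
    also have "\<dots> = (c * D ^ d / real b ^ ((d - 4) * s)) ^ (2 * n - 2) * (\<Sum>t\<in>T. (x s t)\<^sup>2)"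
      by (simp only: sum_distrib_left)
    also have "\<dots> \<le> (c * D ^ d / real b ^ ((d - 4) * s)) ^ (2 * n - 2) * (c * real b ^ (4 * s) * E)"
    proof (rule mult_left_mono)
      have "(\<Sum>t\<in>T. (x s t)\<^sup>2) \<le> real (card (A s)) * E"
        unfolding x_def by (rule L2) (auto simp: A_def)
      also have "\<dots> \<le> c * real b ^ (4 * s) * E" using cardA E by (intro mult_right_mono)
      finally show "(\<Sum>t\<in>T. (x s t)\<^sup>2) \<le> c * real b ^ (4 * s) * E" .
    qed (use c0 assms(1) in auto)
    also have "\<dots> = c ^ (2 * n - 1) * (D ^ d) ^ (2 * n - 2) * E * (real b ^ (4 * s) / (real b ^ ((d - 4) * s)) ^ (2 * n - 2))"
    proof -
      have "c ^ (2 * n - 1) = c ^ (2 * n - 2) * c"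
      proof -
        have "2 * n - 1 = Suc (2 * n - 2)" using n by simp
        then show ?thesis by simp
      qed
      then show ?thesis by (simp add: power_mult_distrib power_divide)
    qed
    also have "\<dots> \<le> c ^ (2 * n - 1) * (D ^ d) ^ (2 * n - 2) * E * (1 / real b ^ (2 * s))"
    proof (rule mult_left_mono)
      have "4 * s + 2 * s \<le> (d - 4) * s * (2 * n - 2)"
      proof -
        have "6 * s \<le> (2 * ((n - 1) * (d - 4))) * s" using nd by (intro mult_right_mono) auto
        also have "\<dots> = (d - 4) * s * (2 * n - 2)" by (simp add: algebra_simps diff_mult_distrib2)
        finally show ?thesis by simp
      qed
      then have "real b ^ (4 * s + 2 * s) \<le> real b ^ ((d - 4) * s * (2 * n - 2))"
        using b by (intro power_increasing) auto
      then have "real b ^ (4 * s) * real b ^ (2 * s) \<le> (real b ^ ((d - 4) * s)) ^ (2 * n - 2)"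
        by (simp only: power_add power_mult)
      then show "real b ^ (4 * s) / (real b ^ ((d - 4) * s)) ^ (2 * n - 2) \<le> 1 / real b ^ (2 * s)"
        using b by (simp add: field_simps)
    qed (use c0 assms(1) E in auto)
    finally show ?thesis by simp
  qed
  define X where "X = c ^ (2 * n - 1) * (D ^ d) ^ (2 * n - 2) * E"
  have X0: "X \<ge> 0" using c0 assms(1) E by (simp add: X_def)
  have "(\<Sum>t\<in>T. norm (\<Sum>k\<in>K. P k t) ^ (2 * n)) \<le> (\<Sum>t\<in>T. \<Sum>s<m. 2 ^ ((2 * n - 1) * Suc s) * x s t ^ (2 * n))"
  proof (rule sum_mono)
    fix t
    have n1: "Suc (2 * n - 1) = 2 * n" using n by simp
    have "norm (\<Sum>k\<in>K. P k t) \<le> (\<Sum>s<m. x s t)"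
      unfolding m x_def A_def by (rule norm_sum)
    then have "norm (\<Sum>k\<in>K. P k t) ^ (2 * n) \<le> (\<Sum>s<m. x s t) ^ (2 * n)" by (intro power_mono) auto
    also have "\<dots> \<le> (\<Sum>s<m. 2 ^ ((2 * n - 1) * Suc s) * x s t ^ (2 * n))"
      using power_sum_le_geometric[of "\<lambda>s. x s t" m "2 * n - 1", OF x0] unfolding n1 .
    finally show "norm (\<Sum>k\<in>K. P k t) ^ (2 * n) \<le> (\<Sum>s<m. 2 ^ ((2 * n - 1) * Suc s) * x s t ^ (2 * n))" .
  qed
  also have "\<dots> = (\<Sum>s<m. 2 ^ ((2 * n - 1) * Suc s) * (\<Sum>t\<in>T. x s t ^ (2 * n)))"
    by (subst sum.swap) (simp only: sum_distrib_left)
  also have "\<dots> \<le> (\<Sum>s<m. 2 ^ ((2 * n - 1) * Suc s) * (X / real b ^ (2 * s)))"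
    using xs by (intro sum_mono mult_left_mono) (auto simp: X_def)
  also have "\<dots> = (\<Sum>s<m. 2 ^ (2 * n - 1) * X * (1 / 2 ^ s))"
  proof (rule sum.cong[OF refl])
    fix s
    have "(2 * n - 1) * Suc s + s = (2 * n - 1) + n * (2 * s)"
      using n by (cases n) (auto simp: algebra_simps)
    then have "(2::real) ^ ((2 * n - 1) * Suc s) * 2 ^ s = 2 ^ (2 * n - 1) * real b ^ (2 * s)"
      unfolding b_def of_nat_power of_nat_numeral by (simp only: power_mult[symmetric] power_add[symmetric])
    then show "2 ^ ((2 * n - 1) * Suc s) * (X / real b ^ (2 * s)) = 2 ^ (2 * n - 1) * X * (1 / 2 ^ s)"
      using b by (simp add: field_simps del: power_Suc mult_Suc_right)
  qed
  also have "\<dots> = 2 ^ (2 * n - 1) * X * (\<Sum>s<m. 1 / 2 ^ s)" by (simp only: sum_distrib_left)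
  also have "\<dots> \<le> 2 ^ (2 * n - 1) * X * 2"
    using X0 by (intro mult_left_mono sum_inverse_powers_of_2) auto
  also have "\<dots> = 2 ^ (2 * n) * X"
  proof -
    have "2 * n = Suc (2 * n - 1)" using n by simp
    then have "(2::real) ^ (2 * n) = 2 ^ (2 * n - 1) * 2" by (metis power_Suc2)
    then show ?thesis by simp
  qed
  finally have "(\<Sum>t\<in>T. norm (\<Sum>k\<in>K. P k t) ^ (2 * n)) \<le> 2 ^ (2 * n) * X" .
  moreover have "c = C * 2 ^ (4 * n)" by (simp add: c_def b_def power_mult[symmetric] mult.commute)
  ultimately show ?thesis by (simp only: X_def mult.assoc)
qed

end

section \<open>Fourier analysis on a finite torus\<close>

lemma sum_cis_progression:
  fixes M :: nat and j :: int
  assumes "M > 0"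
  shows "(\<Sum>t\<in>{0..<int M}. cis (2 * pi * (of_int t * of_int j) / real M)) =
           (if int M dvd j then of_nat M else 0)"
proof -
  define \<zeta> where "\<zeta> = cis (2 * pi * of_int j / real M)"
  have "(\<Sum>t\<in>{0..<int M}. cis (2 * pi * (of_int t * of_int j) / real M)) = (\<Sum>t<M. \<zeta> ^ t)"
    by (rule sum.reindex_bij_witness[of _ int nat])
       (auto simp: \<zeta>_def Complex.DeMoivre algebra_simps)
  also have "\<dots> = (if int M dvd j then of_nat M else 0)"
  proof (cases "int M dvd j")
    case True
    then obtain c where "j = int M * c" by (elim dvdE)
    then have "\<zeta> = 1" using assms cis_multiple_2pi[of "of_int c"] by (simp add: \<zeta>_def algebra_simps)
    then show ?thesis using True by simp
  next
    case False
    have "\<zeta> \<noteq> 1"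
    proof
      assume "\<zeta> = 1"
      then obtain n :: int where "2 * pi * of_int j / real M = of_int n * (2 * pi)"
        using cos_one_2pi_int[of "2 * pi * of_int j / real M"]
        by (auto simp: \<zeta>_def complex_eq_iff)
      then have "real_of_int j = of_int (n * int M)" using assms by (simp add: field_simps)
      then have "j = n * int M" by linarith
      then show False using False by simp
    qed
    moreover have "\<zeta> ^ M = 1"
      using assms cis_multiple_2pi[of "of_int j"] by (simp add: \<zeta>_def Complex.DeMoivre)
    ultimately show ?thesis using False by (simp add: sum_gp_strict)
  qed
  finally show ?thesis .
qed

definition root_char :: "nat \<Rightarrow> int \<Rightarrow> complex" where
  "root_char M j = cis (2 * pi * of_int j / real M)"

lemma root_char_add: "root_char M (i + j) = root_char M i * root_char M j"
  by (simp add: root_char_def cis_mult distrib_left add_divide_distrib)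

lemma root_char_0: "root_char M 0 = 1"
  by (simp add: root_char_def)

lemma norm_root_char: "norm (root_char M j) = 1"
  by (simp add: root_char_def)

lemma cnj_root_char: "cnj (root_char M j) = root_char M (- j)"
  by (simp add: root_char_def cis_cnj)

lemma root_char_sum: "root_char M (\<Sum>i\<in>A. f i) = (\<Prod>i\<in>A. root_char M (f i))"
  by (induction A rule: infinite_finite_induct) (simp_all add: root_char_add root_char_0)

lemma root_char_multiple:
  assumes "M > 0"
  shows "root_char M (int M * j) = 1"
proof -
  have "2 * pi * of_int (int M * j) / real M = 2 * pi * of_int j" using assms by simp
  then show ?thesis unfolding root_char_def by (simp only:) (rule cis_multiple_2pi, simp)
qed

lemma sum_root_char:
  assumes "M > 0"
  shows "(\<Sum>t\<in>{0..<int M}. root_char M (t * j)) = (if int M dvd j then of_nat M else 0)"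
  using sum_cis_progression[OF assms, of j] by (simp add: root_char_def)

lemma weyl_sum_root_char:
  "weyl_sum M R k t = (\<Sum>x\<in>{-2 * int R..2 * int R}. triangle R x * root_char M (k * x\<^sup>2 + t * x))"
  by (simp add: weyl_sum_def root_char_def)

lemma weyl_sum_periodic:
  assumes "M > 0"
  shows "weyl_sum M R (k + int M * j) t = weyl_sum M R k t"
proof -
  have "(k + int M * j) * x\<^sup>2 + t * x = (k * x\<^sup>2 + t * x) + int M * (j * x\<^sup>2)" for x :: int
    by (simp add: algebra_simps)
  then show ?thesis
    using assms by (simp only: weyl_sum_root_char root_char_add root_char_multiple mult_1_right)
qed

lemma sum_rotate:
  "(\<Sum>x\<in>A. \<Sum>y\<in>B. \<Sum>z\<in>C. f x y z) = (\<Sum>y\<in>B. \<Sum>z\<in>C. \<Sum>x\<in>A. f x y z)"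
  by (subst sum.swap) (intro sum.cong refl sum.swap)

definition frequencies :: "nat \<Rightarrow> ('d::finite \<Rightarrow> int) set" where
  "frequencies M = (UNIV \<rightarrow>\<^sub>E {0..<int M})"

definition lattice_cube :: "nat \<Rightarrow> ('d::finite \<Rightarrow> int) set" where
  "lattice_cube R = (UNIV \<rightarrow>\<^sub>E {-2 * int R..2 * int R})"

lemma finite_lattice_cube: "finite (lattice_cube R)"
  by (auto simp: lattice_cube_def intro!: finite_PiE)

lemma sum_frequencies_root_char:
  fixes b :: "'d::finite \<Rightarrow> int"
  assumes "M > 0"
  shows "(\<Sum>t\<in>frequencies M. root_char M (\<Sum>i\<in>UNIV. t i * b i)) =
           (if \<forall>i. int M dvd b i then of_nat M ^ CARD('d) else 0)"
proof -
  have "(\<Sum>t\<in>frequencies M. root_char M (\<Sum>i\<in>UNIV. t i * b i)) = (\<Prod>i\<in>UNIV. \<Sum>t\<in>{0..<int M}. root_char M (t * b i))"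
    unfolding frequencies_def root_char_sum by (rule prod_sum_PiE[symmetric]) auto
  also have "\<dots> = (\<Prod>i\<in>UNIV. if int M dvd b i then of_nat M else 0)"
    using assms by (simp only: sum_root_char)
  also have "\<dots> = (if \<forall>i. int M dvd b i then of_nat M ^ CARD('d) else 0)"
    by (cases "\<forall>i. int M dvd b i") (auto intro!: prod_zero)
  finally show ?thesis .
qed

text \<open>
  Distinct points of the cube stay distinct modulo \<open>M\<close>, because their coordinates differ by at most \<open>4R < M\<close>.
\<close>
lemma parseval_lattice_cube:
  fixes c :: "('d::finite \<Rightarrow> int) \<Rightarrow> complex"
  assumes "M > 4 * R"
  shows "(\<Sum>t\<in>frequencies M. (norm (\<Sum>b\<in>lattice_cube R. c b * root_char M (\<Sum>i\<in>UNIV. t i * b i)))\<^sup>2)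
           = real M ^ CARD('d) * (\<Sum>b\<in>lattice_cube R. (norm (c b))\<^sup>2)"
proof -
  have M: "M > 0" using assms by simp
  let ?e = "\<lambda>t b :: 'd \<Rightarrow> int. root_char M (\<Sum>i\<in>UNIV. t i * b i)"
  have ee: "?e t b * cnj (?e t b') = ?e t (\<lambda>i. b i - b' i)" for t b b'
    by (simp add: cnj_root_char root_char_add[symmetric] right_diff_distrib sum_subtractf)
  have eq: "(\<forall>i. int M dvd b i - b' i) \<longleftrightarrow> b = b'" if "b \<in> lattice_cube R" "b' \<in> lattice_cube R" for b b' :: "'d \<Rightarrow> int"
  proof
    assume dv: "\<forall>i. int M dvd b i - b' i"
    have "b i = b' i" for i
    proof (rule ccontr)
      assume "b i \<noteq> b' i"
      then have "int M \<le> \<bar>b i - b' i\<bar>" using dv by (intro zdvd_imp_le) auto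
      moreover have "b i \<in> {-2 * int R..2 * int R}" "b' i \<in> {-2 * int R..2 * int R}"
        using that by (auto simp: lattice_cube_def PiE_iff)
      ultimately show False using assms by auto
    qed
    then show "b = b'" by blast
  qed auto
  have "of_real (\<Sum>t\<in>frequencies M. (norm (\<Sum>b\<in>lattice_cube R. c b * ?e t b))\<^sup>2) =
    (\<Sum>t\<in>frequencies M. \<Sum>b\<in>lattice_cube R. \<Sum>b'\<in>lattice_cube R. c b * cnj (c b') * ?e t (\<lambda>i. b i - b' i))"
    by (simp add: complex_norm_square cnj_sum sum_product ee[symmetric] mult_ac del: of_real_power)
  also have "\<dots> = (\<Sum>b\<in>lattice_cube R. \<Sum>b'\<in>lattice_cube R. c b * cnj (c b') * (\<Sum>t\<in>frequencies M. ?e t (\<lambda>i. b i - b' i)))"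
    by (subst sum_rotate) (simp only: sum_distrib_left)
  also have "\<dots> = (\<Sum>b\<in>lattice_cube R. \<Sum>b'\<in>lattice_cube R. if b = b' then c b * cnj (c b') * of_nat M ^ CARD('d) else 0)"
    by (intro sum.cong refl) (simp only: sum_frequencies_root_char[OF M] eq, auto)
  also have "\<dots> = of_real (real M ^ CARD('d) * (\<Sum>b\<in>lattice_cube R. (norm (c b))\<^sup>2))"
    by (simp add: finite_lattice_cube complex_norm_square[symmetric] sum_distrib_left mult_ac)
  finally show ?thesis by (simp only: of_real_eq_iff)
qed

definition cube_weight :: "nat \<Rightarrow> ('d::finite \<Rightarrow> int) \<Rightarrow> real" where
  "cube_weight R b = (\<Prod>i\<in>UNIV. triangle R (b i))"

text \<open>
  The contribution of the fraction \<open>k/M\<close> in the circle method for the equation \<open>\<bar>b\<bar>\<^sup>2 = m\<close>.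
\<close>
definition circle_term :: "nat \<Rightarrow> nat \<Rightarrow> int \<Rightarrow> nat \<Rightarrow> ('d::finite \<Rightarrow> int) \<Rightarrow> complex" where
  "circle_term M R m k t = root_char M (- (int k * m)) * (\<Prod>i\<in>UNIV. weyl_sum M R (int k) (t i))"

lemma cube_weight_nonneg: "0 \<le> cube_weight R b"
  by (auto simp: cube_weight_def triangle_nonneg intro!: prod_nonneg)

lemma cube_weight_le_1: "cube_weight R b \<le> 1"
  by (auto simp: cube_weight_def triangle_nonneg triangle_le_1 intro!: prod_le_1)

lemma prod_weyl_sum:
  fixes t :: "'d::finite \<Rightarrow> int"
  shows "(\<Prod>i\<in>UNIV. weyl_sum M R k (t i)) =
     (\<Sum>b\<in>lattice_cube R. cube_weight R b * root_char M (k * sq_norm b) * root_char M (\<Sum>i\<in>UNIV. t i * b i))"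
  unfolding weyl_sum_root_char lattice_cube_def cube_weight_def sq_norm_def sum_distrib_left root_char_sum
    of_real_prod root_char_add
  by (subst prod_sum_PiE) (simp_all add: prod.distrib mult.assoc)

lemma circle_term_expand:
  "circle_term M R m k t =
     (\<Sum>b\<in>lattice_cube R. cube_weight R b * root_char M (int k * (sq_norm b - m)) * root_char M (\<Sum>i\<in>UNIV. t i * b i))"
  unfolding circle_term_def prod_weyl_sum sum_distrib_left
  by (intro sum.cong refl) (simp add: right_diff_distrib root_char_add[of M "int k * sq_norm _" "- (int k * m)", simplified])

text \<open>
  By Parseval the left-hand side is \<open>M\<^sup>d\<close> times a weighted sum of \<open>\<bar>g(b)\<bar>\<^sup>2\<close>, where \<open>g(b)\<close> is a sum of characters
  over \<open>A\<close>. Replacing the squared weight by the weight, which is at most one, and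
  expanding the square produces the Weyl sums at the differences \<open>k - k'\<close> again; for fixed \<open>k\<close> these differences are
  distinct modulo \<open>M\<close>.
\<close>
lemma circle_term_L2:
  assumes "M > 4 * R" "A \<subseteq> {0..<M}"
  shows "(\<Sum>t\<in>(frequencies M :: ('d::finite \<Rightarrow> int) set). (norm (\<Sum>k\<in>A. circle_term M R m k t))\<^sup>2)
    \<le> real (card A) * (real M ^ CARD('d) * (\<Sum>k\<in>{0..<M}. norm (weyl_sum M R (int k) 0) ^ CARD('d)))"
proof -
  have M: "M > 0" using assms by simp
  define g where "g = (\<lambda>b :: 'd \<Rightarrow> int. \<Sum>k\<in>A. root_char M (int k * (sq_norm b - m)))"
  have "(\<Sum>k\<in>A. circle_term M R m k t) = (\<Sum>b\<in>lattice_cube R. (cube_weight R b * g b) * root_char M (\<Sum>i\<in>UNIV. t i * b i))" for t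
    unfolding circle_term_expand g_def
    by (subst sum.swap) (simp only: sum_distrib_left sum_distrib_right)
  then have "(\<Sum>t\<in>(frequencies M :: ('d \<Rightarrow> int) set). (norm (\<Sum>k\<in>A. circle_term M R m k t))\<^sup>2)
      = real M ^ CARD('d) * (\<Sum>b\<in>(lattice_cube R :: ('d \<Rightarrow> int) set). (norm (cube_weight R b * g b))\<^sup>2)"
    using parseval_lattice_cube[OF assms(1), of "\<lambda>b. cube_weight R b * g b"] by simp
  also have "\<dots> \<le> real M ^ CARD('d) * (\<Sum>b\<in>(lattice_cube R :: ('d \<Rightarrow> int) set). cube_weight R b * (norm (g b))\<^sup>2)"
  proof (intro mult_left_mono sum_mono)
    fix b :: "'d \<Rightarrow> int"
    have "(norm (cube_weight R b * g b))\<^sup>2 = (cube_weight R b * cube_weight R b) * (norm (g b))\<^sup>2"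
      by (simp add: norm_mult power2_eq_square mult_ac)
    also have "\<dots> \<le> (cube_weight R b * 1) * (norm (g b))\<^sup>2"
      using cube_weight_nonneg[of R b] cube_weight_le_1[of R b] by (intro mult_right_mono mult_left_mono) auto
    finally show "(norm (cube_weight R b * g b))\<^sup>2 \<le> cube_weight R b * (norm (g b))\<^sup>2" by simp
  qed auto
  also have "(\<Sum>b\<in>(lattice_cube R :: ('d \<Rightarrow> int) set). cube_weight R b * (norm (g b))\<^sup>2)
      \<le> real (card A) * (\<Sum>k\<in>{0..<M}. norm (weyl_sum M R (int k) 0) ^ CARD('d))"
  proof -
    have gg: "of_real ((norm (g b))\<^sup>2) = (\<Sum>k\<in>A. \<Sum>k'\<in>A. root_char M (- ((int k - int k') * m)) * root_char M ((int k - int k') * sq_norm b))" for b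
    proof -
      have "root_char M (int k * (sq_norm b - m)) * cnj (root_char M (int k' * (sq_norm b - m)))
         = root_char M (- ((int k - int k') * m)) * root_char M ((int k - int k') * sq_norm b)" for k k'
        unfolding cnj_root_char root_char_add[symmetric] by (rule arg_cong[of _ _ "root_char M"]) (simp add: algebra_simps)
      then show ?thesis
        by (simp add: complex_norm_square g_def cnj_sum sum_product del: of_real_power)
    qed
    have "of_real (\<Sum>b\<in>(lattice_cube R :: ('d \<Rightarrow> int) set). cube_weight R b * (norm (g b))\<^sup>2)
       = (\<Sum>b\<in>(lattice_cube R :: ('d \<Rightarrow> int) set). \<Sum>k\<in>A. \<Sum>k'\<in>A. root_char M (- ((int k - int k') * m)) *
            (cube_weight R b * root_char M ((int k - int k') * sq_norm b)))"
      by (simp only: of_real_sum of_real_mult gg sum_distrib_left mult.left_commute)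
    also have "\<dots> = (\<Sum>k\<in>A. \<Sum>k'\<in>A. root_char M (- ((int k - int k') * m)) *
         (\<Sum>b\<in>(lattice_cube R :: ('d \<Rightarrow> int) set). cube_weight R b * root_char M ((int k - int k') * sq_norm b)))"
      by (subst sum_rotate) (simp only: sum_distrib_left)
    also have "\<dots> = (\<Sum>k\<in>A. \<Sum>k'\<in>A. root_char M (- ((int k - int k') * m)) *
         (weyl_sum M R (int k - int k') 0) ^ CARD('d))"
      using prod_weyl_sum[where t = "\<lambda>_ :: 'd. 0"] by (simp add: root_char_0)
    finally have "norm (complex_of_real (\<Sum>b\<in>(lattice_cube R :: ('d \<Rightarrow> int) set). cube_weight R b * (norm (g b))\<^sup>2))
        \<le> (\<Sum>k\<in>A. \<Sum>k'\<in>A. norm (weyl_sum M R (int k - int k') 0) ^ CARD('d))"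
      by (simp only:) (intro order_trans[OF norm_sum] sum_mono, simp add: norm_mult norm_root_char norm_power)
    then have "(\<Sum>b\<in>(lattice_cube R :: ('d \<Rightarrow> int) set). cube_weight R b * (norm (g b))\<^sup>2)
        \<le> (\<Sum>k\<in>A. \<Sum>k'\<in>A. norm (weyl_sum M R (int k - int k') 0) ^ CARD('d))"
      unfolding norm_of_real by linarith
    also have "\<dots> \<le> (\<Sum>k\<in>A. \<Sum>j\<in>{0..<M}. norm (weyl_sum M R (int j) 0) ^ CARD('d))"
    proof (rule sum_mono)
      fix k assume "k \<in> A"
      let ?W = "\<lambda>j. norm (weyl_sum M R j 0) ^ CARD('d)"
      let ?r = "\<lambda>k'. nat ((int k - int k') mod int M)"
      have "?W (int k - int k') = ?W (int (?r k'))" for k'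
      proof -
        have "int k - int k' = int (?r k') + int M * ((int k - int k') div int M)" using M by simp
        then show ?thesis using weyl_sum_periodic[OF M] by metis
      qed
      then have "(\<Sum>k'\<in>A. ?W (int k - int k')) = (\<Sum>k'\<in>A. ?W (int (?r k')))" by simp
      also have "\<dots> = (\<Sum>j\<in>?r ` A. ?W (int j))"
      proof (rule sum.reindex[symmetric, unfolded o_def])
        show "inj_on ?r A"
        proof (rule inj_onI)
          fix x y assume xy: "x \<in> A" "y \<in> A" "?r x = ?r y"
          then have "(int k - int x) mod int M = (int k - int y) mod int M"
            using M by (metis eq_nat_nat_iff of_nat_0_less_iff pos_mod_sign)
          then have "int M dvd (int k - int x) - (int k - int y)" by (simp add: mod_eq_dvd_iff)
          then have "int M dvd int y - int x" by simp
          moreover have "x < M" "y < M" using xy assms(2) by auto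
          then have "\<bar>int y - int x\<bar> < int M" by linarith
          ultimately show "x = y" using zdvd_imp_le[of "int M" "\<bar>int y - int x\<bar>"] by (cases "x = y") auto
        qed
      qed
      also have "\<dots> \<le> (\<Sum>j\<in>{0..<M}. ?W (int j))"
        using M by (intro sum_mono2) (auto simp: nat_less_iff)
      finally show "(\<Sum>k'\<in>A. ?W (int k - int k')) \<le> (\<Sum>j\<in>{0..<M}. ?W (int j))" .
    qed
    also have "\<dots> = real (card A) * (\<Sum>k\<in>{0..<M}. norm (weyl_sum M R (int k) 0) ^ CARD('d))" by simp
    finally show ?thesis .
  qed
  finally show ?thesis by (simp add: mult_left_mono mult.left_commute)
qed

section \<open>The upper bound for the energy\<close>

definition lattice_shell :: "nat \<Rightarrow> int \<Rightarrow> ('d::finite \<Rightarrow> int) set" where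
  "lattice_shell R m = {b \<in> lattice_cube R. sq_norm b = m}"

lemma finite_lattice_shell: "finite (lattice_shell R m)"
  by (simp add: lattice_shell_def finite_lattice_cube)

lemma lattice_shell_coord:
  assumes "b \<in> lattice_shell R m" "m \<le> (int R)\<^sup>2"
  shows "\<bar>b i\<bar> \<le> int R"
proof -
  have "(b i)\<^sup>2 \<le> (\<Sum>j\<in>UNIV. (b j)\<^sup>2)" by (rule member_le_sum) auto
  also have "\<dots> \<le> (int R)\<^sup>2" using assms by (simp add: lattice_shell_def sq_norm_def)
  finally have "\<bar>b i\<bar> \<le> \<bar>int R\<bar>" by (simp only: abs_le_square_iff)
  then show ?thesis by simp
qed

lemma cube_weight_lattice_shell:
  fixes b :: "'d::finite \<Rightarrow> int"
  assumes "b \<in> lattice_shell R m" "m \<le> (int R)\<^sup>2" "R > 0"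
  shows "(1 / 2) ^ CARD('d) \<le> cube_weight R b"
proof -
  have "(\<Prod>i\<in>(UNIV :: 'd set). 1 / 2) \<le> cube_weight R b"
    unfolding cube_weight_def
    using triangle_ge_half[OF assms(3)] lattice_shell_coord[OF assms(1,2)] by (intro prod_mono) auto
  then show ?thesis by simp
qed

text \<open>
  Summing over all fractions picks out the points with \<open>\<bar>b\<bar>\<^sup>2 \<equiv> m\<close> modulo \<open>M\<close>. On the cube \<open>\<bar>b\<bar>\<^sup>2\<close> is at most
  \<open>4dR\<^sup>2 = M\<close>, so for \<open>0 < m < M\<close> the congruence is an equality.
\<close>
lemma sum_circle_term:
  fixes t :: "'d::finite \<Rightarrow> int"
  assumes "R > 0" "0 < m" "m \<le> (int R)\<^sup>2" "M = 4 * CARD('d) * R\<^sup>2"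
  shows "(\<Sum>k\<in>{0..<M}. circle_term M R m k t) =
     of_nat M * (\<Sum>b\<in>lattice_shell R m. cube_weight R b * root_char M (\<Sum>i\<in>UNIV. t i * b i))"
proof -
  have M: "M > 0" using assms by simp
  have dv: "int M dvd sq_norm b - m \<longleftrightarrow> sq_norm b = m" if b: "b \<in> lattice_cube R" for b :: "'d \<Rightarrow> int"
  proof
    assume dvd: "int M dvd sq_norm b - m"
    have "(b i)\<^sup>2 \<le> 4 * (int R)\<^sup>2" for i
    proof -
      have "b i \<in> {-2 * int R..2 * int R}" using b by (auto simp: lattice_cube_def PiE_iff)
      then have "\<bar>b i\<bar> \<le> \<bar>2 * int R\<bar>" by auto
      then show ?thesis unfolding abs_le_square_iff by (simp add: power_mult_distrib)
    qed
    then have "sq_norm b \<le> (\<Sum>i\<in>(UNIV :: 'd set). 4 * (int R)\<^sup>2)"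
      unfolding sq_norm_def by (intro sum_mono)
    then have "sq_norm b - m < int M" using assms by simp
    moreover have "sq_norm b \<ge> 0" by (simp add: sq_norm_def sum_nonneg)
    moreover have "m < int M"
    proof -
      have "(int R)\<^sup>2 * 1 < (int R)\<^sup>2 * (4 * int CARD('d))"
      proof (rule mult_strict_left_mono)
        have "0 < CARD('d)" by simp
        then show "1 < 4 * int CARD('d)" by linarith
      qed (use assms(1) in simp)
      moreover have "int M = (int R)\<^sup>2 * (4 * int CARD('d))" by (simp add: assms(4))
      ultimately show ?thesis using assms(3) by linarith
    qed
    ultimately have "\<bar>sq_norm b - m\<bar> < int M" by linarith
    then show "sq_norm b = m" using dvd zdvd_imp_le[of "int M" "\<bar>sq_norm b - m\<bar>"] by (cases "sq_norm b = m") auto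
  qed auto
  have "(\<Sum>k\<in>{0..<M}. root_char M (int k * j)) = (if int M dvd j then of_nat M else 0)" for j
  proof -
    have "(\<Sum>k\<in>{0..<M}. root_char M (int k * j)) = (\<Sum>t\<in>{0..<int M}. root_char M (t * j))"
      by (rule sum.reindex_bij_witness[of _ nat int]) auto
    then show ?thesis by (simp only: sum_root_char[OF M])
  qed
  note char = this
  have "(\<Sum>k\<in>{0..<M}. circle_term M R m k t) = (\<Sum>b\<in>lattice_cube R. (\<Sum>k\<in>{0..<M}. root_char M (int k * (sq_norm b - m))) *
      (cube_weight R b * root_char M (\<Sum>i\<in>UNIV. t i * b i)))"
    unfolding circle_term_expand by (subst sum.swap) (simp add: sum_distrib_left sum_distrib_right mult_ac)
  also have "\<dots> = (\<Sum>b\<in>lattice_cube R. if sq_norm b = m then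
      of_nat M * (cube_weight R b * root_char M (\<Sum>i\<in>UNIV. t i * b i)) else 0)"
    by (intro sum.cong refl) (simp only: char dv, simp)
  also have "\<dots> = of_nat M * (\<Sum>b\<in>lattice_shell R m. cube_weight R b * root_char M (\<Sum>i\<in>UNIV. t i * b i))"
    unfolding sum_distrib_left lattice_shell_def by (rule sum.inter_filter[symmetric, OF finite_lattice_cube])
  finally show ?thesis .
qed

definition coord_energy :: "nat \<Rightarrow> ('d \<Rightarrow> int) set \<Rightarrow> (nat \<Rightarrow> 'd \<Rightarrow> int) set" where
  "coord_energy n F = {a \<in> {1..2 * n} \<rightarrow>\<^sub>E F. \<forall>j. (\<Sum>i = 1..n. a i j) = (\<Sum>i = n + 1..2 * n. a i j)}"

text \<open>
  Expanding the \<open>2n\<close>-th power gives a sum over \<open>2n\<close>-tuples, and averaging over the frequencies keeps those with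
  \<open>a\<^sub>1 + \<dots> + a\<^sub>n \<equiv> a\<^sub>n\<^sub>+\<^sub>1 + \<dots> + a\<^sub>2\<^sub>n\<close> modulo \<open>M\<close>. Their weights are non-negative, so tuples with equality provide a lower bound.
\<close>
lemma energy_moment:
  fixes w :: "('d::finite \<Rightarrow> int) \<Rightarrow> real" and F :: "('d \<Rightarrow> int) set" and \<delta> :: real
  assumes M: "M > 0" and finF: "finite F" and \<delta>: "\<delta> \<ge> 0" and w: "\<And>b. b \<in> F \<Longrightarrow> \<delta> \<le> w b"
  shows "real (card (coord_energy n F)) * (\<delta> ^ (2 * n) * real M ^ CARD('d))
    \<le> (\<Sum>t\<in>frequencies M. norm (\<Sum>b\<in>F. w b * root_char M (\<Sum>i\<in>UNIV. t i * b i)) ^ (2 * n))"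
proof -
  define s where "s = (\<lambda>i. if i \<le> n then 1 else -1 :: int)"
  define G where "G = (\<lambda>t::'d \<Rightarrow> int. \<Sum>b\<in>F. w b * root_char M (\<Sum>i\<in>UNIV. t i * b i))"
  let ?I = "{1..2 * n}"
  let ?T = "?I \<rightarrow>\<^sub>E F"
  have I: "?I = {1..n} \<union> {n + 1..2 * n}" by auto
  have finT: "finite ?T" using finF by (intro finite_PiE) auto
  have signed: "(\<Sum>i\<in>?I. s i * f i) = (\<Sum>i = 1..n. f i) - (\<Sum>i = n + 1..2 * n. f i)" for f :: "nat \<Rightarrow> int"
    unfolding I by (subst sum.union_disjoint) (auto simp: s_def sum_negf)
  have G: "of_real (norm (G t) ^ (2 * n)) = (\<Sum>a\<in>?T. of_real (\<Prod>i\<in>?I. w (a i)) *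
      root_char M (\<Sum>j\<in>UNIV. t j * (\<Sum>i\<in>?I. s i * a i j)))" for t
  proof -
    have "of_real (norm (G t) ^ (2 * n)) = (of_real ((norm (G t))\<^sup>2) :: complex) ^ n" by (simp add: power_mult)
    also have "\<dots> = (G t * cnj (G t)) ^ n" by (simp only: complex_norm_square)
    also have "\<dots> = (\<Prod>i\<in>{1..n}. G t) * (\<Prod>i\<in>{n + 1..2 * n}. cnj (G t))"
      by (simp add: power_mult_distrib)
    also have "\<dots> = (\<Prod>i\<in>?I. if i \<le> n then G t else cnj (G t))"
      unfolding I by (subst prod.union_disjoint) auto
    also have "\<dots> = (\<Prod>i\<in>?I. \<Sum>b\<in>F. w b * root_char M (s i * (\<Sum>j\<in>UNIV. t j * b j)))"
      by (intro prod.cong refl) (simp add: s_def G_def cnj_sum cnj_root_char)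
    also have "\<dots> = (\<Sum>a\<in>?T. \<Prod>i\<in>?I. w (a i) * root_char M (s i * (\<Sum>j\<in>UNIV. t j * a i j)))"
      using finF by (intro prod_sum_PiE) auto
    also have "\<dots> = (\<Sum>a\<in>?T. of_real (\<Prod>i\<in>?I. w (a i)) * root_char M (\<Sum>i\<in>?I. s i * (\<Sum>j\<in>UNIV. t j * a i j)))"
      by (simp only: prod.distrib root_char_sum of_real_prod)
    also have "(\<lambda>a. \<Sum>i\<in>?I. s i * (\<Sum>j\<in>UNIV. t j * a i j)) = (\<lambda>a. \<Sum>j\<in>UNIV. t j * (\<Sum>i\<in>?I. s i * a i j))"
      unfolding sum_distrib_left by (subst sum.swap) (simp only: mult.left_commute)
    finally show ?thesis by (simp add: fun_eq_iff)
  qed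
  have "complex_of_real (\<Sum>t\<in>frequencies M. norm (G t) ^ (2 * n)) =
     (\<Sum>a\<in>?T. of_real (\<Prod>i\<in>?I. w (a i)) * (\<Sum>t\<in>frequencies M. root_char M (\<Sum>j\<in>UNIV. t j * (\<Sum>i\<in>?I. s i * a i j))))"
    unfolding of_real_sum G by (subst sum.swap) (simp only: sum_distrib_left)
  also have "\<dots> = of_real (\<Sum>a\<in>?T. (\<Prod>i\<in>?I. w (a i)) *
      (if \<forall>j. int M dvd (\<Sum>i\<in>?I. s i * a i j) then real M ^ CARD('d) else 0))"
    unfolding sum_frequencies_root_char[OF M] of_real_sum by (intro sum.cong refl) auto
  finally have moment: "(\<Sum>t\<in>frequencies M. norm (G t) ^ (2 * n)) = (\<Sum>a\<in>?T. (\<Prod>i\<in>?I. w (a i)) *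
      (if \<forall>j. int M dvd (\<Sum>i\<in>?I. s i * a i j) then real M ^ CARD('d) else 0))"
    by (simp only: of_real_eq_iff)
  have wpos: "0 \<le> w b" if "b \<in> F" for b using w[OF that] \<delta> by linarith
  have "real (card (coord_energy n F)) * (\<delta> ^ (2 * n) * real M ^ CARD('d)) = (\<Sum>a\<in>coord_energy n F. \<delta> ^ (2 * n) * real M ^ CARD('d))"
    by simp
  also have "\<dots> \<le> (\<Sum>a\<in>coord_energy n F. (\<Prod>i\<in>?I. w (a i)) *
      (if \<forall>j. int M dvd (\<Sum>i\<in>?I. s i * a i j) then real M ^ CARD('d) else 0))"
  proof (rule sum_mono)
    fix a assume a: "a \<in> coord_energy n F"
    then have "(\<Sum>i\<in>?I. s i * a i j) = 0" for j unfolding signed by (simp add: coord_energy_def)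
    then have dvd: "\<forall>j. int M dvd (\<Sum>i\<in>?I. s i * a i j)" by simp
    have "(\<Prod>i\<in>?I. \<delta>) \<le> (\<Prod>i\<in>?I. w (a i))"
      using a \<delta> w by (intro prod_mono) (auto simp: coord_energy_def PiE_iff)
    then have "\<delta> ^ (2 * n) * real M ^ CARD('d) \<le> (\<Prod>i\<in>?I. w (a i)) * real M ^ CARD('d)"
      by (intro mult_right_mono) auto
    then show "\<delta> ^ (2 * n) * real M ^ CARD('d) \<le> (\<Prod>i\<in>?I. w (a i)) *
        (if \<forall>j. int M dvd (\<Sum>i\<in>?I. s i * a i j) then real M ^ CARD('d) else 0)"
      by (simp only: if_P[OF dvd])
  qed
  also have "\<dots> \<le> (\<Sum>a\<in>?T. (\<Prod>i\<in>?I. w (a i)) *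
      (if \<forall>j. int M dvd (\<Sum>i\<in>?I. s i * a i j) then real M ^ CARD('d) else 0))"
  proof (rule sum_mono2[OF finT])
    show "coord_energy n F \<subseteq> ?T" unfolding coord_energy_def by blast
    fix a assume "a \<in> ?T - coord_energy n F"
    then have "0 \<le> (\<Prod>i\<in>?I. w (a i))" using wpos by (intro prod_nonneg) (blast dest: PiE_mem)
    then show "0 \<le> (\<Prod>i\<in>?I. w (a i)) *
        (if \<forall>j. int M dvd (\<Sum>i\<in>?I. s i * a i j) then real M ^ CARD('d) else 0)"
      by (intro mult_nonneg_nonneg) simp_all
  qed
  also note moment[symmetric]
  finally show ?thesis unfolding G_def .
qed

text \<open>
  The count of near-integer multiples is at least \<open>8 R y\<^sup>2\<close> where the level \<open>y\<close> is exceeded, provided \<open>8 R y\<^sup>2 \<ge> 1\<close>. For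
  smaller \<open>y\<close> the claimed bound exceeds the number \<open>4dR\<^sup>2\<close> of all fractions.
\<close>
lemma weak_L4_circle:
  assumes "R > 0" "d > 0"
  shows "weak_L4 {0..<4 * d * R\<^sup>2} (\<lambda>k. sqrt ((1 + real (near_integer_count (8 * R) (2 * real k / real (4 * d * R\<^sup>2)))) / (16 * real R)))
    (5 + real d / 8)"
proof
  define M where "M = 4 * d * R\<^sup>2"
  define L where "L = (\<lambda>k. real (near_integer_count (8 * R) (2 * real k / real M)))"
  define v where "v = (\<lambda>k. sqrt ((1 + L k) / (16 * real R)))"
  have LR: "0 \<le> L k" "L k \<le> real (8 * R)" for k
    using near_integer_count_le[of "8 * R"] unfolding L_def by (auto simp only: of_nat_le_iff of_nat_0_le_iff)
  show "0 < sqrt ((1 + real (near_integer_count (8 * R) (2 * real k / real (4 * d * R\<^sup>2)))) / (16 * real R))" for k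
    using assms by (simp add: add_pos_nonneg)
  show "sqrt ((1 + real (near_integer_count (8 * R) (2 * real k / real (4 * d * R\<^sup>2)))) / (16 * real R)) \<le> 1" for k
  proof -
    have "1 + L k \<le> 16 * real R" using LR(2)[of k] assms by simp
    then show ?thesis using assms by (simp add: L_def M_def)
  qed
  fix y :: real assume y: "0 < y"
  have MD: "real M = (real d / 16) * real (8 * R) ^ 2" by (simp add: M_def power_mult_distrib)
  have M0: "M > 0" using assms by (simp add: M_def)
  have "real (card {k \<in> {0..<M}. y < v k}) \<le> (5 + real d / 8) / y ^ 4"
  proof (cases "real (8 * R) * y\<^sup>2 \<ge> 1")
    case True
    have "card {k \<in> {0..<M}. y < v k} \<le> card {k \<in> {0..<M}. real (8 * R) * y\<^sup>2 \<le> L k}"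
    proof (intro card_mono subsetI)
      fix k assume k: "k \<in> {k \<in> {0..<M}. y < v k}"
      then have "y\<^sup>2 < (v k)\<^sup>2" using y by (intro power_strict_mono) auto
      also have "(v k)\<^sup>2 = (1 + L k) / (16 * real R)" using LR(1)[of k] by (simp add: v_def)
      finally have "2 * (real (8 * R) * y\<^sup>2) < 1 + L k" using assms by (simp add: field_simps)
      then show "k \<in> {k \<in> {0..<M}. real (8 * R) * y\<^sup>2 \<le> L k}" using True k by auto
    qed auto
    also have "real \<dots> \<le> (5 + 2 * (real d / 16)) * (real (8 * R) / (real (8 * R) * y\<^sup>2))\<^sup>2"
      unfolding L_def using assms y M0 by (intro card_near_integer_count_ge[OF MD]) auto
    also have "\<dots> = (5 + real d / 8) / y ^ 4"
      using assms by (simp add: power_divide power_mult[symmetric])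
    finally show ?thesis by simp
  next
    case False
    have "real (card {k \<in> {0..<M}. y < v k}) \<le> real (card {0..<M})"
      by (intro of_nat_mono card_mono) auto
    also have "\<dots> = (real d / 16) * real (8 * R) ^ 2" using MD by simp
    also have "\<dots> \<le> (real d / 16) * (1 / y\<^sup>2)\<^sup>2"
      using False y by (intro mult_left_mono power_mono) (auto simp: field_simps)
    also have "\<dots> = (real d / 16) / y ^ 4" by (simp add: power_divide power_mult[symmetric])
    also have "\<dots> \<le> (5 + real d / 8) / y ^ 4" using y by (intro divide_right_mono) auto
    finally show ?thesis .
  qed
  then show "real (card {k \<in> {0..<4 * d * R\<^sup>2}. y < sqrt ((1 + real (near_integer_count (8 * R) (2 * real k / real (4 * d * R\<^sup>2)))) / (16 * real R))})
     \<le> (5 + real d / 8) / y ^ 4"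
    by (simp only: v_def L_def M_def)
qed auto

lemma weyl_sum_le_level:
  assumes "R > 0"
  shows "norm (weyl_sum M R (int k) t) \<le>
    304 * real R * sqrt ((1 + real (near_integer_count (8 * R) (2 * real k / real M))) / (16 * real R))"
proof (rule power2_le_imp_le)
  define L where "L = real (near_integer_count (8 * R) (2 * real k / real M))"
  have "(norm (weyl_sum M R (int k) t))\<^sup>2 \<le> 5760 * real R * (1 + L)"
    using weyl_sum_bound[OF assms, of M "int k" t] by (simp add: L_def)
  \<comment> \<open>The constant is rounded up so that its product with \<open>16\<close> is the square of \<open>304\<close>.\<close>
  also have "\<dots> \<le> 5776 * real R * (1 + L)" by (intro mult_right_mono) (auto simp: L_def)
  also have "\<dots> = (304 * real R * sqrt ((1 + L) / (16 * real R)))\<^sup>2"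
    using assms by (simp add: power_mult_distrib L_def) (simp add: power2_eq_square)
  finally show "(norm (weyl_sum M R (int k) t))\<^sup>2 \<le> (304 * real R * sqrt ((1 + L) / (16 * real R)))\<^sup>2" .
qed auto

text \<open>
  The abstract interpolation is applied with \<open>D\<close> of order \<open>R\<close> and \<open>E\<close> of order \<open>M\<^sup>d R\<^sup>d\<close>. The resulting power
  \<open>R\<^sup>d\<^sup>(\<^sup>2\<^sup>n\<^sup>-\<^sup>1\<^sup>)\<close> is divided by \<open>M\<^sup>2\<^sup>n\<close>, the normalisation of the sum over the fractions, and
  \<open>M\<close> is at least \<open>R\<^sup>2\<close>.
\<close>
theorem energy_upper_bound:
  fixes n :: nat
  assumes d: "CARD('d::finite) = d" "d \<ge> 5" and n: "(n - 1) * (d - 4) \<ge> 3"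
  shows "\<exists>C\<ge>0. \<forall>R m. R > 0 \<longrightarrow> 0 < m \<longrightarrow> m \<le> (int R)\<^sup>2 \<longrightarrow>
    real (card (coord_energy n (lattice_shell R m :: ('d \<Rightarrow> int) set))) \<le> C * real R ^ (2 * n * (d - 2) - d)"
proof -
  have n1: "n \<ge> 2" using n by (cases "n \<ge> 2") auto
  define C0 where "C0 = 5 + real d / 8"
  define C1 where "C1 = 2 ^ (2 * n) * (C0 * 2 ^ (4 * n)) ^ (2 * n - 1)"
  define C where "C = 2 ^ (d * (2 * n)) * C1 * (32 * C0) * 304 ^ (d * (2 * n - 1))"
  have C0: "C0 \<ge> 0" by (simp add: C0_def)
  have C1: "C1 \<ge> 0" using C0 by (simp add: C1_def)
  have "real (card (coord_energy n (lattice_shell R m :: ('d \<Rightarrow> int) set))) \<le> C * real R ^ (2 * n * (d - 2) - d)"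
    if R: "R > 0" and m: "0 < m" "m \<le> (int R)\<^sup>2" for R m
  proof -
    define M where "M = 4 * d * R\<^sup>2"
    define e where "e = real (card (coord_energy n (lattice_shell R m :: ('d \<Rightarrow> int) set)))"
    define v where "v = (\<lambda>k. sqrt ((1 + real (near_integer_count (8 * R) (2 * real k / real M))) / (16 * real R)))"
    interpret weak_L4 "{0..<M}" v C0
      unfolding M_def v_def C0_def using weak_L4_circle[of R d] R d by simp
    have M: "M > 4 * R"
    proof -
      have "4 * R * 1 < 4 * R * (d * R)" using R d by (intro mult_strict_left_mono) (auto intro: le_less_trans[OF _ less_le_trans[of 1 "d * 1"]])
      then show ?thesis by (simp add: M_def power2_eq_square)
    qed
    have vW: "norm (weyl_sum M R (int k) t) \<le> 304 * real R * v k" for k t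
      unfolding v_def by (rule weyl_sum_le_level[OF R])
    define Q where "Q = real M ^ d * (\<Sum>k\<in>{0..<M}. norm (weyl_sum M R (int k) 0) ^ d)"
    have "(\<Sum>k\<in>{0..<M}. norm (weyl_sum M R (int k) 0) ^ d) \<le> (\<Sum>k\<in>{0..<M}. (304 * real R) ^ d * v k ^ d)"
      unfolding power_mult_distrib[symmetric] by (intro sum_mono power_mono vW) auto
    also have "\<dots> = (304 * real R) ^ d * (\<Sum>k\<in>{0..<M}. v k ^ d)" by (simp only: sum_distrib_left)
    also have "\<dots> \<le> (304 * real R) ^ d * (32 * C0)" using moment_bound[OF d(2)] by (intro mult_left_mono) auto
    finally have Q: "Q \<le> real M ^ d * ((304 * real R) ^ d * (32 * C0))"
      unfolding Q_def by (intro mult_left_mono) auto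
    have Q0: "Q \<ge> 0" by (simp add: Q_def sum_nonneg)
    have "(\<Sum>t\<in>(frequencies M :: ('d \<Rightarrow> int) set). norm (\<Sum>k\<in>{0..<M}. circle_term M R m k t) ^ (2 * n))
        \<le> C1 * ((304 * real R) ^ d) ^ (2 * n - 2) * Q"
      unfolding C1_def
    proof (rule interpolation)
      fix k and t :: "'d \<Rightarrow> int"
      have "norm (circle_term M R m k t) = (\<Prod>i\<in>UNIV. norm (weyl_sum M R (int k) (t i)))"
        by (simp add: circle_term_def norm_mult norm_root_char prod_norm)
      also have "\<dots> \<le> (\<Prod>i\<in>(UNIV :: 'd set). 304 * real R * v k)" by (intro prod_mono) (auto intro: vW)
      finally show "norm (circle_term M R m k t) \<le> (304 * real R * v k) ^ d" using d by simp
    next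
      fix A assume "A \<subseteq> {0..<M}"
      then show "(\<Sum>t\<in>(frequencies M :: ('d \<Rightarrow> int) set). (norm (\<Sum>k\<in>A. circle_term M R m k t))\<^sup>2) \<le> real (card A) * Q"
        using circle_term_L2[OF M, where ?'d = 'd] d by (simp add: Q_def)
    qed (use n n1 Q0 in auto)
    also have "\<dots> \<le> C1 * ((304 * real R) ^ d) ^ (2 * n - 2) * (real M ^ d * ((304 * real R) ^ d * (32 * C0)))"
      using Q C1 by (intro mult_left_mono) auto
    also have "\<dots> = real M ^ d * (C1 * (32 * C0) * (304 * real R) ^ (d * (2 * n - 1)))"
    proof -
      have "2 * n - 1 = Suc (2 * n - 2)" using n1 by simp
      then have "(304 * real R) ^ (d * (2 * n - 1)) = ((304 * real R) ^ d) ^ (2 * n - 2) * (304 * real R) ^ d"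
        by (simp only: power_mult power_Suc2)
      then show ?thesis by (simp only: mult_ac)
    qed
    finally have up: "(\<Sum>t\<in>(frequencies M :: ('d \<Rightarrow> int) set). norm (\<Sum>k\<in>{0..<M}. circle_term M R m k t) ^ (2 * n))
      \<le> real M ^ d * (C1 * (32 * C0) * (304 * real R) ^ (d * (2 * n - 1)))" .
    have "e * (((1 / 2) ^ d) ^ (2 * n) * real M ^ d) * real M ^ (2 * n)
       \<le> (\<Sum>t\<in>(frequencies M :: ('d \<Rightarrow> int) set). norm (\<Sum>b\<in>lattice_shell R m. cube_weight R b * root_char M (\<Sum>i\<in>UNIV. t i * b i)) ^ (2 * n)) * real M ^ (2 * n)"
      unfolding e_def d(1)[symmetric] using M
      by (intro mult_right_mono energy_moment finite_lattice_shell cube_weight_lattice_shell[OF _ m(2) R]) auto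
    also have "\<dots> = (\<Sum>t\<in>(frequencies M :: ('d \<Rightarrow> int) set). norm (\<Sum>k\<in>{0..<M}. circle_term M R m k t) ^ (2 * n))"
    proof -
      have "(\<Sum>k\<in>{0..<M}. circle_term M R m k t) =
          of_nat M * (\<Sum>b\<in>lattice_shell R m. cube_weight R b * root_char M (\<Sum>i\<in>UNIV. t i * b i))"
        for t :: "'d \<Rightarrow> int"
        by (rule sum_circle_term[OF R m]) (simp add: M_def d(1))
      then show ?thesis
        unfolding norm_mult norm_of_nat power_mult_distrib sum_distrib_right by (simp add: norm_mult power_mult_distrib mult.commute)
    qed
    also note up
    finally have "real M ^ d * (e * ((1 / 2) ^ d) ^ (2 * n) * real M ^ (2 * n)) \<le> real M ^ d * (C1 * (32 * C0) * (304 * real R) ^ (d * (2 * n - 1)))"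
      by (simp only: mult_ac)
    then have 1: "e * ((1 / 2) ^ d) ^ (2 * n) * real M ^ (2 * n) \<le> C1 * (32 * C0) * (304 * real R) ^ (d * (2 * n - 1))"
      by (rule mult_left_le_imp_le) (use M in simp)
    have "R\<^sup>2 * 1 \<le> R\<^sup>2 * (4 * d)" using d by (intro mult_left_mono) auto
    then have "R\<^sup>2 \<le> M" by (simp add: M_def mult_ac)
    then have "(real R)\<^sup>2 \<le> real M" by (metis of_nat_le_iff of_nat_power)
    then have "((real R)\<^sup>2) ^ (2 * n) \<le> real M ^ (2 * n)" by (intro power_mono) auto
    then have "e * ((1 / 2) ^ d) ^ (2 * n) * ((real R)\<^sup>2) ^ (2 * n) \<le> e * ((1 / 2) ^ d) ^ (2 * n) * real M ^ (2 * n)"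
      by (intro mult_left_mono) (auto simp: e_def)
    with 1 have "e * ((1 / 2) ^ d) ^ (2 * n) * ((real R)\<^sup>2) ^ (2 * n) \<le> C1 * (32 * C0) * (304 * real R) ^ (d * (2 * n - 1))"
      by linarith
    also have "(304 * real R) ^ (d * (2 * n - 1)) = 304 ^ (d * (2 * n - 1)) * (real R ^ (2 * n * (d - 2) - d) * ((real R)\<^sup>2) ^ (2 * n))"
    proof -
      have "2 * n * (d - 2) \<ge> d"
      proof -
        have "2 * n * (d - 2) \<ge> 4 * (d - 2)" using n1 by (intro mult_right_mono) auto
        then show ?thesis using d by linarith
      qed
      moreover have "2 * n * (d - 2) + 4 * n = d * (2 * n - 1) + d"
      proof -
        obtain k l where "n = 2 + k" "d = 5 + l" using n1 d(2) le_Suc_ex by metis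
        then show ?thesis by (simp add: algebra_simps)
      qed
      ultimately have "d * (2 * n - 1) = (2 * n * (d - 2) - d) + 2 * (2 * n)" by linarith
      then have "real R ^ (d * (2 * n - 1)) = real R ^ (2 * n * (d - 2) - d) * ((real R)\<^sup>2) ^ (2 * n)"
        by (simp only: power_add power_mult[symmetric])
      then show ?thesis by (simp only: power_mult_distrib)
    qed
    finally have "((real R)\<^sup>2) ^ (2 * n) * (e * ((1 / 2) ^ d) ^ (2 * n)) \<le>
        ((real R)\<^sup>2) ^ (2 * n) * (C1 * (32 * C0) * 304 ^ (d * (2 * n - 1)) * real R ^ (2 * n * (d - 2) - d))"
      by (simp only: mult_ac)
    then have "e * ((1 / 2) ^ d) ^ (2 * n) \<le> C1 * (32 * C0) * 304 ^ (d * (2 * n - 1)) * real R ^ (2 * n * (d - 2) - d)"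
      by (rule mult_left_le_imp_le) (use R in simp)
    then have "2 ^ (d * (2 * n)) * (e * ((1 / 2) ^ d) ^ (2 * n)) \<le> 2 ^ (d * (2 * n)) * (C1 * (32 * C0) * 304 ^ (d * (2 * n - 1)) * real R ^ (2 * n * (d - 2) - d))"
      by (rule mult_left_mono) simp
    also have "2 ^ (d * (2 * n)) * (e * ((1 / 2) ^ d) ^ (2 * n)) = e"
      by (simp add: power_one_over power_mult)
    finally show ?thesis by (simp add: e_def C_def mult_ac)
  qed
  moreover have "C \<ge> 0" using C0 C1 by (simp add: C_def)
  ultimately show ?thesis by blast
qed

section \<open>Cauchy-Schwarz and the lower bound for the energy\<close>

text \<open>
  If \<open>r(x)\<close> counts the \<open>n\<close>-tuples with sum \<open>x\<close>, then \<open>r\<close> has total mass \<open>#F\<^sup>n\<close> on the set \<open>X\<close>, and the energy is the sum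
  of the squares of \<open>r\<close>; apply Cauchy-Schwarz.
\<close>
lemma additive_energy_lower:
  fixes F :: "'a::comm_monoid_add set"
  assumes finF: "finite F" and finX: "finite X" and X: "\<And>a. a \<in> {1..n} \<rightarrow>\<^sub>E F \<Longrightarrow> (\<Sum>i = 1..n. a i) \<in> X"
  shows "card F ^ (2 * n) \<le> card X * additive_energy n F"
proof -
  define r where "r = (\<lambda>x. {a \<in> {1..n} \<rightarrow>\<^sub>E F. (\<Sum>i = 1..n. a i) = x})"
  let ?P = "{a \<in> {1..2 * n} \<rightarrow>\<^sub>E F. (\<Sum>i = 1..n. a i) = (\<Sum>i = n + 1..2 * n. a i)}"
  have finr: "finite (r x)" for x
    unfolding r_def by (rule finite_subset[of _ "{1..n} \<rightarrow>\<^sub>E F"]) (auto intro: finite_PiE finF)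
  have finP: "finite ?P"
    by (rule finite_subset[of _ "{1..2 * n} \<rightarrow>\<^sub>E F"]) (auto intro: finite_PiE finF)
  have "card F ^ n = card ({1..n} \<rightarrow>\<^sub>E F)" by (simp add: card_PiE)
  also have "{1..n} \<rightarrow>\<^sub>E F = (\<Union>x\<in>X. r x)" using X by (auto simp: r_def)
  also have "card \<dots> = (\<Sum>x\<in>X. card (r x))"
    by (rule card_UN_disjoint) (auto simp: finX finr, auto simp: r_def)
  finally have Fr: "card F ^ n = (\<Sum>x\<in>X. card (r x))" .
  define h where "h = (\<lambda>(x :: 'a, a, a'). \<lambda>i\<in>{1..2 * n}. if i \<le> n then a i else a' (i - n) :: 'a)"
  have "card (SIGMA x:X. r x \<times> r x) \<le> card ?P"
  proof (rule card_inj_on_le[OF _ _ finP])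
    show "inj_on h (SIGMA x:X. r x \<times> r x)"
    proof (rule inj_onI)
      fix p q assume p: "p \<in> (SIGMA x:X. r x \<times> r x)" and q: "q \<in> (SIGMA x:X. r x \<times> r x)" and eq: "h p = h q"
      obtain x a a' where pe: "p = (x, a, a')" by (cases p) auto
      obtain y b b' where qe: "q = (y, b, b')" by (cases q) auto
      have a: "a \<in> r x" "a' \<in> r x" "b \<in> r y" "b' \<in> r y" using p q by (auto simp: pe qe)
      have eqi: "h p i = h q i" for i using eq by simp
      have "a = b"
      proof (rule PiE_ext)
        show "a \<in> {1..n} \<rightarrow>\<^sub>E F" "b \<in> {1..n} \<rightarrow>\<^sub>E F" using a by (auto simp: r_def)
        show "a i = b i" if "i \<in> {1..n}" for i using eqi[of i] that by (simp add: h_def pe qe)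
      qed
      moreover have "a' = b'"
      proof (rule PiE_ext)
        show "a' \<in> {1..n} \<rightarrow>\<^sub>E F" "b' \<in> {1..n} \<rightarrow>\<^sub>E F" using a by (auto simp: r_def)
        show "a' i = b' i" if "i \<in> {1..n}" for i using eqi[of "i + n"] that by (simp add: h_def pe qe)
      qed
      moreover have "x = y" using a \<open>a = b\<close> by (simp add: r_def)
      ultimately show "p = q" by (simp add: pe qe)
    qed
    show "h ` (SIGMA x:X. r x \<times> r x) \<subseteq> ?P"
    proof (rule image_subsetI)
      fix p assume p: "p \<in> (SIGMA x:X. r x \<times> r x)"
      obtain x a a' where pe: "p = (x, a, a')" by (cases p) auto
      have a: "a \<in> {1..n} \<rightarrow>\<^sub>E F" "a' \<in> {1..n} \<rightarrow>\<^sub>E F" "(\<Sum>i = 1..n. a i) = x" "(\<Sum>i = 1..n. a' i) = x"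
        using p by (auto simp: pe r_def)
      have "h p \<in> {1..2 * n} \<rightarrow>\<^sub>E F"
      proof
        fix i assume i: "i \<in> {1..2 * n}"
        show "h p i \<in> F"
        proof (cases "i \<le> n")
          case True
          then show ?thesis using i PiE_mem[OF a(1), of i] by (simp add: h_def pe)
        next
          case False
          then have "i - n \<in> {1..n}" using i by auto
          then show ?thesis using i False PiE_mem[OF a(2), of "i - n"] by (simp add: h_def pe)
        qed
      qed (auto simp: h_def pe)
      moreover have "(\<Sum>i = 1..n. h p i) = (\<Sum>i = 1..n. a i)"
        by (rule sum.cong) (auto simp: h_def pe)
      moreover have "(\<Sum>i = n + 1..2 * n. h p i) = (\<Sum>i = 1..n. a' i)"
        by (rule sum.reindex_bij_witness[of _ "\<lambda>i. i + n" "\<lambda>i. i - n"]) (auto simp: h_def pe)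
      ultimately show "h p \<in> ?P" using a(3,4) by simp
    qed
  qed
  then have sq: "(\<Sum>x\<in>X. (card (r x))\<^sup>2) \<le> additive_energy n F"
    by (subst (asm) card_SigmaI) (auto simp: finX finr card_cartesian_product power2_eq_square additive_energy_def)
  have "real (card F ^ (2 * n)) = (real (card F ^ n))\<^sup>2"
    by (simp add: power_mult[symmetric] mult.commute)
  also have "\<dots> = (\<Sum>x\<in>X. real (card (r x)))\<^sup>2" by (simp only: Fr of_nat_sum)
  also have "\<dots> \<le> (\<Sum>x\<in>X. (real (card (r x)))\<^sup>2) * real (card X)"
    by (rule sum_squared_le_sum_of_squares)
  also have "(\<Sum>x\<in>X. (real (card (r x)))\<^sup>2) \<le> real (additive_energy n F)"
    using sq by (simp flip: of_nat_power of_nat_sum)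
  finally have "real (card F ^ (2 * n)) \<le> real (additive_energy n F) * real (card X)"
    by (simp add: mult_right_mono)
  then show ?thesis by (simp add: mult.commute flip: of_nat_mult)
qed

text \<open>
  Points of the sphere are vectors with integral real coordinates, whereas the Fourier analysis is carried out for
  integer-valued functions; \<open>coords\<close> and \<open>of_coords\<close> translate between the two.
\<close>
definition coords :: "(real ^ 'd) \<Rightarrow> 'd \<Rightarrow> int" where
  "coords v i = \<lfloor>v $ i\<rfloor>"

definition of_coords :: "('d \<Rightarrow> int) \<Rightarrow> real ^ 'd" where
  "of_coords b = (\<chi> i. of_int (b i))"

lemma coords_of_coords: "coords (of_coords b) = b"
  by (simp add: coords_def of_coords_def fun_eq_iff)

lemma of_coords_coords: "\<forall>i. v $ i \<in> \<int> \<Longrightarrow> of_coords (coords v) = v"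
  by (simp add: coords_def of_coords_def vec_eq_iff Ints_def)

lemma lattice_sphere_eq:
  fixes N :: real and m :: int
  assumes "N > 0" "N\<^sup>2 = of_int m"
  shows "(lattice_sphere N :: (real ^ 'd::finite) set) = of_coords ` {b. sq_norm b = m}"
proof -
  have norm: "norm (of_coords b) = N \<longleftrightarrow> sq_norm b = m" for b :: "'d \<Rightarrow> int"
  proof -
    have "norm (of_coords b) = N \<longleftrightarrow> (norm (of_coords b))\<^sup>2 = N\<^sup>2"
      using assms(1) by (simp add: power2_eq_iff_nonneg)
    also have "(norm (of_coords b))\<^sup>2 = of_int (sq_norm b)"
      by (simp add: norm_vec_def L2_set_def sum_nonneg of_coords_def sq_norm_def)
    finally show ?thesis using assms(2) by simp
  qed
  show ?thesis
  proof (intro equalityI subsetI)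
    fix v :: "real ^ 'd" assume "v \<in> lattice_sphere N"
    then have v: "of_coords (coords v) = v" "norm v = N" by (auto simp: lattice_sphere_def of_coords_coords)
    then have "sq_norm (coords v) = m" using norm[of "coords v"] by simp
    then show "v \<in> of_coords ` {b. sq_norm b = m}" by (intro image_eqI[of v of_coords "coords v"]) (simp_all add: v(1))
  next
    fix v :: "real ^ 'd" assume "v \<in> of_coords ` {b. sq_norm b = m}"
    then obtain b where b: "v = of_coords b" "sq_norm b = m" by blast
    then show "v \<in> lattice_sphere N" using norm[of b] by (simp only: lattice_sphere_def mem_Collect_eq) (simp add: of_coords_def)
  qed
qed

lemma lattice_shell_eq:
  assumes "m \<le> (int R)\<^sup>2"
  shows "lattice_shell R m = {b. sq_norm b = m}"
proof -
  have "b \<in> lattice_cube R" if "sq_norm b = m" for b :: "'a \<Rightarrow> int"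
  proof -
    have "\<bar>b i\<bar> \<le> 2 * int R" for i
    proof -
      have "(b i)\<^sup>2 \<le> (\<Sum>j\<in>UNIV. (b j)\<^sup>2)" by (rule member_le_sum) auto
      also have "\<dots> \<le> (int R)\<^sup>2" using assms that by (simp add: sq_norm_def)
      finally have "\<bar>b i\<bar> \<le> \<bar>int R\<bar>" by (simp only: abs_le_square_iff)
      then show ?thesis by simp
    qed
    then show ?thesis by (auto simp: lattice_cube_def PiE_iff abs_le_iff minus_le_iff)
  qed
  then show ?thesis by (auto simp: lattice_shell_def)
qed

lemma additive_energy_of_coords:
  fixes F :: "('d::finite \<Rightarrow> int) set"
  shows "additive_energy n (of_coords ` F) = card (coord_energy n F)"
proof -
  let ?g = "\<lambda>a. \<lambda>i\<in>{1..2 * n}. of_coords (a i)" and ?h = "\<lambda>a. \<lambda>i\<in>{1..2 * n}. coords (a i)"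
  have sum_eq: "(\<Sum>i\<in>A. of_coords (a i)) = (\<Sum>i\<in>B. of_coords (a i)) \<longleftrightarrow> (\<forall>j. (\<Sum>i\<in>A. a i j) = (\<Sum>i\<in>B. a i j))"
    for A B and a :: "nat \<Rightarrow> 'd \<Rightarrow> int"
    by (simp add: vec_eq_iff of_coords_def flip: of_int_sum)
  have cong: "(\<Sum>i = 1..n. ?g a i) = (\<Sum>i = 1..n. of_coords (a i))"
     "(\<Sum>i = n + 1..2 * n. ?g a i) = (\<Sum>i = n + 1..2 * n. of_coords (a i))" for a :: "nat \<Rightarrow> 'd \<Rightarrow> int"
    by (auto intro!: sum.cong)
  have "bij_betw ?g (coord_energy n F)
      {a \<in> {1..2 * n} \<rightarrow>\<^sub>E of_coords ` F. (\<Sum>i = 1..n. a i) = (\<Sum>i = n + 1..2 * n. a i)}"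
  proof (rule bij_betwI[where g = ?h])
    show "?g \<in> coord_energy n F \<rightarrow> {a \<in> {1..2 * n} \<rightarrow>\<^sub>E of_coords ` F. (\<Sum>i = 1..n. a i) = (\<Sum>i = n + 1..2 * n. a i)}"
    proof
      fix a assume a: "a \<in> coord_energy n F"
      then have "?g a \<in> {1..2 * n} \<rightarrow>\<^sub>E of_coords ` F" by (auto simp: coord_energy_def PiE_iff)
      moreover have "(\<Sum>i = 1..n. ?g a i) = (\<Sum>i = n + 1..2 * n. ?g a i)"
        unfolding cong sum_eq using a by (simp add: coord_energy_def)
      ultimately show "?g a \<in> {a \<in> {1..2 * n} \<rightarrow>\<^sub>E of_coords ` F. (\<Sum>i = 1..n. a i) = (\<Sum>i = n + 1..2 * n. a i)}"
        by blast
    qed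
    have gh: "?g (?h a) = a" and hF: "?h a \<in> {1..2 * n} \<rightarrow>\<^sub>E F" if aT: "a \<in> {1..2 * n} \<rightarrow>\<^sub>E of_coords ` F" for a
    proof -
      show "?h a \<in> {1..2 * n} \<rightarrow>\<^sub>E F" using that by (auto simp: PiE_iff coords_of_coords)
      show "?g (?h a) = a"
      proof
        fix i
        show "?g (?h a) i = a i"
        proof (cases "i \<in> {1..2 * n}")
          case True
          then obtain b where "a i = of_coords b" using PiE_mem[OF aT True] by blast
          then show ?thesis using True by (simp add: coords_of_coords)
        next
          case False
          then show ?thesis by (simp only: restrict_apply if_not_P[OF False] if_False PiE_arb[OF aT False])
        qed
      qed
    qed
    show "?h \<in> {a \<in> {1..2 * n} \<rightarrow>\<^sub>E of_coords ` F. (\<Sum>i = 1..n. a i) = (\<Sum>i = n + 1..2 * n. a i)} \<rightarrow> coord_energy n F"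
    proof
      fix a assume a: "a \<in> {a \<in> {1..2 * n} \<rightarrow>\<^sub>E of_coords ` F. (\<Sum>i = 1..n. a i) = (\<Sum>i = n + 1..2 * n. a i)}"
      then have aP: "a \<in> {1..2 * n} \<rightarrow>\<^sub>E of_coords ` F" by blast
      have "(\<Sum>i = 1..n. ?g (?h a) i) = (\<Sum>i = n + 1..2 * n. ?g (?h a) i)" unfolding gh[OF aP] using a by blast
      then have "\<forall>j. (\<Sum>i = 1..n. ?h a i j) = (\<Sum>i = n + 1..2 * n. ?h a i j)" unfolding cong sum_eq .
      then show "?h a \<in> coord_energy n F" using hF[OF aP] unfolding coord_energy_def by blast
    qed
    show "?h (?g a) = a" if "a \<in> coord_energy n F" for a
    proof
      fix i
      have aT: "a \<in> {1..2 * n} \<rightarrow>\<^sub>E F" using that by (simp add: coord_energy_def)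
      show "?h (?g a) i = a i"
      proof (cases "i \<in> {1..2 * n}")
        case True
        then show ?thesis by (simp add: coords_of_coords)
      next
        case False
        then show ?thesis by (simp only: restrict_apply if_not_P[OF False] if_False PiE_arb[OF aT False])
      qed
    qed
    show "?g (?h b) = b" if "b \<in> {a \<in> {1..2 * n} \<rightarrow>\<^sub>E of_coords ` F. (\<Sum>i = 1..n. a i) = (\<Sum>i = n + 1..2 * n. a i)}" for b
      using that gh by blast
  qed
  then show ?thesis unfolding additive_energy_def by (rule bij_betw_same_card[symmetric])
qed

lemma sphere_radius:
  fixes N :: real
  assumes "N > 0" "N\<^sup>2 \<in> \<int>"
  obtains m :: int and R :: nat
  where "N\<^sup>2 = of_int m" "m > 0" "N \<ge> 1" "R > 0" "N \<le> real R" "real R \<le> 2 * N" "m \<le> (int R)\<^sup>2"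
proof -
  obtain m :: int where m: "N\<^sup>2 = of_int m" using assms(2) by (elim Ints_cases)
  have "0 < N\<^sup>2" using assms(1) by simp
  then have m0: "m > 0" unfolding m by simp
  have "1 \<le> N\<^sup>2" unfolding m using m0 by simp
  then have N1: "1 \<le> N" using assms(1) by (intro power2_le_imp_le[of 1 N]) auto
  define R where "R = nat \<lceil>N\<rceil>"
  have R: "N \<le> real R" "real R \<le> N + 1" using assms(1) unfolding R_def by linarith+
  have "N\<^sup>2 \<le> (real R)\<^sup>2" using R assms(1) by (intro power_mono) auto
  then have "real_of_int m \<le> of_int ((int R)\<^sup>2)" unfolding m by simp
  then have "m \<le> (int R)\<^sup>2" by (simp only: of_int_le_iff)
  moreover have "R > 0" using R(1) N1 by (cases R) auto
  ultimately show thesis using that m m0 N1 R by simp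
qed

lemma powr_energy_exponent:
  fixes N :: real
  assumes "N > 0" "d \<ge> 5" "n \<ge> 1"
  shows "N powr (2 * real n * (real d - 2) - real d) = N ^ (2 * n * (d - 2) - d)"
proof -
  have "d \<le> 2 * (d - 2)" using assms(2) by simp
  also have "\<dots> \<le> 2 * n * (d - 2)" using assms(3) by (intro mult_right_mono) auto
  finally have "real (2 * n * (d - 2) - d) = 2 * real n * (real d - 2) - real d"
    using assms(2) by (simp add: of_nat_diff)
  then show ?thesis using assms(1) by (metis powr_realpow)
qed

lemma lattice_sphere_energy_upper:
  assumes "CARD('d::finite) = d" "d \<ge> 5" "(n - 1) * (d - 4) \<ge> 3"
  shows "\<exists>C>0. \<forall>N. N > 0 \<and> N\<^sup>2 \<in> \<int> \<longrightarrow>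
     real (additive_energy n (lattice_sphere N :: (real ^ 'd) set)) \<le> C * N powr (2 * real n * (real d - 2) - real d)"
proof -
  have n1: "n \<ge> 1" using assms(3) by (cases n) auto
  define e where "e = 2 * n * (d - 2) - d"
  obtain C where C: "C \<ge> 0" "\<And>R m. R > 0 \<Longrightarrow> 0 < m \<Longrightarrow> m \<le> (int R)\<^sup>2 \<Longrightarrow>
    real (card (coord_energy n (lattice_shell R m :: ('d \<Rightarrow> int) set))) \<le> C * real R ^ e"
    using energy_upper_bound[OF assms] unfolding e_def by blast
  have "real (additive_energy n (lattice_sphere N :: (real ^ 'd) set)) \<le> (C * 2 ^ e + 1) * N powr (2 * real n * (real d - 2) - real d)"
    if N: "N > 0" "N\<^sup>2 \<in> \<int>" for N
  proof -
    obtain m R where mR: "N\<^sup>2 = of_int m" "m > 0" "N \<ge> 1" "R > 0" "N \<le> real R" "real R \<le> 2 * N" "m \<le> (int R)\<^sup>2"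
      by (rule sphere_radius[OF N])
    have "real (additive_energy n (lattice_sphere N :: (real ^ 'd) set)) = real (card (coord_energy n (lattice_shell R m :: ('d \<Rightarrow> int) set)))"
      by (simp only: lattice_sphere_eq[OF N(1) mR(1)] additive_energy_of_coords lattice_shell_eq[OF mR(7)])
    also have "\<dots> \<le> C * real R ^ e" by (rule C(2)[OF mR(4,2,7)])
    also have "\<dots> \<le> C * (2 * N) ^ e" using mR(6) C(1) by (intro mult_left_mono power_mono) auto
    also have "\<dots> \<le> (C * 2 ^ e + 1) * N ^ e" using N by (simp add: power_mult_distrib algebra_simps)
    finally show ?thesis using powr_energy_exponent[OF N(1) assms(2) n1] by (simp add: e_def)
  qed
  moreover have "C * 2 ^ e + 1 > 0" using C(1) by (simp add: add_nonneg_pos)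
  ultimately show ?thesis by blast
qed

lemma card_sphere_sums:
  fixes N :: real
  assumes "N > 0"
  shows "finite {v :: real ^ 'd::finite. \<forall>i. v $ i \<in> \<int> \<and> \<bar>v $ i\<bar> \<le> real n * N}"
    and "real (card {v :: real ^ 'd::finite. \<forall>i. v $ i \<in> \<int> \<and> \<bar>v $ i\<bar> \<le> real n * N}) \<le> (2 * (real n * N) + 1) ^ CARD('d)"
proof -
  define K where "K = \<lfloor>real n * N\<rfloor>"
  define B where "B = (UNIV \<rightarrow>\<^sub>E {-K..K} :: ('d \<Rightarrow> int) set)"
  have K: "0 \<le> K" using assms by (simp add: K_def)
  have finB: "finite B" unfolding B_def by (intro finite_PiE) auto
  have sub: "{v :: real ^ 'd. \<forall>i. v $ i \<in> \<int> \<and> \<bar>v $ i\<bar> \<le> real n * N} \<subseteq> of_coords ` B"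
  proof
    fix v :: "real ^ 'd" assume "v \<in> {v. \<forall>i. v $ i \<in> \<int> \<and> \<bar>v $ i\<bar> \<le> real n * N}"
    then have v: "\<And>i. v $ i \<in> \<int>" "\<And>i. \<bar>v $ i\<bar> \<le> real n * N" by auto
    have eq: "of_coords (coords v) = v" using v(1) by (intro of_coords_coords) auto
    have "coords v i \<in> {-K..K}" for i
    proof -
      have "v $ i = of_int (coords v i)" using arg_cong[OF eq, of "\<lambda>v. v $ i"] by (simp add: of_coords_def)
      then have "of_int \<bar>coords v i\<bar> \<le> real n * N" using v(2)[of i] by simp
      then have "\<bar>coords v i\<bar> \<le> K" unfolding K_def by (simp only: le_floor_iff)
      then show ?thesis by auto
    qed
    then have "coords v \<in> B" by (auto simp: B_def PiE_iff)
    then show "v \<in> of_coords ` B" using eq by (intro image_eqI[of v of_coords "coords v"]) simp_all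
  qed
  show "finite {v :: real ^ 'd. \<forall>i. v $ i \<in> \<int> \<and> \<bar>v $ i\<bar> \<le> real n * N}"
    by (rule finite_subset[OF sub]) (simp add: finB)
  have "card {v :: real ^ 'd. \<forall>i. v $ i \<in> \<int> \<and> \<bar>v $ i\<bar> \<le> real n * N} \<le> card (of_coords ` B)"
    using sub finB by (intro card_mono) auto
  also have "\<dots> \<le> card B" by (rule card_image_le[OF finB])
  also have "card B = nat (2 * K + 1) ^ CARD('d)" by (simp add: B_def card_PiE)
  finally have "real (card {v :: real ^ 'd. \<forall>i. v $ i \<in> \<int> \<and> \<bar>v $ i\<bar> \<le> real n * N}) \<le> real (nat (2 * K + 1)) ^ CARD('d)"
    by (simp only: of_nat_le_iff flip: of_nat_power)
  also have "\<dots> \<le> (2 * (real n * N) + 1) ^ CARD('d)"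
  proof (rule power_mono)
    have "real_of_int K \<le> real n * N" unfolding K_def by simp
    then show "real (nat (2 * K + 1)) \<le> 2 * (real n * N) + 1" using K by simp
  qed auto
  finally show "real (card {v :: real ^ 'd. \<forall>i. v $ i \<in> \<int> \<and> \<bar>v $ i\<bar> \<le> real n * N}) \<le> (2 * (real n * N) + 1) ^ CARD('d)" .
qed

lemma lattice_sphere_energy_lower:
  assumes d: "CARD('d::finite) = d" "d \<ge> 5" and n: "n \<ge> 1"
  shows "\<exists>c>0. \<forall>N. N > 0 \<and> N\<^sup>2 \<in> \<int> \<longrightarrow>
     c * N powr (2 * real n * (real d - 2) - real d) \<le> real (additive_energy n (lattice_sphere N :: (real ^ 'd) set))"
proof -
  define e where "e = 2 * n * (d - 2) - d"
  define c0 where "c0 = 4 / (4 * real d) ^ (d - 4)"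
  define c where "c = c0 ^ (2 * n) / (3 * real n) ^ d"
  have c0: "c0 > 0" using d by (simp add: c0_def)
  have "c * N powr (2 * real n * (real d - 2) - real d) \<le> real (additive_energy n (lattice_sphere N :: (real ^ 'd) set))"
    if N: "N > 0" "N\<^sup>2 \<in> \<int>" for N
  proof -
    obtain m R where mR: "N\<^sup>2 = of_int m" "m > 0" "N \<ge> 1" "R > 0" "N \<le> real R" "real R \<le> 2 * N" "m \<le> (int R)\<^sup>2"
      by (rule sphere_radius[OF N])
    let ?S = "lattice_sphere N :: (real ^ 'd) set"
    let ?B = "{b :: 'd \<Rightarrow> int. sq_norm b = m}"
    let ?X = "{v :: real ^ 'd. \<forall>i. v $ i \<in> \<int> \<and> \<bar>v $ i\<bar> \<le> real n * N}"
    have S: "?S = of_coords ` ?B" by (rule lattice_sphere_eq[OF N(1) mR(1)])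
    have finB: "finite ?B" using finite_lattice_shell[of R m] unfolding lattice_shell_eq[OF mR(7)] .
    have finS: "finite ?S" unfolding S using finB by simp
    have "inj_on (of_coords :: ('d \<Rightarrow> int) \<Rightarrow> _) ?B" by (rule inj_on_inverseI[where g = coords]) (rule coords_of_coords)
    then have cardS: "card ?S = card ?B" unfolding S by (rule card_image)
    have sqrt: "sqrt (of_int m) = N" using N(1) by (simp flip: mR(1))
    have "c0 * N ^ (d - 2) \<le> real (card ?S)"
    proof -
      have "d - 2 = 2 + (d - 4)" using d by simp
      then have "c0 * N ^ (d - 2) = 4 * N\<^sup>2 * (N / (4 * real d)) ^ (d - 4)"
        by (simp only: power_add) (simp add: c0_def power_divide)
      also have "\<dots> = 4 * real_of_int m * (sqrt (of_int m) / (4 * real d)) ^ (d - 4)" by (simp only: sqrt mR(1))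
      also have "\<dots> \<le> real (card ?B)" by (rule card_lattice_points_lower[OF d mR(2) finB])
      finally show ?thesis by (simp only: cardS)
    qed
    then have "(c0 * N ^ (d - 2)) ^ (2 * n) \<le> real (card ?S) ^ (2 * n)"
      using c0 N by (intro power_mono) auto
    also have "\<dots> = real (card ?S ^ (2 * n))" by simp
    also have "\<dots> \<le> real (card ?X * additive_energy n ?S)"
    proof (rule of_nat_mono, rule additive_energy_lower[OF finS card_sphere_sums(1)[OF N(1)]])
      fix a assume a: "a \<in> {1..n} \<rightarrow>\<^sub>E ?S"
      have "(\<Sum>j = 1..n. a j) $ i \<in> \<int> \<and> \<bar>(\<Sum>j = 1..n. a j) $ i\<bar> \<le> real n * N" for i
      proof
        have aj: "a j $ i \<in> \<int>" "\<bar>a j $ i\<bar> \<le> N" if "j \<in> {1..n}" for j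
        proof -
          have "a j \<in> ?S" using a that by (rule PiE_mem)
          then have "\<forall>i. a j $ i \<in> \<int>" "norm (a j) = N" by (auto simp: lattice_sphere_def)
          then show "a j $ i \<in> \<int>" "\<bar>a j $ i\<bar> \<le> N" using component_le_norm_cart[of "a j" i] by auto
        qed
        show "(\<Sum>j = 1..n. a j) $ i \<in> \<int>" unfolding sum_component by (rule Ints_sum) (rule aj(1))
        have "\<bar>(\<Sum>j = 1..n. a j) $ i\<bar> \<le> (\<Sum>j = 1..n. \<bar>a j $ i\<bar>)" by (simp add: sum_abs)
        also have "\<dots> \<le> (\<Sum>j = 1..n. N)" using aj(2) by (intro sum_mono) auto
        finally show "\<bar>(\<Sum>j = 1..n. a j) $ i\<bar> \<le> real n * N" by simp
      qed
      then show "(\<Sum>j = 1..n. a j) \<in> ?X" by blast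
    qed
    also have "\<dots> \<le> (3 * real n * N) ^ d * real (additive_energy n ?S)"
    proof -
      have "1 * 1 \<le> real n * N" using n mR(3) by (intro mult_mono) auto
      then have "2 * (real n * N) + 1 \<le> 3 * real n * N" by linarith
      then have "(2 * (real n * N) + 1) ^ CARD('d) \<le> (3 * real n * N) ^ d" unfolding d(1) using N(1) by (intro power_mono) auto
      then have "real (card ?X) \<le> (3 * real n * N) ^ d" using card_sphere_sums(2)[OF N(1), of n, where ?'d = 'd] by linarith
      then show ?thesis by (simp add: mult_right_mono)
    qed
    finally have main: "(c0 * N ^ (d - 2)) ^ (2 * n) \<le> (3 * real n * N) ^ d * real (additive_energy n ?S)" .
    have "d \<le> 2 * (d - 2)" using d(2) by simp
    also have "\<dots> \<le> 2 * n * (d - 2)" using n by (intro mult_right_mono) auto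
    finally have "(d - 2) * (2 * n) = d + e" by (simp add: e_def mult.commute)
    then have "(c0 * N ^ (d - 2)) ^ (2 * n) = N ^ d * (c0 ^ (2 * n) * N ^ e)"
      by (simp only: power_mult_distrib power_mult[symmetric] power_add mult_ac)
    moreover have "(3 * real n * N) ^ d * real (additive_energy n ?S) = N ^ d * ((3 * real n) ^ d * real (additive_energy n ?S))"
      by (simp only: power_mult_distrib mult_ac)
    ultimately have "c0 ^ (2 * n) * N ^ e \<le> (3 * real n) ^ d * real (additive_energy n ?S)"
      using main N(1) by (simp only: mult_le_cancel_left_pos zero_less_power)
    then have "c * N ^ e \<le> real (additive_energy n ?S)"
      using n by (simp add: c_def pos_divide_le_eq mult.commute)
    then show ?thesis using powr_energy_exponent[OF N(1) d(2) n] by (simp add: e_def)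
  qed
  moreover have "c > 0" using c0 n by (simp add: c_def)
  ultimately show ?thesis by blast
qed

theorem theorem1p5:
  fixes d n :: nat
  defines "E \<equiv> (\<lambda>N. real (additive_energy n (lattice_sphere N :: (real ^ 'd) set)))"
  assumes "CARD('d) = d" and "d \<ge> 5" and "n \<ge> 1"
  shows "((d \<ge> 9 \<and> n \<ge> 2) \<or> (d \<in> {7, 8} \<and> n \<ge> 3) \<or> (d = 6 \<and> n \<ge> 4) \<or> (d = 5 \<and> n \<ge> 6) \<longrightarrow>
           (\<exists>c C. 0 < c \<and> c \<le> C \<and>
             (\<forall>N. N > 0 \<and> N\<^sup>2 \<in> \<int> \<longrightarrow>
               c * N powr (2 * real n * (real d - 2) - real d) \<le> E N \<and>
               E N \<le> C * N powr (2 * real n * (real d - 2) - real d))))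
       \<and> (d \<ge> 9 \<and> n = 1 \<longrightarrow>
           (\<exists>c > 0. \<forall>N. N > 0 \<and> N\<^sup>2 \<in> \<int> \<longrightarrow>
               c * N powr (2 * real n * (real d - 2) - real d) \<le> E N))
       \<and> ((d \<in> {7, 8} \<and> n = 2) \<or> (d = 6 \<and> n = 3) \<or> (d = 5 \<and> n \<in> {4, 5}) \<longrightarrow>
           (\<exists>C. \<forall>N. N > 1 \<and> N\<^sup>2 \<in> \<int> \<longrightarrow>
               E N \<le> C * (ln N) powr ((real d - 2) / (real d - 4))
                       * N powr (2 * real n * (real d - 2) - real d)))"
proof -
  let ?e = "2 * real n * (real d - 2) - real d"
  obtain c where c: "c > 0" "\<And>N. N > 0 \<and> N\<^sup>2 \<in> \<int> \<Longrightarrow> c * N powr ?e \<le> E N"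
    using lattice_sphere_energy_lower[OF assms(2-4)] unfolding E_def by blast
  have upper: "\<exists>C>0. \<forall>N. N > 0 \<and> N\<^sup>2 \<in> \<int> \<longrightarrow> E N \<le> C * N powr ?e" if "(n - 1) * (d - 4) \<ge> 3"
    using lattice_sphere_energy_upper[OF assms(2,3) that] unfolding E_def .
  have prod: "3 \<le> (n - 1) * (d - 4)" if "k * l \<ge> 3" "k \<le> n - 1" "l \<le> d - 4" for k l
    using mult_le_mono[OF that(2,3)] that(1) by linarith
  have A: "\<exists>c C. 0 < c \<and> c \<le> C \<and> (\<forall>N. N > 0 \<and> N\<^sup>2 \<in> \<int> \<longrightarrow> c * N powr ?e \<le> E N \<and> E N \<le> C * N powr ?e)"
    if nd: "(n - 1) * (d - 4) \<ge> 3"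
  proof -
    obtain C where C: "C > 0" "\<And>N. N > 0 \<and> N\<^sup>2 \<in> \<int> \<Longrightarrow> E N \<le> C * N powr ?e" using upper[OF nd] by blast
    have "c \<le> C" using c(2)[of 1] C(2)[of 1] by simp
    then show ?thesis using c C by blast
  qed
  have B: "\<exists>C. \<forall>N. N > 1 \<and> N\<^sup>2 \<in> \<int> \<longrightarrow> E N \<le> C * (ln N) powr ((real d - 2) / (real d - 4)) * N powr ?e"
    if nd: "(n - 1) * (d - 4) \<ge> 3"
  proof -
    obtain C where C: "C > 0" "\<And>N. N > 0 \<and> N\<^sup>2 \<in> \<int> \<Longrightarrow> E N \<le> C * N powr ?e" using upper[OF nd] by blast
    let ?q = "(real d - 2) / (real d - 4)"
    have q: "?q \<ge> 0" using assms(3) by simp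
    have "E N \<le> (C / (ln 2 / 2) powr ?q) * (ln N) powr ?q * N powr ?e" if N: "N > 1" "N\<^sup>2 \<in> \<int>" for N
    proof -
      obtain m :: int where m: "N\<^sup>2 = of_int m" using N(2) by (elim Ints_cases)
      have "1 < N\<^sup>2" using N(1) by (simp add: one_less_power)
      then have "2 \<le> N\<^sup>2" unfolding m by simp
      then have "ln 2 \<le> ln (N\<^sup>2)" using N(1) by (subst ln_le_cancel_iff) auto
      also have "ln (N\<^sup>2) = 2 * ln N" using N(1) by (simp add: ln_realpow)
      finally have "ln 2 / 2 \<le> ln N" by simp
      then have "(ln 2 / 2) powr ?q \<le> (ln N) powr ?q" using q by (intro powr_mono2) auto
      then have "C * 1 \<le> C * ((ln N) powr ?q / (ln 2 / 2) powr ?q)"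
        using C(1) by (intro mult_left_mono) (auto simp: le_divide_eq)
      then have "C * N powr ?e \<le> (C / (ln 2 / 2) powr ?q) * (ln N) powr ?q * N powr ?e"
        by (intro mult_right_mono) auto
      then show ?thesis using C(2)[of N] N by linarith
    qed
    then show ?thesis by blast
  qed
  show ?thesis
  proof (intro conjI impI)
    assume "(d \<ge> 9 \<and> n \<ge> 2) \<or> (d \<in> {7, 8} \<and> n \<ge> 3) \<or> (d = 6 \<and> n \<ge> 4) \<or> (d = 5 \<and> n \<ge> 6)"
    then have "(n - 1) * (d - 4) \<ge> 3"
      using prod[of 1 5] prod[of 2 3] prod[of 3 2] prod[of 5 1] by auto
    then show "\<exists>c C. 0 < c \<and> c \<le> C \<and> (\<forall>N. N > 0 \<and> N\<^sup>2 \<in> \<int> \<longrightarrow> c * N powr ?e \<le> E N \<and> E N \<le> C * N powr ?e)"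
      by (rule A)
  next
    show "\<exists>c > 0. \<forall>N. N > 0 \<and> N\<^sup>2 \<in> \<int> \<longrightarrow> c * N powr ?e \<le> E N" using c by blast
  next
    assume "(d \<in> {7, 8} \<and> n = 2) \<or> (d = 6 \<and> n = 3) \<or> (d = 5 \<and> n \<in> {4, 5})"
    then have "(n - 1) * (d - 4) \<ge> 3" by auto
    then show "\<exists>C. \<forall>N. N > 1 \<and> N\<^sup>2 \<in> \<int> \<longrightarrow> E N \<le> C * (ln N) powr ((real d - 2) / (real d - 4)) * N powr ?e"
      by (rule B)
  qed
qed

end
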